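(* Let $n\ge3$, let $\Omega\subset\mathbb{R}^n$ be a bounded one-sided NTA domain, and let $\sigma$ be a $d$-Ahlfors regular measure supported on $\partial\Omega$ with $n-2<d<n$. Let $z_0\in\partial\Omega$, $0<r\le\operatorname{diam}(\Omega)$, $0<k<\frac{d}{n-2}$, $c>0$, and let $E\subset B(z_0,r)\cap\Omega$ be measurable with $|E|\ge c\,r^n$. Then there exist constants $C>0$ and $K>1$ such that, for every $u\in W^{1,2}(\Omega)$, $$\biggl(\frac{1}{\sigma(\Delta(z_0,r))}\int_{\Delta(z_0,r)}\bigl|\operatorname{Tr}u(z)-\overline u_E\bigr|^{2k}\,d\sigma(z)\biggr)^{\frac1{2k}}\le C\,r\,\biggl(\frac{1}{|B(z_0,Kr)\cap\Omega|}\int_{B(z_0,Kr)\cap\Omega}|\nabla u|^2\,dx\biggr)^{\frac12},$$ where $\overline u_E:=\frac1{|E|}\int_Eu\,dx$. Here $K$ depends only on the geometric constants of $(\Omega,\sigma)$, while $C$ depends only on the geometric constants of $(\Omega,\sigma)$, on $c$, and on $k$.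
   Context: Notation: $\delta(x)=\operatorname{dist}(x,\partial\Omega)$, $B(x,r)$ is the Euclidean ball, $\Delta(x,r)=B(x,r)\cap\partial\Omega$, $|\cdot|$ of a set is Lebesgue measure. One-sided NTA domain: an open set $\Omega$ for which there is a constant $M>1$ such that (H1) for every $z\in\partial\Omega$ and $0<r\le\operatorname{diam}(\Omega)$ there is a point $A_r(z)\in\Omega\cap B(z,r)$ with $\delta(A_r(z))\ge M^{-1}r$; and (H2) for all $0<r\le\operatorname{diam}(\Omega)$, all $\epsilon>0$, all integers $k\ge1$ and all $x,y\in\Omega$ with $|x-y|=r$, $\min\{\delta(x),\delta(y)\}\ge\epsilon$ and $2^k\epsilon\ge r$, there are points $x_1,\dots,x_{Mk}\in\Omega$ with $x_1=x$, $x_{Mk}=y$ and $x_{i+1}\in B(x_i,\delta(x_i)/2)$ for $i<Mk$ ($M$ may be taken an integer). $d$-Ahlfors regular measure: (H3) $\sigma$ is a Borel measure supported on $\partial\Omega$ with $M^{-1}r^d\le\sigma(\Delta(z,r))\le Mr^d$ for all $z\in\partial\Omega$, $0<r\le\operatorname{diam}(\Omega)$, for some $M\ge1$. The geometric constants of $(\Omega,\sigma)$ are the constants $M$ in (H1)-(H3), together with $d$ and $n$. Trace: $\operatorname{Tr}:W^{1,2}(\Omega)\to L^2(\partial\Omega,\sigma)$ is the bounded linear operator with $\operatorname{Tr}\varphi=\varphi|_{\partial\Omega}$ for $\varphi\in C_c^\infty(\mathbb{R}^n)$ (restrictions of such functions are dense in $W^{1,2}(\Omega)$). *)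

theory Defs
  imports "HOL-Analysis.Analysis"
begin

text \<open>\<open>0 < r \<le> diam \<Omega>\<close>. The library's \<^const>\<open>diameter\<close> is only meaningful for bounded sets;
  an unbounded set has infinite diameter, so every positive \<open>r\<close> is admissible for it.\<close>
definition admissible_radius :: "(real^'n) set \<Rightarrow> real \<Rightarrow> bool" where
  "admissible_radius \<Omega> r \<longleftrightarrow> 0 < r \<and> (bounded \<Omega> \<longrightarrow> r \<le> diameter \<Omega>)"

text \<open>Caution: \<^const>\<open>infdist\<close> to the empty set is \<open>0\<close>; the frontier of a nonempty bounded
  set is never empty.\<close>
definition bdist :: "(real^'n) set \<Rightarrow> real^'n \<Rightarrow> real" where
  "bdist \<Omega> x = infdist x (frontier \<Omega>)"

definition surface_ball :: "(real^'n) set \<Rightarrow> real^'n \<Rightarrow> real \<Rightarrow> (real^'n) set" where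
  "surface_ball \<Omega> z r = ball z r \<inter> frontier \<Omega>"

definition interior_corkscrew :: "nat \<Rightarrow> (real^'n) set \<Rightarrow> bool" where
  "interior_corkscrew M \<Omega> \<longleftrightarrow>
     (\<forall>z \<in> frontier \<Omega>. \<forall>r. admissible_radius \<Omega> r \<longrightarrow>
        (\<exists>a \<in> \<Omega> \<inter> ball z r. bdist \<Omega> a \<ge> r / real M))"

definition harnack_chain :: "nat \<Rightarrow> (real^'n) set \<Rightarrow> bool" where
  "harnack_chain M \<Omega> \<longleftrightarrow>
     (\<forall>r \<epsilon> (k::nat). \<forall>x \<in> \<Omega>. \<forall>y \<in> \<Omega>.
        admissible_radius \<Omega> r \<and> \<epsilon> > 0 \<and> k \<ge> 1 \<and> dist x y = r \<and>
        min (bdist \<Omega> x) (bdist \<Omega> y) \<ge> \<epsilon> \<and> 2 ^ k * \<epsilon> \<ge> r \<longrightarrow>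
        (\<exists>X :: nat \<Rightarrow> real^'n.
           (\<forall>i \<in> {1..M * k}. X i \<in> \<Omega>) \<and> X 1 = x \<and> X (M * k) = y \<and>
           (\<forall>i \<in> {1..<M * k}. X (i + 1) \<in> ball (X i) (bdist \<Omega> (X i) / 2))))"

definition one_sided_NTA :: "nat \<Rightarrow> (real^'n) set \<Rightarrow> bool" where
  "one_sided_NTA M \<Omega> \<longleftrightarrow>
     open \<Omega> \<and> M > 1 \<and> interior_corkscrew M \<Omega> \<and> harnack_chain M \<Omega>"

text \<open>As the frontier is closed, \<open>\<sigma>\<close> is supported on it iff its complement is a null set.\<close>
definition ahlfors_regular :: "real \<Rightarrow> real \<Rightarrow> (real^'n) set \<Rightarrow> (real^'n) measure \<Rightarrow> bool" where
  "ahlfors_regular M d \<Omega> \<sigma> \<longleftrightarrow>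
     M \<ge> 1 \<and> sets \<sigma> = sets borel \<and> emeasure \<sigma> (- frontier \<Omega>) = 0 \<and>
     (\<forall>z \<in> frontier \<Omega>. \<forall>r. admissible_radius \<Omega> r \<longrightarrow>
        ennreal (r powr d / M) \<le> emeasure \<sigma> (surface_ball \<Omega> z r) \<and>
        emeasure \<sigma> (surface_ball \<Omega> z r) \<le> ennreal (M * r powr d))"

definition partial_deriv :: "'n \<Rightarrow> (real^'n \<Rightarrow> real) \<Rightarrow> real^'n \<Rightarrow> real" where
  "partial_deriv i f x = frechet_derivative f (at x) (axis i 1)"

primrec C_k :: "nat \<Rightarrow> (real^'n \<Rightarrow> real) \<Rightarrow> bool" where
  "C_k 0 f \<longleftrightarrow> continuous_on UNIV f"
| "C_k (Suc k) f \<longleftrightarrow> (\<forall>x. f differentiable (at x)) \<and> (\<forall>i. C_k k (partial_deriv i f))"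

definition test_functions :: "(real^'n) set \<Rightarrow> (real^'n \<Rightarrow> real) set" where
  "test_functions U =
     {\<phi>. (\<forall>k. C_k k \<phi>) \<and> compact (closure {x. \<phi> x \<noteq> 0}) \<and> closure {x. \<phi> x \<noteq> 0} \<subseteq> U}"

text \<open>Elements of these spaces are represented by functions, not by classes modulo null sets.\<close>

definition square_int :: "'a measure \<Rightarrow> ('a \<Rightarrow> 'b::real_normed_vector) set" where
  "square_int M = {f \<in> borel_measurable M. integrable M (\<lambda>x. (norm (f x))\<^sup>2)}"

definition norm_L2 :: "'a measure \<Rightarrow> ('a \<Rightarrow> 'b::real_normed_vector) \<Rightarrow> real" where
  "norm_L2 M f = sqrt (\<integral>x. (norm (f x))\<^sup>2 \<partial>M)"

definition is_weak_grad ::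
    "(real^'n) set \<Rightarrow> (real^'n \<Rightarrow> real) \<Rightarrow> (real^'n \<Rightarrow> real^'n) \<Rightarrow> bool" where
  "is_weak_grad \<Omega> u g \<longleftrightarrow>
     (\<forall>\<phi> \<in> test_functions \<Omega>. \<forall>i.
        (\<integral>x. u x * partial_deriv i \<phi> x \<partial>lebesgue_on \<Omega>)
        = - (\<integral>x. g x $ i * \<phi> x \<partial>lebesgue_on \<Omega>))"

definition W12 :: "(real^'n) set \<Rightarrow> (real^'n \<Rightarrow> real) set" where
  "W12 \<Omega> = {u \<in> square_int (lebesgue_on \<Omega>).
              \<exists>g \<in> square_int (lebesgue_on \<Omega>). is_weak_grad \<Omega> u g}"

text \<open>The weak gradient is unique up to null sets; this picks a representative.\<close>
definition weak_grad :: "(real^'n) set \<Rightarrow> (real^'n \<Rightarrow> real) \<Rightarrow> real^'n \<Rightarrow> real^'n" where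
  "weak_grad \<Omega> u = (SOME g. g \<in> square_int (lebesgue_on \<Omega>) \<and> is_weak_grad \<Omega> u g)"

definition norm_W12 :: "(real^'n) set \<Rightarrow> (real^'n \<Rightarrow> real) \<Rightarrow> real" where
  "norm_W12 \<Omega> u =
     sqrt ((norm_L2 (lebesgue_on \<Omega>) u)\<^sup>2 + (norm_L2 (lebesgue_on \<Omega>) (weak_grad \<Omega> u))\<^sup>2)"

text \<open>\<open>Tr\<close> is a bounded linear operator from \<open>W\<^sup>1\<^sup>,\<^sup>2(\<Omega>)\<close> to \<open>L\<^sup>2(\<partial>\<Omega>, \<sigma>)\<close> extending restriction to
  the frontier. Linearity is up to \<open>\<sigma>\<close>-null sets; together with boundedness it makes \<open>Tr\<close>
  compatible with equality almost everywhere. Since \<open>\<sigma>\<close> is carried by the frontier, square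
  integrability with respect to \<open>\<sigma>\<close> is square integrability on the frontier.\<close>
definition is_trace_operator ::
    "(real^'n) set \<Rightarrow> (real^'n) measure \<Rightarrow> ((real^'n \<Rightarrow> real) \<Rightarrow> (real^'n \<Rightarrow> real)) \<Rightarrow> bool" where
  "is_trace_operator \<Omega> \<sigma> Tr \<longleftrightarrow>
     (\<forall>u \<in> W12 \<Omega>. Tr u \<in> square_int \<sigma>) \<and>
     (\<forall>u \<in> W12 \<Omega>. \<forall>v \<in> W12 \<Omega>. AE z in \<sigma>. Tr (\<lambda>x. u x + v x) z = Tr u z + Tr v z) \<and>
     (\<forall>u \<in> W12 \<Omega>. \<forall>a. AE z in \<sigma>. Tr (\<lambda>x. a * u x) z = a * Tr u z) \<and>
     (\<exists>B. \<forall>u \<in> W12 \<Omega>. norm_L2 \<sigma> (Tr u) \<le> B * norm_W12 \<Omega> u) \<and>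
     (\<forall>\<phi> \<in> test_functions UNIV. AE z in \<sigma>. Tr \<phi> z = \<phi> z)"

definition avg :: "'a measure \<Rightarrow> 'a set \<Rightarrow> ('a \<Rightarrow> real) \<Rightarrow> real" where
  "avg M S f = (LINT x:S|M. f x) / measure M S"

end

theory Submission
  imports Defs
begin

text \<open>For a \<open>C\<^sup>1\<close> function \<open>u\<close> and a point \<open>x\<close> of the closure of \<open>\<Omega>\<close>, telescoping the means of \<open>u\<close>
  over balls centred at corkscrew points of the scales \<open>\<rho>\<^sub>j = 2\<^sup>-\<^sup>j r\<close>, with Harnack chains between
  consecutive ones, bounds \<open>\<bar>u x - c\<bar>\<close> by the sum over \<open>j\<close> of \<open>\<rho>\<^sub>j powr (1 - n / 2)\<close> times the
  \<open>L\<^sup>2\<close> norm of \<open>grad u\<close> on \<open>\<Omega> \<inter> ball x (K * \<rho>\<^sub>j)\<close>. The \<open>p\<close>-th power of this is integrated in \<open>x\<close>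
  against a measure \<open>\<mu>\<close> with \<open>\<mu> (ball y \<rho>) \<lesssim> \<rho> powr d\<close> by Tonelli, and the resulting series
  converges because \<open>p (n - 2) / 2 < d\<close>. This is used twice: for \<open>\<sigma>\<close>, and for Lebesgue measure on \<open>\<Omega>\<close>,
  which compares \<open>c\<close> with the mean over \<open>E\<close>.

  To pass to \<open>W\<^sup>1\<^sup>,\<^sup>2\<close>, where only the values of the trace on test functions are known, one needs that
  test functions are dense. An element \<open>u\<close> is approximated at scale \<open>\<rho>\<close> by gluing its mollified
  values at corkscrew points with a lattice partition of unity; again Harnack chains bound the
  energy of the approximants, which therefore converge weakly, and convex combinations of them
  converge strongly. The inequality then follows from Fatou's lemma.\<close>

section \<open>Smooth functions\<close>

text \<open>The trace is pinned down only by test functions on the whole space, so density has to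
  hold up to the boundary, where interior mollification gives nothing. The lattice operator reads
  \<open>u\<close> only at points well inside \<Omega> and still returns a function that is smooth
  on the whole space. It reproduces constants but not linear functions, so its gradients are merely
  bounded in L2, with no evident strong convergence to the gradient of \<open>u\<close>; this is why
  a weak limit and a minimisation argument come in.

  The exponent is dictated by scaling: in the integrated p-th power, scale \<rho> contributes \<rho>
  to the power p (1 - n/2) + d, which is positive exactly below the critical exponent. Tonelli needs
  one factor of the energy to stay linear, which forces p \<ge> 2; smaller exponents 2k are reached
  through p = 2, which is admissible because d > n - 2. The dilation factor K comes only from the
  reach of the chains and is therefore fixed before the exponent and the lower density c of E are
  chosen.\<close>

definition flat :: "nat \<Rightarrow> real \<Rightarrow> real" where
  "flat j t = (if t \<le> 0 then 0 else (1 / t) ^ j * exp (- (1 / t)))"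

lemma flat_tendsto_0: "((\<lambda>t. flat j t) \<longlongrightarrow> 0) (at 0)"
proof -
  have "filterlim (\<lambda>t::real. 1 / t) at_top (at_right 0)"
    using filterlim_inverse_at_top_right by (simp add: inverse_eq_divide)
  from filterlim_compose[OF tendsto_power_div_exp_0 this, of j]
  have "((\<lambda>t. (1 / t) ^ j * exp (- (1 / t))) \<longlongrightarrow> (0::real)) (at_right 0)"
    by (simp add: exp_minus divide_inverse)
  then have R: "(flat j \<longlongrightarrow> 0) (at_right 0)"
    by (rule Lim_transform_eventually) (auto simp: flat_def eventually_at_filter)
  have L: "(flat j \<longlongrightarrow> 0) (at_left 0)"
    by (rule Lim_transform_eventually[OF tendsto_const]) (auto simp: flat_def eventually_at_filter)
  show ?thesis using L R by (simp add: filterlim_split_at)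
qed

text \<open>The index \<open>j\<close> is there for this formula: differentiating t^(-j) exp(-1/t)
  yields members of the same family with larger index, so the family is closed under derivatives up
  to linear combinations.\<close>

lemma flat_has_derivative:
  "(flat j has_real_derivative (flat (j + 2) t - real j * flat (j + 1) t)) (at t)"
proof -
  consider "t < 0" | "t = 0" | "t > 0" by linarith
  then show ?thesis
  proof cases
    case 1
    have "((\<lambda>_. 0) has_real_derivative 0) (at t)" by simp
    then have "(flat j has_real_derivative 0) (at t)"
      by (rule has_field_derivative_transform_within_open[of _ _ _ "{..<0}"])
        (use 1 in \<open>auto simp: flat_def\<close>)
    then show ?thesis using 1 by (simp add: flat_def)
  next
    case 2
    \<comment> \<open>Since \<open>flat j 0 = 0\<close>, the difference quotient at the origin is
      \<open>flat (Suc j)\<close> away from 0, which again tends to 0.\<close>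
    have "(\<lambda>h. (flat j (0 + h) - flat j 0) / h) \<midarrow>0\<rightarrow> 0"
      by (rule Lim_transform_eventually[OF flat_tendsto_0[of "Suc j"]])
        (auto simp: flat_def eventually_at_filter)
    then have "DERIV (flat j) 0 :> 0" by (simp add: DERIV_def)
    then show ?thesis using 2 by (simp add: flat_def)
  next
    case 3
    have "((\<lambda>t. (1 / t) ^ j * exp (- (1 / t))) has_real_derivative
        ((1 / t) ^ (j+2) * exp (- (1 / t)) - real j * ((1 / t) ^ (j+1) * exp (- (1 / t))))) (at t)"
    proof (cases j)
      case 0
      then show ?thesis using 3
        by (auto intro!: derivative_eq_intros simp: field_simps power2_eq_square)
    next
      case (Suc i)
      then show ?thesis using 3
        by (auto intro!: derivative_eq_intros simp: field_simps power2_eq_square)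
          (cases i, auto simp: algebra_simps)
    qed
    then have "(flat j has_real_derivative
        ((1 / t) ^ (j+2) * exp (- (1 / t)) - real j * ((1 / t) ^ (j+1) * exp (- (1 / t))))) (at t)"
      by (rule has_field_derivative_transform_within_open[of _ _ _ "{0<..}"])
        (use 3 in \<open>auto simp: flat_def\<close>)
    then show ?thesis using 3 by (simp add: flat_def)
  qed
qed

lemma flat_nonneg [simp]: "flat j t \<ge> 0"
  by (simp add: flat_def)

lemma flat_pos: "t > 0 \<Longrightarrow> flat j t > 0"
  by (simp add: flat_def)

text \<open>A generating set of smooth functions that is closed under partial derivatives, so that
  smoothness of all orders follows by a single induction.\<close>

inductive_set smooth_gen :: "(real^'n \<Rightarrow> real) set" where
  flat: "(\<lambda>x. flat j (a * x $ i + b)) \<in> smooth_gen"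
| const: "(\<lambda>x. c) \<in> smooth_gen"
| add: "f \<in> smooth_gen \<Longrightarrow> g \<in> smooth_gen \<Longrightarrow> (\<lambda>x. f x + g x) \<in> smooth_gen"
| mult: "f \<in> smooth_gen \<Longrightarrow> g \<in> smooth_gen \<Longrightarrow> (\<lambda>x. f x * g x) \<in> smooth_gen"
| inverse: "f \<in> smooth_gen \<Longrightarrow> (\<And>x. f x \<noteq> 0) \<Longrightarrow> (\<lambda>x. inverse (f x)) \<in> smooth_gen"

lemma smooth_gen_diff:
  assumes "f \<in> smooth_gen" "g \<in> smooth_gen" shows "(\<lambda>x. f x - g x) \<in> smooth_gen"
  using smooth_gen.add[OF assms(1) smooth_gen.mult[OF smooth_gen.const[of "-1"] assms(2)]] by simp

lemma smooth_gen_cmult: "f \<in> smooth_gen \<Longrightarrow> (\<lambda>x. c * f x) \<in> smooth_gen"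
  by (rule smooth_gen.mult[OF smooth_gen.const])

lemma smooth_gen_sum: "(\<And>i. i \<in> I \<Longrightarrow> f i \<in> smooth_gen) \<Longrightarrow> (\<lambda>x. \<Sum>i\<in>I. f i x) \<in> smooth_gen"
  by (induction I rule: infinite_finite_induct) (auto intro: smooth_gen.intros)

lemma smooth_gen_prod: "(\<And>i. i \<in> I \<Longrightarrow> f i \<in> smooth_gen) \<Longrightarrow> (\<lambda>x. \<Prod>i\<in>I. f i x) \<in> smooth_gen"
  by (induction I rule: infinite_finite_induct) (auto intro: smooth_gen.intros)

section \<open>Gradients and derivatives of the generated functions\<close>

definition grad :: "(real^'n \<Rightarrow> real) \<Rightarrow> real^'n \<Rightarrow> real^'n" where
  "grad f x = (\<chi> i. partial_deriv i f x)"

lemma grad_nth [simp]: "grad f x $ i = partial_deriv i f x"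
  by (simp add: grad_def)

lemma grad_eqI:
  assumes "(f has_derivative (\<lambda>v. v \<bullet> g)) (at x)" shows "grad f x = g"
  using frechet_derivative_at[OF assms, symmetric]
  by (simp add: vec_eq_iff partial_deriv_def inner_axis')

lemma has_derivative_grad:
  assumes "f differentiable (at x)" shows "(f has_derivative (\<lambda>v. v \<bullet> grad f x)) (at x)"
proof -
  have D: "(f has_derivative frechet_derivative f (at x)) (at x)"
    using assms by (simp add: frechet_derivative_works)
  then have lin: "linear (frechet_derivative f (at x))"
    using has_derivative_linear by blast
  have "frechet_derivative f (at x) v = v \<bullet> grad f x" for v
  proof -
    have "frechet_derivative f (at x) v = frechet_derivative f (at x) (\<Sum>i\<in>UNIV. v $ i *\<^sub>R axis i 1)"
      by (simp add: basis_expansion[of v, unfolded scalar_mult_eq_scaleR])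
    also have "\<dots> = v \<bullet> grad f x"
      using lin by (simp add: linear_sum linear_cmul inner_vec_def partial_deriv_def)
    finally show ?thesis .
  qed
  then have "frechet_derivative f (at x) = (\<lambda>v. v \<bullet> grad f x)" by auto
  with D show ?thesis by simp
qed

text \<open>The induction has to carry a gradient field with components in the set again;
  differentiability alone would not iterate. Only the generator \<open>flat\<close> produces new
  functions, and these are generators of higher index.\<close>

lemma smooth_gen_has_derivative:
  fixes f :: "real^'n \<Rightarrow> real"
  assumes "f \<in> smooth_gen"
  shows "\<exists>G. (\<forall>i. (\<lambda>x. G x $ i) \<in> smooth_gen) \<and> (\<forall>x. (f has_derivative (\<lambda>v. v \<bullet> G x)) (at x))"
  using assms
proof induction
  case (flat j a i b)
  define g where "g x = a * (flat (j + 2) (a * x $ i + b) - real j * flat (j + 1) (a * x $ i + b))"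
    for x :: "real^'n"
  have gs: "g \<in> smooth_gen"
    unfolding g_def by (intro smooth_gen_cmult smooth_gen_diff smooth_gen.flat)
  have "(\<lambda>x. (axis i (g x) :: real^'n) $ k) \<in> smooth_gen" for k
    using gs smooth_gen.const[of 0] by (cases "k = i") (auto simp: axis_def)
  moreover have "((\<lambda>x. flat j (a * x $ i + b)) has_derivative (\<lambda>v. v \<bullet> axis i (g x))) (at x)" for x
  proof -
    have "((\<lambda>x. a * x $ i + b) has_derivative (\<lambda>v. a * v $ i)) (at x)"
      by (auto intro!: derivative_eq_intros bounded_linear_imp_has_derivative bounded_linear_vec_nth)
    from has_derivative_compose[OF this flat_has_derivative[of j "a * x $ i + b", unfolded has_field_derivative_def]]
    show ?thesis by (simp add: g_def inner_axis algebra_simps)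
  qed
  ultimately show ?case by (intro exI[of _ "\<lambda>x. axis i (g x)"]) auto
next
  case (const c)
  show ?case by (rule exI[of _ "\<lambda>x. 0"]) (auto intro: smooth_gen.const)
next
  case (add f g)
  then obtain F G where *: "\<forall>i. (\<lambda>x. F x $ i) \<in> smooth_gen" "\<forall>x. (f has_derivative (\<lambda>v. v \<bullet> F x)) (at x)"
    "\<forall>i. (\<lambda>x. G x $ i) \<in> smooth_gen" "\<forall>x. (g has_derivative (\<lambda>v. v \<bullet> G x)) (at x)" by auto
  show ?case
    by (rule exI[of _ "\<lambda>x. F x + G x"])
      (use * in \<open>auto intro!: smooth_gen.intros derivative_eq_intros simp: inner_add_right\<close>)
next
  case (mult f g)
  then obtain F G where *: "\<forall>i. (\<lambda>x. F x $ i) \<in> smooth_gen" "\<forall>x. (f has_derivative (\<lambda>v. v \<bullet> F x)) (at x)"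
    "\<forall>i. (\<lambda>x. G x $ i) \<in> smooth_gen" "\<forall>x. (g has_derivative (\<lambda>v. v \<bullet> G x)) (at x)" by auto
  show ?case
    by (rule exI[of _ "\<lambda>x. g x *\<^sub>R F x + f x *\<^sub>R G x"])
      (use * mult.hyps in \<open>auto intro!: smooth_gen.intros derivative_eq_intros simp: inner_add_right algebra_simps\<close>)
next
  case (inverse f)
  then obtain F where *: "\<forall>i. (\<lambda>x. F x $ i) \<in> smooth_gen" "\<forall>x. (f has_derivative (\<lambda>v. v \<bullet> F x)) (at x)" by auto
  have "(\<lambda>x. (-1) * (inverse (f x) * inverse (f x)) * F x $ i) \<in> smooth_gen" for i
    by (intro smooth_gen.mult smooth_gen_cmult smooth_gen.inverse) (use * inverse in auto)
  moreover have "((\<lambda>x. inverse (f x)) has_derivative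
      (\<lambda>v. v \<bullet> ((-1) * (inverse (f x) * inverse (f x))) *\<^sub>R F x)) (at x)" for x
    by (rule derivative_eq_intros *(2)[rule_format] refl inverse)+ (simp add: algebra_simps)
  ultimately show ?case
    by (intro exI[of _ "\<lambda>x. ((-1) * (inverse (f x) * inverse (f x))) *\<^sub>R F x"]) auto
qed

lemma smooth_gen_differentiable: "f \<in> smooth_gen \<Longrightarrow> f differentiable (at x)"
  using smooth_gen_has_derivative unfolding differentiable_def by blast

lemma smooth_gen_partial_deriv:
  assumes "f \<in> smooth_gen" shows "partial_deriv i f \<in> smooth_gen"
proof -
  obtain G where G: "(\<lambda>x. G x $ i) \<in> smooth_gen" "\<And>x. (f has_derivative (\<lambda>v. v \<bullet> G x)) (at x)"
    using smooth_gen_has_derivative[OF assms] by blast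
  have "partial_deriv i f = (\<lambda>x. G x $ i)"
    using grad_eqI[OF G(2)] by (metis grad_nth)
  with G show ?thesis by simp
qed

lemma smooth_gen_C_k: "f \<in> smooth_gen \<Longrightarrow> C_k k f"
proof (induction k arbitrary: f)
  case 0
  then show ?case
    by (auto intro!: differentiable_imp_continuous_on
        simp: differentiable_on_def smooth_gen_differentiable)
qed (auto simp: smooth_gen_differentiable smooth_gen_partial_deriv)

subsection \<open>A smooth partition of unity on the line\<close>

text \<open>The standard smooth transition from 0 to 1 across the unit interval. The denominator
  never vanishes, because \<open>t\<close> or \<open>1 - t\<close> is positive, so the rule for
  inverses applies to it.\<close>

definition smooth_step :: "real \<Rightarrow> real" where
  "smooth_step t = flat 0 t * inverse (flat 0 t + flat 0 (1 - t))"

lemma flat_sum_pos: "flat 0 t + flat 0 (1 - t) > 0"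
  by (cases "t > 0") (auto simp: flat_pos add_pos_nonneg add_nonneg_pos)

lemma smooth_step_0: "t \<le> 0 \<Longrightarrow> smooth_step t = 0"
  by (simp add: smooth_step_def flat_def)

lemma smooth_step_1: "t \<ge> 1 \<Longrightarrow> smooth_step t = 1"
  using flat_pos[of t 0] by (simp add: smooth_step_def flat_def[of _ "1 - t"])

lemma smooth_step_nonneg: "smooth_step t \<ge> 0"
  using flat_sum_pos[of t] by (simp add: smooth_step_def)

lemma smooth_step_le_1: "smooth_step t \<le> 1"
  using flat_sum_pos[of t] by (simp add: smooth_step_def field_simps)

lemma smooth_step_smooth: "(\<lambda>x::real^'n. smooth_step (a * x $ i + b)) \<in> smooth_gen"
proof -
  have "(\<lambda>x::real^'n. flat 0 (1 - (a * x $ i + b))) \<in> smooth_gen"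
    using smooth_gen.flat[of 0 "-a" i "1 - b"] by (simp add: algebra_simps)
  moreover have "flat 0 t + flat 0 (1 - t) \<noteq> 0" for t
    using flat_sum_pos[of t] by linarith
  ultimately show ?thesis
    unfolding smooth_step_def
    by (intro smooth_gen.mult smooth_gen.flat smooth_gen.inverse smooth_gen.add)
qed

text \<open>Being a difference of two consecutive steps, this bump on [0, 2] has integer translates
  that telescope to 1; no normalising quotient is needed for a partition of unity.\<close>

definition hat :: "real \<Rightarrow> real" where
  "hat t = smooth_step t - smooth_step (t - 1)"

lemma hat_smooth: "(\<lambda>x::real^'n. hat (a * x $ i + b)) \<in> smooth_gen"
  using smooth_gen_diff[OF smooth_step_smooth[of a i b] smooth_step_smooth[of a i "b - 1"]]
  by (simp add: hat_def algebra_simps)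

lemma hat_nonneg: "hat t \<ge> 0"
proof (cases "t \<le> 1")
  case True
  then show ?thesis using smooth_step_0[of "t - 1"] smooth_step_nonneg by (simp add: hat_def)
next
  case False
  then show ?thesis using smooth_step_1[of t] smooth_step_le_1 by (simp add: hat_def)
qed

lemma hat_le_1: "hat t \<le> 1"
  using smooth_step_le_1[of t] smooth_step_nonneg[of "t-1"] by (simp add: hat_def)

lemma hat_eq_0: "t \<le> 0 \<or> t \<ge> 2 \<Longrightarrow> hat t = 0"
  by (auto simp: hat_def smooth_step_0 smooth_step_1)

lemma hat_1: "hat 1 = 1"
  by (simp add: hat_def smooth_step_0 smooth_step_1)

lemma hat_sum:
  assumes "\<bar>t\<bar> \<le> real N - 1"
  shows "(\<Sum>q = - int N..int N. hat (t - of_int q)) = 1"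
proof -
  \<comment> \<open>Telescoped partial sums. At \<open>m = 2 * N\<close> the bound on
    \<open>t\<close> places the first step where it is 1 and the second where it is 0.\<close>
  have "(\<Sum>q = -int N..int m - int N. hat (t - of_int q)) = smooth_step (t + N) - smooth_step (t - real m + N - 1)"
    for m :: nat
  proof (induction m)
    case 0
    then show ?case by (simp add: hat_def)
  next
    case (Suc m)
    have "{- int N..int (Suc m) - int N} = insert (int (Suc m) - int N) {- int N..int m - int N}"
      by auto
    with Suc show ?case by (simp add: hat_def algebra_simps)
  qed
  from this[of "2 * N"] assms show ?thesis
    by (simp add: smooth_step_0 smooth_step_1)
qed

section \<open>Integration\<close>

text \<open>Dominated convergence for the difference quotients, which the mean value inequality
  bounds by \<open>B\<close>. The bound is demanded for all parameters rather than near one point,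
  so that no neighbourhood has to be tracked.\<close>

lemma has_real_derivative_integral:
  fixes f f' :: "real \<Rightarrow> 'a \<Rightarrow> real"
  assumes int: "\<And>t. integrable M (f t)"
    and deriv: "\<And>t x. x \<in> space M \<Longrightarrow> ((\<lambda>t. f t x) has_real_derivative f' t x) (at t)"
    and bound: "\<And>t x. x \<in> space M \<Longrightarrow> \<bar>f' t x\<bar> \<le> B x" and B: "integrable M B"
  shows "((\<lambda>t. \<integral>x. f t x \<partial>M) has_real_derivative (\<integral>x. f' t x \<partial>M)) (at t)"
proof -
  have quot: "\<bar>(f (t + h) x - f t x) / h\<bar> \<le> B x" if "h \<noteq> 0" "x \<in> space M" for h x
  proof -
    have "norm (f (t + h) x - f t x) \<le> B x * norm (t + h - t)"
      by (rule field_differentiable_bound[of UNIV _ "\<lambda>t. f' t x"])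
        (use that in \<open>auto intro: deriv has_field_derivative_at_within bound\<close>)
    then show ?thesis using that by (simp add: field_simps abs_mult)
  qed
  have lim: "((\<lambda>h. (f (t + h) x - f t x) / h) \<longlongrightarrow> f' t x) (at 0)" if "x \<in> space M" for x
    using deriv[OF that, of t] by (simp add: DERIV_def)
  have "((\<lambda>h. \<integral>x. (f (t + h) x - f t x) / h \<partial>M) \<longlongrightarrow> (\<integral>x. f' t x \<partial>M)) (at 0)"
  proof (rule tendsto_at_iff_sequentially[THEN iffD2], intro allI impI)
    fix X :: "nat \<Rightarrow> real" assume X: "\<forall>i. X i \<in> UNIV - {0}" "X \<longlonglongrightarrow> 0"
    then have X': "filterlim X (at 0) sequentially"
      by (auto simp: filterlim_at)
    have "(\<lambda>i. \<integral>x. (f (t + X i) x - f t x) / X i \<partial>M) \<longlonglongrightarrow> (\<integral>x. f' t x \<partial>M)"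
    proof (rule integral_dominated_convergence[where w = B])
      have m: "(\<lambda>x. (f (t + X i) x - f t x) / X i) \<in> borel_measurable M" for i
        using int[THEN borel_measurable_integrable] by measurable
      then show "(\<lambda>x. (f (t + X i) x - f t x) / X i) \<in> borel_measurable M" for i .
      have l: "(\<lambda>i. (f (t + X i) x - f t x) / X i) \<longlonglongrightarrow> f' t x" if "x \<in> space M" for x
        using filterlim_compose[OF lim[OF that] X'] .
      show "f' t \<in> borel_measurable M"
        by (rule borel_measurable_LIMSEQ_real[OF l m])
      show "AE x in M. (\<lambda>i. (f (t + X i) x - f t x) / X i) \<longlonglongrightarrow> f' t x"
        using l by simp
      show "AE x in M. norm ((f (t + X i) x - f t x) / X i) \<le> B x" for i
        using quot X by auto
    qed (rule B)
    then show "((\<lambda>h. \<integral>x. (f (t + h) x - f t x) / h \<partial>M) \<circ> X) \<longlonglongrightarrow> (\<integral>x. f' t x \<partial>M)"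
      by (simp add: o_def)
  qed
  then show ?thesis
    by (simp add: DERIV_def int)
qed

lemma nn_integral_lborel_affine:
  fixes f :: "'a::euclidean_space \<Rightarrow> ennreal"
  assumes [measurable]: "f \<in> borel_measurable borel" and s: "s > 0"
  shows "(\<integral>\<^sup>+x. f x \<partial>lborel) = ennreal (s ^ DIM('a)) * (\<integral>\<^sup>+y. f (a + s *\<^sub>R y) \<partial>lborel)"
  using s by (subst lborel_affine[of s a])
    (simp_all add: nn_integral_density nn_integral_distr nn_integral_cmult ennreal_power)

lemma lborel_integral_translate:
  fixes f :: "'a::euclidean_space \<Rightarrow> real"
  assumes [measurable]: "f \<in> borel_measurable borel"
  shows "(\<integral>x. f (a + x) \<partial>lborel) = (\<integral>x. f x \<partial>lborel)"
  by (subst (2) lborel_distr_plus[of a, symmetric]) (simp add: integral_distr)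

text \<open>The integral of a translate does not depend on the translation; differentiating it under
  the integral sign along \<open>axis i 1\<close> gives the claim. Applied to a product, this is
  integration by parts.\<close>

lemma integral_partial_deriv_eq_0:
  fixes f :: "real^'n \<Rightarrow> real"
  assumes C1: "C_k (Suc 0) f" and supp: "compact (closure {x. f x \<noteq> 0})"
  shows "(\<integral>x. partial_deriv i f x \<partial>lborel) = 0"
proof -
  have diff: "f differentiable (at x)" for x using C1 by simp
  have cf: "continuous_on UNIV f"
    using diff by (simp add: differentiable_imp_continuous_on differentiable_on_def)
  have cp: "continuous_on UNIV (partial_deriv i f)" using C1 by simp
  obtain R where R: "closure {x. f x \<noteq> 0} \<subseteq> ball 0 R" "R > 0"
    using bounded_subset_ballD[OF compact_imp_bounded[OF supp], of 0] by auto
  have f0: "f x = 0" if "x \<notin> ball 0 R" for x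
    using that R closure_subset[of "{x. f x \<noteq> 0}"] by auto
  have p0: "partial_deriv i f x = 0" if "x \<notin> closure {x. f x \<noteq> 0}" for x
  proof -
    have "((\<lambda>_. 0) has_derivative (\<lambda>v. v \<bullet> 0)) (at x)" by simp
    then have "(f has_derivative (\<lambda>v. v \<bullet> 0)) (at x)"
      by (rule has_derivative_transform_within_open[of _ _ _ _ "- closure {x. f x \<noteq> 0}"])
        (use that closure_subset[of "{x. f x \<noteq> 0}"] in auto)
    from grad_eqI[OF this] show ?thesis by (metis grad_nth zero_index)
  qed
  obtain C where C: "\<And>x. \<bar>partial_deriv i f x\<bar> \<le> C"
  proof -
    have "compact (partial_deriv i f ` closure {x. f x \<noteq> 0})"
      by (intro compact_continuous_image supp continuous_on_subset[OF cp]) auto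
    then obtain C where "\<And>x. x \<in> closure {x. f x \<noteq> 0} \<Longrightarrow> norm (partial_deriv i f x) \<le> C"
      by (metis bounded_iff compact_imp_bounded imageI)
    then have "\<bar>partial_deriv i f x\<bar> \<le> max C 0" for x
      using p0[of x] by (cases "x \<in> closure {x. f x \<noteq> 0}") (auto simp: le_max_iff_disj)
    then show ?thesis by (rule that)
  qed
  let ?e = "axis i (1::real) :: real^'n"
  have [measurable]: "f \<in> borel_measurable borel" using cf by (rule borel_measurable_continuous_onI)
  have intf: "integrable lborel (\<lambda>x. f (t *\<^sub>R ?e + x))" for t
  proof -
    have "integrable lborel (\<lambda>x. indicator (cball (- (t *\<^sub>R ?e)) R) x *\<^sub>R f (t *\<^sub>R ?e + x))"
      by (rule borel_integrable_compact)
        (auto intro!: continuous_intros continuous_on_compose2[OF cf])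
    also have "(\<lambda>x. indicator (cball (- (t *\<^sub>R ?e)) R) x *\<^sub>R f (t *\<^sub>R ?e + x)) = (\<lambda>x. f (t *\<^sub>R ?e + x))"
    proof
      fix x
      show "indicator (cball (- (t *\<^sub>R ?e)) R) x *\<^sub>R f (t *\<^sub>R ?e + x) = f (t *\<^sub>R ?e + x)"
      proof (cases "t *\<^sub>R ?e + x \<in> ball 0 R")
        case True
        then have "norm (t *\<^sub>R ?e + x) < R" by simp
        then have "x \<in> cball (- (t *\<^sub>R ?e)) R"
          by (simp add: dist_norm norm_minus_commute) (metis add.commute less_imp_le minus_diff_eq norm_minus_cancel uminus_add_conv_diff diff_minus_eq_add)
        then show ?thesis by simp
      qed (simp add: f0)
    qed
    finally show ?thesis .
  qed
  have der: "((\<lambda>t. f (t *\<^sub>R ?e + x)) has_real_derivative partial_deriv i f (t *\<^sub>R ?e + x)) (at t)" for t x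
  proof -
    have "((\<lambda>t. t *\<^sub>R ?e + x) has_derivative (\<lambda>h. h *\<^sub>R ?e)) (at t)"
      by (auto intro!: derivative_eq_intros)
    from has_derivative_compose[OF this has_derivative_grad[OF diff]]
    show ?thesis
      by (simp add: has_field_derivative_def inner_axis' mult_commute_abs)
  qed
  \<comment> \<open>Clamping the parameter to \<open>sin t \<in> [-1, 1]\<close> gives a dominating function valid for every \<open>t\<close>.\<close>
  have der': "((\<lambda>t. f (sin t *\<^sub>R ?e + x)) has_real_derivative
      (cos t * partial_deriv i f (sin t *\<^sub>R ?e + x))) (at t)" for t x
    using DERIV_chain2[OF der DERIV_sin] by (simp add: mult.commute)
  have "((\<lambda>t. \<integral>x. f (sin t *\<^sub>R ?e + x) \<partial>lborel) has_real_derivative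
      (\<integral>x. cos 0 * partial_deriv i f (sin 0 *\<^sub>R ?e + x) \<partial>lborel)) (at 0)"
  proof (rule has_real_derivative_integral[where B = "\<lambda>x. C * indicator (cball 0 (R + 1)) x"])
    show "integrable lborel (\<lambda>x. f (sin t *\<^sub>R ?e + x))" for t by (rule intf)
    show "((\<lambda>t. f (sin t *\<^sub>R ?e + x)) has_real_derivative
      (cos t * partial_deriv i f (sin t *\<^sub>R ?e + x))) (at t)" for t x by (rule der')
    show "integrable lborel (\<lambda>x. C * indicator (cball 0 (R + 1)) x :: real)"
      using emeasure_lborel_cball_finite
      by (intro integrable_mult_right integrable_real_indicator) (auto simp: infinity_ennreal_def)
    show "\<bar>cos t * partial_deriv i f (sin t *\<^sub>R ?e + x)\<bar> \<le> C * indicator (cball 0 (R + 1)) x" for t x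
    proof (cases "sin t *\<^sub>R ?e + x \<in> closure {x. f x \<noteq> 0}")
      case True
      then have n: "norm (sin t *\<^sub>R ?e + x) < R" using R by auto
      have "norm x \<le> norm (sin t *\<^sub>R ?e + x) + norm (sin t *\<^sub>R ?e)"
        by (metis add_diff_cancel_left' norm_triangle_ineq4)
      also have "norm (sin t *\<^sub>R ?e) \<le> 1" by (simp add: norm_axis_1 )
      finally have "norm x \<le> R + 1" using n by linarith
      moreover have "\<bar>cos t\<bar> * \<bar>partial_deriv i f (sin t *\<^sub>R ?e + x)\<bar> \<le> 1 * C"
        by (intro mult_mono C) auto
      ultimately show ?thesis by (simp add: abs_mult)
    next
      case False
      have "C \<ge> 0" using C[of 0] by linarith
      with False show ?thesis by (simp add: p0 indicator_def)
    qed
  qed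
  moreover have "(\<integral>x. f (sin t *\<^sub>R ?e + x) \<partial>lborel) = (\<integral>x. f x \<partial>lborel)" for t
    by (rule lborel_integral_translate) measurable
  ultimately have "((\<lambda>t. \<integral>x. f x \<partial>lborel) has_real_derivative (\<integral>x. partial_deriv i f x \<partial>lborel)) (at (0::real))"
    by simp
  then show ?thesis
    using DERIV_const DERIV_unique by blast
qed

section \<open>Tonelli for integrals over balls of fixed radius\<close>

lemma measurable_pair_ball:
  fixes f :: "real^'n \<Rightarrow> ennreal"
  assumes \<mu>: "sets \<mu> = sets borel" and N: "\<And>A. A \<in> sets borel \<Longrightarrow> A \<inter> space N \<in> sets N"
    and f: "f \<in> borel_measurable N"
  shows "(\<lambda>p. f (snd p) * indicator (ball (fst p) R) (snd p)) \<in> borel_measurable (\<mu> \<Otimes>\<^sub>M N)"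
proof -
  \<comment> \<open>\<open>N\<close> stands for Lebesgue measure on \<Omega>, whose measurable sets
    go beyond the Borel sets; all that is used of it is that Borel sets restrict to measurable ones.
    This makes the distance jointly measurable, while \<open>f\<close> is only measurable for
    \<open>N\<close>.\<close>
  have idN: "(\<lambda>y. y) \<in> N \<rightarrow>\<^sub>M borel"
    using N by (auto simp: measurable_def)
  have id\<mu>: "(\<lambda>y. y) \<in> \<mu> \<rightarrow>\<^sub>M borel"
    using \<mu> by (simp add: measurable_ident_sets)
  have [measurable]: "fst \<in> \<mu> \<Otimes>\<^sub>M N \<rightarrow>\<^sub>M borel" "snd \<in> \<mu> \<Otimes>\<^sub>M N \<rightarrow>\<^sub>M borel"
    using measurable_compose[OF measurable_fst id\<mu>] measurable_compose[OF measurable_snd idN] by auto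
  have "Measurable.pred (\<mu> \<Otimes>\<^sub>M N) (\<lambda>p. dist (fst p) (snd p) < R)"
    by measurable
  then have "(\<lambda>p. of_bool (dist (fst p) (snd p) < R) :: ennreal) \<in> borel_measurable (\<mu> \<Otimes>\<^sub>M N)"
    by measurable
  moreover have "(\<lambda>p. f (snd p)) \<in> borel_measurable (\<mu> \<Otimes>\<^sub>M N)"
    using f by measurable
  ultimately have m: "(\<lambda>p. f (snd p) * of_bool (dist (fst p) (snd p) < R)) \<in> borel_measurable (\<mu> \<Otimes>\<^sub>M N)"
    by measurable
  then show ?thesis by (simp add: indicator_def of_bool_def)
qed

lemma borel_measurable_nn_integral_ball:
  fixes f :: "real^'n \<Rightarrow> ennreal"
  assumes "sets \<mu> = sets borel" "sigma_finite_measure N"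
    and "\<And>A. A \<in> sets borel \<Longrightarrow> A \<inter> space N \<in> sets N" "f \<in> borel_measurable N"
  shows "(\<lambda>x. \<integral>\<^sup>+y. f y * indicator (ball x R) y \<partial>N) \<in> borel_measurable \<mu>"
  using sigma_finite_measure.borel_measurable_nn_integral_fst[OF assms(2) measurable_pair_ball[OF assms(1,3,4), of R]]
  by simp

text \<open>Tonelli together with the symmetry of \<open>y \<in> ball x R\<close>: after the
  exchange, the inner integral is the measure of a ball around \<open>y\<close>. This is how growth
  of \<mu> on balls turns local energies into a multiple of the total energy.\<close>

lemma nn_integral_ball_le:
  fixes f :: "real^'n \<Rightarrow> ennreal"
  assumes \<mu>: "sigma_finite_measure \<mu>" "sets \<mu> = sets borel"
    and N: "sigma_finite_measure N" "\<And>A. A \<in> sets borel \<Longrightarrow> A \<inter> space N \<in> sets N"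
    and f: "f \<in> borel_measurable N"
    and \<Lambda>: "\<And>y. emeasure \<mu> (ball y R) \<le> \<Lambda>"
  shows "(\<integral>\<^sup>+x. (\<integral>\<^sup>+y. f y * indicator (ball x R) y \<partial>N) \<partial>\<mu>) \<le> \<Lambda> * (\<integral>\<^sup>+y. f y \<partial>N)"
proof -
  interpret \<mu>: sigma_finite_measure \<mu> by fact
  interpret N: sigma_finite_measure N by fact
  interpret pair_sigma_finite \<mu> N ..
  have "(\<integral>\<^sup>+x. (\<integral>\<^sup>+y. f y * indicator (ball x R) y \<partial>N) \<partial>\<mu>)
      = (\<integral>\<^sup>+y. (\<integral>\<^sup>+x. f y * indicator (ball x R) y \<partial>\<mu>) \<partial>N)"
    using Fubini'[of "\<lambda>x y. f y * indicator (ball x R) y"] measurable_pair_ball[OF \<mu>(2) N(2) f, of R]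
    by (simp add: case_prod_beta')
  also have "\<dots> = (\<integral>\<^sup>+y. f y * emeasure \<mu> (ball y R) \<partial>N)"
  proof (intro nn_integral_cong)
    fix y
    have "(\<integral>\<^sup>+x. f y * indicator (ball x R) y \<partial>\<mu>) = (\<integral>\<^sup>+x. f y * indicator (ball y R) x \<partial>\<mu>)"
      by (intro nn_integral_cong) (simp add: indicator_def dist_commute)
    also have "\<dots> = f y * emeasure \<mu> (ball y R)"
      by (rule nn_integral_cmult_indicator) (simp add: \<mu>)
    finally show "(\<integral>\<^sup>+x. f y * indicator (ball x R) y \<partial>\<mu>) = f y * emeasure \<mu> (ball y R)" .
  qed
  also have "\<dots> \<le> (\<integral>\<^sup>+y. f y * \<Lambda> \<partial>N)"
    by (intro nn_integral_mono mult_left_mono \<Lambda>) auto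
  also have "\<dots> = \<Lambda> * (\<integral>\<^sup>+y. f y \<partial>N)"
    using f by (simp add: nn_integral_cmult mult.commute[of _ \<Lambda>])
  finally show ?thesis .
qed

lemma integrable_mult_square:
  fixes f g :: "'a \<Rightarrow> real"
  assumes [measurable]: "f \<in> borel_measurable M" "g \<in> borel_measurable M"
    and "integrable M (\<lambda>x. (f x)\<^sup>2)" "integrable M (\<lambda>x. (g x)\<^sup>2)"
  shows "integrable M (\<lambda>x. f x * g x)"
proof (rule Bochner_Integration.integrable_bound)
  show "integrable M (\<lambda>x. (f x)\<^sup>2 + (g x)\<^sup>2)" using assms by simp
  have "\<bar>a * b\<bar> \<le> a\<^sup>2 + b\<^sup>2" for a b :: real
  proof -
    have "0 \<le> (\<bar>a\<bar> - \<bar>b\<bar>)\<^sup>2" by simp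
    then have "2 * (\<bar>a\<bar> * \<bar>b\<bar>) \<le> a\<^sup>2 + b\<^sup>2" by (simp add: power2_diff)
    moreover have "0 \<le> \<bar>a\<bar> * \<bar>b\<bar>" by simp
    ultimately show ?thesis unfolding abs_mult by linarith
  qed
  then show "AE x in M. norm (f x * g x) \<le> norm ((f x)\<^sup>2 + (g x)\<^sup>2)" by simp
qed measurable

lemma integral_Cauchy_Schwarz:
  fixes f g :: "'a \<Rightarrow> real"
  assumes [measurable]: "f \<in> borel_measurable M" "g \<in> borel_measurable M"
    and f: "integrable M (\<lambda>x. (f x)\<^sup>2)" and g: "integrable M (\<lambda>x. (g x)\<^sup>2)"
  shows "(\<integral>x. f x * g x \<partial>M)\<^sup>2 \<le> (\<integral>x. (f x)\<^sup>2 \<partial>M) * (\<integral>x. (g x)\<^sup>2 \<partial>M)"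
proof -
  have fg: "integrable M (\<lambda>x. \<bar>f x\<bar> * \<bar>g x\<bar>)"
    using integrable_abs[OF integrable_mult_square[OF assms]] by (simp add: abs_mult)
  have "ennreal ((\<integral>x. \<bar>f x\<bar> * \<bar>g x\<bar> \<partial>M)\<^sup>2) = (\<integral>\<^sup>+x. ennreal \<bar>f x\<bar> * ennreal \<bar>g x\<bar> \<partial>M)\<^sup>2"
    using fg by (simp add: ennreal_mult'[symmetric] nn_integral_eq_integral ennreal_power)
  also have "\<dots> \<le> (\<integral>\<^sup>+x. (ennreal \<bar>f x\<bar>)\<^sup>2 \<partial>M) * (\<integral>\<^sup>+x. (ennreal \<bar>g x\<bar>)\<^sup>2 \<partial>M)"
    by (rule Cauchy_Schwarz_nn_integral) auto
  also have "\<dots> = ennreal ((\<integral>x. (f x)\<^sup>2 \<partial>M) * (\<integral>x. (g x)\<^sup>2 \<partial>M))"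
    using f g by (simp add: ennreal_power nn_integral_eq_integral ennreal_mult)
  finally have "(\<integral>x. \<bar>f x\<bar> * \<bar>g x\<bar> \<partial>M)\<^sup>2 \<le> (\<integral>x. (f x)\<^sup>2 \<partial>M) * (\<integral>x. (g x)\<^sup>2 \<partial>M)"
    by (subst (asm) ennreal_le_iff) auto
  moreover have "\<bar>\<integral>x. f x * g x \<partial>M\<bar> \<le> (\<integral>x. \<bar>f x\<bar> * \<bar>g x\<bar> \<partial>M)"
    using integral_abs_bound[of M "\<lambda>x. f x * g x"] by (simp add: abs_mult)
  then have "(\<integral>x. f x * g x \<partial>M)\<^sup>2 \<le> (\<integral>x. \<bar>f x\<bar> * \<bar>g x\<bar> \<partial>M)\<^sup>2"
    by (simp add: abs_le_square_iff[symmetric])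
  ultimately show ?thesis by linarith
qed

section \<open>Lattice partitions of unity and mollifying kernels\<close>

lemma smooth_gen_test_function:
  assumes f: "f \<in> smooth_gen" and K: "compact K" "{x. f x \<noteq> 0} \<subseteq> K" "K \<subseteq> U"
  shows "f \<in> test_functions U"
proof -
  have "closure {x. f x \<noteq> 0} \<subseteq> K" using K by (intro closure_minimal compact_imp_closed)
  moreover from this have "compact (closure {x. f x \<noteq> 0})"
    using K(1) by (metis closed_closure compact_Int_closed inf.absorb_iff2)
  ultimately show ?thesis
    using K smooth_gen_C_k[OF f] by (auto simp: test_functions_def)
qed

lemma grad_eq_0_open:
  assumes "open V" "x \<in> V" "\<And>y. y \<in> V \<Longrightarrow> f y = 0" shows "grad f x = 0"
proof (rule grad_eqI)
  have "((\<lambda>_. 0) has_derivative (\<lambda>v. v \<bullet> 0)) (at x)" by simp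
  then show "(f has_derivative (\<lambda>v. v \<bullet> 0)) (at x)"
    by (rule has_derivative_transform_within_open[OF _ assms(1,2)]) (use assms(3) in auto)
qed

lemma bounded_grad:
  fixes f :: "real^'n \<Rightarrow> real"
  assumes f: "C_k (Suc 0) f" and K: "compact (closure {x. f x \<noteq> 0})"
  obtains B where "B \<ge> 0" "\<And>x. norm (grad f x) \<le> B"
proof -
  have cg: "continuous_on UNIV (grad f)"
    unfolding grad_def using f by (intro continuous_on_vec_lambda) simp
  have "compact (grad f ` closure {x. f x \<noteq> 0})"
    by (intro compact_continuous_image continuous_on_subset[OF cg] K) auto
  then obtain B where B: "\<And>x. x \<in> closure {x. f x \<noteq> 0} \<Longrightarrow> norm (grad f x) \<le> B"
    by (metis bounded_iff compact_imp_bounded imageI)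
  have "grad f x = 0" if "x \<notin> closure {x. f x \<noteq> 0}" for x
    by (rule grad_eq_0_open[of "- closure {x. f x \<noteq> 0}"])
      (use that closure_subset[of "{x. f x \<noteq> 0}"] in auto)
  then have "norm (grad f x) \<le> max B 0" for x
    using B[of x] by (cases "x \<in> closure {x. f x \<noteq> 0}") (auto simp: le_max_iff_disj)
  then show thesis by (rule that[of "max B 0", rotated]) simp
qed

section \<open>The lattice partition of unity at scale \<rho>\<close>

definition cell :: "real \<Rightarrow> ('n::finite \<Rightarrow> int) \<Rightarrow> real^'n \<Rightarrow> real" where
  "cell \<rho> q x = (\<Prod>i\<in>UNIV. hat (x $ i / \<rho> - of_int (q i)))"

text \<open>A finite index set keeps all sums finite. The cells then add up to 1 only on a large
  cube, which suffices for bounded domains.\<close>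

definition lattice :: "nat \<Rightarrow> ('n::finite \<Rightarrow> int) set" where
  "lattice N = PiE UNIV (\<lambda>_. {- int N..int N})"

definition lattice_point :: "real \<Rightarrow> ('n::finite \<Rightarrow> int) \<Rightarrow> real^'n" where
  "lattice_point \<rho> q = (\<chi> i. \<rho> * of_int (q i))"

lemma finite_lattice [simp]: "finite (lattice N)"
  unfolding lattice_def by (intro finite_PiE) auto

lemma cell_smooth: "cell \<rho> q \<in> smooth_gen"
  unfolding cell_def[abs_def] divide_inverse
  using hat_smooth[of "inverse \<rho>"]
  by (intro smooth_gen_prod) (simp add: mult.commute diff_conv_add_uminus del: add_uminus_conv_diff)

lemma cell_nonneg: "cell \<rho> q x \<ge> 0"
  unfolding cell_def by (intro prod_nonneg) (simp add: hat_nonneg)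

lemma cell_le_1: "cell \<rho> q x \<le> 1"
  unfolding cell_def by (intro prod_le_1) (simp add: hat_nonneg hat_le_1)

text \<open>For \<rho> > 0 the cell lives on the open cube of side 2\<rho> whose lower corner is
  \<open>lattice_point \<rho> q\<close>.\<close>

lemma cell_nonzeroD: "cell \<rho> q x \<noteq> 0 \<Longrightarrow> 0 < x $ i / \<rho> - of_int (q i) \<and> x $ i / \<rho> - of_int (q i) < 2"
proof -
  assume "cell \<rho> q x \<noteq> 0"
  then have "hat (x $ i / \<rho> - of_int (q i)) \<noteq> 0" by (auto simp: cell_def)
  then show ?thesis using hat_eq_0[of "x $ i / \<rho> - of_int (q i)"] by linarith
qed

lemma sum_cell_eq_1:
  fixes x :: "real^'n"
  assumes "\<And>i. \<bar>x $ i / \<rho>\<bar> \<le> real N - 1"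
  shows "(\<Sum>q\<in>lattice N. cell \<rho> q x) = 1"
proof -
  have "(\<Sum>q\<in>lattice N. cell \<rho> q x)
      = (\<Prod>i\<in>UNIV. \<Sum>k\<in>{- int N..int N}. hat (x $ i / \<rho> - of_int k))"
    unfolding lattice_def cell_def by (rule prod_sum_PiE[symmetric]) auto
  also have "\<dots> = 1" by (intro prod.neutral ballI hat_sum assms)
  finally show ?thesis .
qed

text \<open>The inequalities are closed although a cell is nonzero only where the strict ones hold:
  if \<open>q\<close> is not near \<open>x\<close>, it is not near any point of a neighbourhood of
  \<open>x\<close>, so the gradient of the cell vanishes at \<open>x\<close> too.\<close>

definition near_cells :: "real \<Rightarrow> real^'n \<Rightarrow> ('n \<Rightarrow> int) set" where
  "near_cells \<rho> x = {q. \<forall>i. 0 \<le> x $ i / \<rho> - of_int (q i) \<and> x $ i / \<rho> - of_int (q i) \<le> 2}"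

text \<open>In each coordinate the index lies in an interval of length 2, which contains at most
  three integers. This overlap bound does not depend on the scale.\<close>

lemma near_cells_card:
  fixes x :: "real^'n"
  shows "finite (near_cells \<rho> x)" "card (near_cells \<rho> x) \<le> 3 ^ CARD('n)"
proof -
  let ?B = "PiE UNIV (\<lambda>i. {\<lceil>x $ i / \<rho>\<rceil> - 2..\<lfloor>x $ i / \<rho>\<rfloor>})"
  have sub: "near_cells \<rho> x \<subseteq> ?B"
    by (auto simp: near_cells_def le_floor_iff ceiling_le_iff PiE_UNIV_domain algebra_simps)
  have fin: "finite ?B" by (intro finite_PiE) auto
  then show "finite (near_cells \<rho> x)" using sub finite_subset by blast
  have "card {\<lceil>t\<rceil> - 2..\<lfloor>t\<rfloor>} \<le> 3" for t :: real
    using floor_le_ceiling[of t] by (simp add: nat_le_iff)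
  then have "card ?B \<le> (\<Prod>i\<in>(UNIV :: 'n set). 3)"
    unfolding card_PiE[OF finite] by (intro prod_mono) auto
  then show "card (near_cells \<rho> x) \<le> 3 ^ CARD('n)"
    using card_mono[OF fin sub] by simp
qed

lemma near_cells_outside:
  fixes x :: "real^'n"
  assumes "q \<notin> near_cells \<rho> x" shows "cell \<rho> q x = 0" "grad (cell \<rho> q) x = 0"
proof -
  show "cell \<rho> q x = 0"
  proof (rule ccontr)
    assume "cell \<rho> q x \<noteq> 0"
    from cell_nonzeroD[OF this] have "q \<in> near_cells \<rho> x"
      unfolding near_cells_def using less_imp_le by blast
    with assms show False by simp
  qed
  obtain i where i: "x $ i / \<rho> - of_int (q i) < 0 \<or> x $ i / \<rho> - of_int (q i) > 2"
    using assms by (auto simp: near_cells_def not_le)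
  have "open {y :: real^'n. y $ i / \<rho> - of_int (q i) < 0 \<or> y $ i / \<rho> - of_int (q i) > 2}"
    by (intro open_Collect_disj open_Collect_less) (auto intro!: continuous_intros simp: divide_inverse)
  then show "grad (cell \<rho> q) x = 0"
  proof (rule grad_eq_0_open)
    show "cell \<rho> q y = 0" if "y \<in> {y. y $ i / \<rho> - of_int (q i) < 0 \<or> y $ i / \<rho> - of_int (q i) > 2}" for y
      using that cell_nonzeroD[of \<rho> q y i] by fastforce
  qed (use i in simp)
qed

lemma norm_le_of_coords:
  fixes x :: "real^'n"
  assumes "\<And>i. \<bar>x $ i\<bar> \<le> c" shows "norm x \<le> real CARD('n) * c"
proof -
  have "norm x \<le> (\<Sum>i\<in>UNIV. \<bar>x $ i\<bar>)" by (rule norm_le_l1_cart)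
  also have "\<dots> \<le> (\<Sum>i\<in>(UNIV :: 'n set). c)" by (intro sum_mono assms)
  finally show ?thesis by simp
qed

lemma near_cells_dist:
  fixes x :: "real^'n"
  assumes "q \<in> near_cells \<rho> x" "\<rho> > 0"
  shows "dist x (lattice_point \<rho> q) \<le> 2 * real CARD('n) * \<rho>"
proof -
  have "\<bar>(x - lattice_point \<rho> q) $ i\<bar> \<le> 2 * \<rho>" for i
  proof -
    have "0 \<le> x $ i / \<rho> - of_int (q i)" "x $ i / \<rho> - of_int (q i) \<le> 2"
      using assms by (auto simp: near_cells_def)
    then have "0 \<le> \<rho> * (x $ i / \<rho> - of_int (q i))" "\<rho> * (x $ i / \<rho> - of_int (q i)) \<le> \<rho> * 2"
      using assms(2) by (auto intro!: mult_left_mono)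
    moreover have "\<rho> * (x $ i / \<rho> - of_int (q i)) = (x - lattice_point \<rho> q) $ i"
      using assms(2) by (simp add: lattice_point_def algebra_simps)
    ultimately show ?thesis by simp
  qed
  from norm_le_of_coords[OF this] show ?thesis by (simp add: dist_norm mult.assoc mult.left_commute)
qed

lemma cell_support_compact: "\<rho> > 0 \<Longrightarrow> {x. cell \<rho> q x \<noteq> 0} \<subseteq> cball (lattice_point \<rho> q) (2 * real CARD('n) * \<rho>)"
  for q :: "'n::finite \<Rightarrow> int"
  using near_cells_outside(1) near_cells_dist[where 'n='n] by (fastforce simp: dist_commute)

lemma has_derivative_cell: "(cell \<rho> q has_derivative (\<lambda>v. v \<bullet> grad (cell \<rho> q) x)) (at x)"
  by (intro has_derivative_grad smooth_gen_differentiable cell_smooth)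

lemma compact_closure_subset: "compact K \<Longrightarrow> A \<subseteq> K \<Longrightarrow> compact (closure A)"
  for K :: "'a::heine_borel set"
  by (meson bounded_subset compact_closure compact_imp_bounded)

text \<open>Scaling: every cell is one fixed cell composed with an affine map of ratio 1/\<rho>, and
  the gradient of that fixed cell is bounded by compactness of its support.\<close>

lemma grad_cell_bound:
  obtains L where "L > 0" "\<And>\<rho> (q :: 'n::finite \<Rightarrow> int) x. \<rho> > 0 \<Longrightarrow> norm (grad (cell \<rho> q) x) \<le> L / \<rho>"
proof -
  let ?b = "cell 1 (\<lambda>_. 0) :: real^'n \<Rightarrow> real"
  have "compact (closure {x. ?b x \<noteq> 0})"
    using cell_support_compact[of 1] by (intro compact_closure_subset[OF compact_cball]) auto
  from bounded_grad[OF smooth_gen_C_k[OF cell_smooth] this]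
  obtain B where B: "B \<ge> 0" "\<And>x. norm (grad ?b x) \<le> B" by blast
  show thesis
  proof (rule that[of "B + 1"])
    show "B + 1 > 0" using B by simp
    fix \<rho> :: real and q :: "'n \<Rightarrow> int" and x :: "real^'n" assume \<rho>: "\<rho> > 0"
    let ?S = "\<lambda>x. (1 / \<rho>) *\<^sub>R x - (\<chi> i. of_int (q i))"
    have "(?S has_derivative (\<lambda>v. (1 / \<rho>) *\<^sub>R v)) (at x)"
      by (auto intro!: derivative_eq_intros)
    from has_derivative_compose[OF this has_derivative_cell[of 1 "\<lambda>_. 0" "?S x"]]
    have "((\<lambda>x. ?b (?S x)) has_derivative (\<lambda>v. v \<bullet> ((1 / \<rho>) *\<^sub>R grad ?b (?S x)))) (at x)" by simp
    also have "(\<lambda>x. ?b (?S x)) = cell \<rho> q" by (simp add: cell_def fun_eq_iff)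
    finally have "grad (cell \<rho> q) x = (1 / \<rho>) *\<^sub>R grad ?b (?S x)" by (rule grad_eqI)
    then show "norm (grad (cell \<rho> q) x) \<le> (B + 1) / \<rho>"
      using B(2)[of "?S x"] \<rho> by (simp add: divide_right_mono)
  qed
qed

section \<open>The mollifying kernel\<close>

definition bump :: "real^'n \<Rightarrow> real" where
  "bump = cell 1 (\<lambda>_. -1)"

definition bump_integral :: "'n::finite itself \<Rightarrow> real" where
  "bump_integral _ = (\<integral>x. (bump :: real^'n \<Rightarrow> real) x \<partial>lborel)"

text \<open>The index -1 in \<open>bump\<close> centres the cell, which is then nonzero only where
  all coordinates are below 1 in absolute value; the radius \<open>CARD('n)\<close> comes from
  bounding the Euclidean norm by the sum of the coordinates.\<close>

lemma bump_support:
  fixes y :: "real^'n"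
  assumes "bump y \<noteq> 0" shows "norm y < real CARD('n)"
proof -
  have "\<bar>y $ i\<bar> < 1" for i
    using cell_nonzeroD[of 1 "\<lambda>_. -1" y i] assms by (auto simp: bump_def)
  then have "(\<Sum>i\<in>UNIV. \<bar>y $ i\<bar>) < (\<Sum>i\<in>(UNIV::'n set). 1)" by (intro sum_strict_mono) auto
  then show ?thesis using norm_le_l1_cart[of y] by simp
qed

lemma bump_nonneg: "bump x \<ge> 0" and bump_le_1: "bump x \<le> 1"
  by (simp_all add: bump_def cell_nonneg cell_le_1)

lemma continuous_bump: "continuous_on UNIV (bump :: real^'n \<Rightarrow> real)"
  unfolding bump_def using smooth_gen_C_k[OF cell_smooth, of 0] by simp

lemma borel_measurable_bump [measurable]: "(bump :: real^'n \<Rightarrow> real) \<in> borel_measurable borel"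
  by (rule borel_measurable_continuous_onI[OF continuous_bump])

lemma integrable_bump: "integrable lborel (bump :: real^'n \<Rightarrow> real)"
proof -
  have "integrable lborel (\<lambda>x. indicator (cball 0 (real CARD('n))) x *\<^sub>R (bump :: real^'n \<Rightarrow> real) x)"
    by (intro borel_integrable_compact continuous_on_subset[OF continuous_bump]) auto
  also have "(\<lambda>x. indicator (cball 0 (real CARD('n))) x *\<^sub>R (bump :: real^'n \<Rightarrow> real) x) = bump"
    using bump_support by (fastforce simp: indicator_def fun_eq_iff)
  finally show ?thesis .
qed

lemma bump_integral_pos: "bump_integral TYPE('n::finite) > 0"
proof -
  let ?b = "bump :: real^'n \<Rightarrow> real"
  have b0: "?b 0 = 1" by (simp add: bump_def cell_def hat_1)
  have "open {x. ?b x > 1 / 2}"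
    by (intro open_Collect_less continuous_on_const continuous_bump)
  then obtain e where e: "e > 0" "ball 0 e \<subseteq> {x. ?b x > 1 / 2}"
    using b0 openE[of "{x. ?b x > 1 / 2}" 0] by auto
  have "\<not> (AE x in lborel. ?b x = 0)"
  proof
    assume "AE x in lborel. ?b x = 0"
    then have "AE x in lborel. x \<notin> ball (0 :: real^'n) e"
      by eventually_elim (use e(2) in force)
    then have "ball (0 :: real^'n) e \<in> null_sets lborel"
      by (subst AE_iff_null_sets) auto
    then have "measure lborel (ball (0 :: real^'n) e) = 0" by (auto simp: measure_def)
    then show False using content_ball_pos[OF e(1), of "0 :: real^'n"] by linarith
  qed
  then have "(\<integral>x. ?b x \<partial>lborel) \<noteq> 0"
    using integral_nonneg_eq_0_iff_AE[OF integrable_bump] bump_nonneg by auto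
  moreover have "(\<integral>x. ?b x \<partial>lborel) \<ge> 0" by (intro integral_nonneg_AE) (simp add: bump_nonneg)
  ultimately show ?thesis by (simp add: bump_integral_def)
qed

text \<open>The usual mollifier of total mass 1, centred at \<open>a\<close>. Its support lies
  within distance \<open>CARD('n) * s\<close> of \<open>a\<close>, not \<open>s\<close>, because the
  bump is supported on a cube and no better radius is extracted from it.\<close>

definition kernel :: "real \<Rightarrow> real^'n \<Rightarrow> real^'n \<Rightarrow> real" where
  "kernel s a x = bump ((1 / s) *\<^sub>R (x - a)) / (bump_integral TYPE('n) * s ^ CARD('n))"

lemma kernel_smooth: "kernel s a \<in> smooth_gen"
proof -
  have "(\<lambda>x. 1 / (bump_integral TYPE('n) * s ^ CARD('n)) *
      (\<Prod>i\<in>UNIV. hat (1 / s * x $ i + (1 - a $ i / s)))) \<in> smooth_gen" for a :: "real^'n"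
    by (intro smooth_gen_cmult smooth_gen_prod hat_smooth)
  also have "(\<lambda>x. 1 / (bump_integral TYPE('n) * s ^ CARD('n)) *
      (\<Prod>i\<in>UNIV. hat (1 / s * x $ i + (1 - a $ i / s)))) = kernel s a" for a :: "real^'n"
    by (simp add: kernel_def bump_def cell_def fun_eq_iff algebra_simps diff_divide_distrib)
  finally show ?thesis .
qed

lemma kernel_nonneg:
  fixes a x :: "real^'n"
  shows "s > 0 \<Longrightarrow> kernel s a x \<ge> 0"
  using bump_integral_pos[where 'n='n] by (simp add: kernel_def bump_nonneg)

lemma kernel_le:
  fixes a x :: "real^'n"
  shows "s > 0 \<Longrightarrow> kernel s a x \<le> 1 / (bump_integral TYPE('n) * s ^ CARD('n))"
  unfolding kernel_def using bump_integral_pos[where 'n='n]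
  by (intro divide_right_mono bump_le_1) simp

lemma kernel_support:
  fixes a x :: "real^'n"
  assumes "s > 0" "kernel s a x \<noteq> 0" shows "dist a x < real CARD('n) * s"
proof -
  have "norm ((1 / s) *\<^sub>R (x - a)) < real CARD('n)"
    using assms by (intro bump_support) (auto simp: kernel_def)
  then have "norm (x - a) / s < real CARD('n)" using assms(1) by (simp only: norm_scaleR) simp
  then show ?thesis using assms(1) by (simp add: dist_norm norm_minus_commute field_simps)
qed

lemma kernel_support_compact:
  fixes a :: "real^'n"
  assumes "s > 0" shows "compact (closure {x. kernel s a x \<noteq> 0})"
  using kernel_support[OF assms, of a]
  by (intro compact_closure_subset[OF compact_cball[of a "real CARD('n) * s"]]) force

lemma kernel_test_function:
  fixes a :: "real^'n"
  assumes "s > 0" "cball a (real CARD('n) * s) \<subseteq> U" shows "kernel s a \<in> test_functions U"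
  by (rule smooth_gen_test_function[OF kernel_smooth compact_cball _ assms(2)])
    (use kernel_support[OF assms(1), of a] in force)

lemma continuous_kernel: "continuous_on UNIV (kernel s a)"
  using smooth_gen_C_k[OF kernel_smooth, of 0] by simp

lemma borel_measurable_kernel [measurable]: "kernel s a \<in> borel_measurable borel"
  by (rule borel_measurable_continuous_onI[OF continuous_kernel])

lemma nn_integral_kernel:
  fixes a :: "real^'n"
  assumes s: "s > 0" shows "(\<integral>\<^sup>+x. ennreal (kernel s a x) \<partial>lborel) = 1"
proof -
  let ?I = "bump_integral TYPE('n)"
  have I: "?I > 0" by (rule bump_integral_pos)
  have "(\<integral>\<^sup>+x. ennreal (kernel s a x) \<partial>lborel)
      = ennreal (s ^ CARD('n)) * (\<integral>\<^sup>+y. ennreal (kernel s a (a + s *\<^sub>R y)) \<partial>lborel)"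
    using nn_integral_lborel_affine[of "\<lambda>x. ennreal (kernel s a x)" s a] s by simp
  also have "(\<integral>\<^sup>+y. ennreal (kernel s a (a + s *\<^sub>R y)) \<partial>lborel)
      = (\<integral>\<^sup>+y. ennreal (1 / (?I * s ^ CARD('n))) * ennreal (bump y) \<partial>(lborel :: (real^'n) measure))"
    using s I by (intro nn_integral_cong) (simp add: kernel_def ennreal_mult'[symmetric])
  also have "\<dots> = ennreal (1 / (?I * s ^ CARD('n))) * ennreal ?I"
    using bump_nonneg unfolding bump_integral_def
    by (subst nn_integral_eq_integral[OF integrable_bump, symmetric]) (auto intro!: nn_integral_cmult)
  also have "ennreal (s ^ CARD('n)) * \<dots> = 1"
    using s I by (simp add: ennreal_mult'[symmetric])
  finally show ?thesis .
qed

lemma has_derivative_kernel: "(kernel s a has_derivative (\<lambda>v. v \<bullet> grad (kernel s a) x)) (at x)"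
  by (intro has_derivative_grad smooth_gen_differentiable kernel_smooth)

lemma kernel_translate: "kernel s a x = kernel s 0 (x - a)"
  by (simp add: kernel_def)

lemma grad_kernel_translate: "grad (kernel s a) x = grad (kernel s 0) (x - a)"
proof (rule grad_eqI)
  have "((\<lambda>x. x - a) has_derivative (\<lambda>v. v)) (at x)" by (auto intro!: derivative_eq_intros)
  from has_derivative_compose[OF this has_derivative_kernel]
  show "(kernel s a has_derivative (\<lambda>v. v \<bullet> grad (kernel s 0) (x - a))) (at x)"
    by (simp add: kernel_translate[of s a, abs_def])
qed

text \<open>The kernel depends on \<open>x - a\<close> only, so moving the centre is minus
  differentiating in \<open>x\<close>. This lets a derivative of mollified values fall on the test
  function in the definition of the weak gradient.\<close>

lemma kernel_has_derivative_center:
  "((\<lambda>t. kernel s (a + t *\<^sub>R v) x) has_real_derivative - (v \<bullet> grad (kernel s (a + t *\<^sub>R v)) x)) (at t)"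
proof -
  have "((\<lambda>t. x - (a + t *\<^sub>R v)) has_derivative (\<lambda>h. - (h *\<^sub>R v))) (at t)"
    by (auto intro!: derivative_eq_intros)
  from has_derivative_compose[OF this has_derivative_kernel[of s 0 "x - (a + t *\<^sub>R v)"]]
  have "((\<lambda>t. kernel s 0 (x - (a + t *\<^sub>R v))) has_derivative
      (*) (- (v \<bullet> grad (kernel s 0) (x - (a + t *\<^sub>R v))))) (at t)"
    by (rule has_derivative_eq_rhs) (simp add: fun_eq_iff)
  then show ?thesis
    unfolding has_field_derivative_def grad_kernel_translate[of s "a + t *\<^sub>R v"]
    by (subst kernel_translate)
qed

section \<open>Square integrable functions and weak gradients on bounded open sets\<close>

lemma borel_measurable_lebesgue_on:
  "f \<in> borel_measurable borel \<Longrightarrow> f \<in> borel_measurable (lebesgue_on \<Omega>)"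
  by (intro measurable_restrict_space1 measurable_completion) simp

locale bounded_open =
  fixes \<Omega> :: "(real^'n) set"
  assumes op: "open \<Omega>" and bnd: "bounded \<Omega>"
begin

abbreviation "N \<equiv> lebesgue_on \<Omega>"

lemma lmeasurable: "\<Omega> \<in> lmeasurable"
  using op bnd by (intro bounded_set_imp_lmeasurable) auto

sublocale finite_measure N
  by (rule finite_measure_lebesgue_on[OF lmeasurable])

lemma space_N [simp]: "space N = \<Omega>"
  by (simp add: space_restrict_space)

lemma sets_N: "A \<in> sets borel \<Longrightarrow> A \<inter> space N \<in> sets N"
  using op by (auto simp: sets_restrict_space image_iff)

lemma integrable_continuous:
  fixes f :: "real^'n \<Rightarrow> 'b::{banach, second_countable_topology}"
  assumes "continuous_on UNIV f" shows "integrable N f"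
proof -
  have "compact (f ` closure \<Omega>)"
    using bnd by (intro compact_continuous_image continuous_on_subset[OF assms]) auto
  then obtain B where B: "\<And>x. x \<in> closure \<Omega> \<Longrightarrow> norm (f x) \<le> B"
    by (metis bounded_iff compact_imp_bounded imageI)
  show ?thesis
    by (rule integrable_const_bound[of _ B])
      (use B closure_subset[of \<Omega>] in \<open>auto intro!: AE_I2 borel_measurable_lebesgue_on
        borel_measurable_continuous_onI[OF assms]\<close>)
qed

lemma square_int_continuous:
  fixes f :: "real^'n \<Rightarrow> 'b::{banach, second_countable_topology}"
  assumes "continuous_on UNIV f" shows "f \<in> square_int N"
proof -
  have "f \<in> borel_measurable N"
    by (intro borel_measurable_lebesgue_on borel_measurable_continuous_onI assms)
  moreover have "integrable N (\<lambda>x. (norm (f x))\<^sup>2)"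
    by (intro integrable_continuous continuous_on_power continuous_on_norm assms)
  ultimately show ?thesis by (simp add: square_int_def)
qed

lemma square_int_mult:
  fixes f g :: "real^'n \<Rightarrow> real"
  assumes "f \<in> square_int N" "g \<in> square_int N" shows "integrable N (\<lambda>x. f x * g x)"
  using assms by (intro integrable_mult_square) (auto simp: square_int_def)

lemma square_int_integrable:
  fixes f :: "real^'n \<Rightarrow> real"
  assumes "f \<in> square_int N" shows "integrable N f"
  by (rule square_integrable_imp_integrable) (use assms in \<open>auto simp: square_int_def\<close>)

lemma square_int_add:
  fixes f g :: "real^'n \<Rightarrow> 'b::{banach, second_countable_topology}"
  assumes "f \<in> square_int N" "g \<in> square_int N" shows "(\<lambda>x. f x + g x) \<in> square_int N"
proof -
  have [measurable]: "f \<in> borel_measurable N" "g \<in> borel_measurable N"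
    using assms by (auto simp: square_int_def)
  have "integrable N (\<lambda>x. (norm (f x + g x))\<^sup>2)"
  proof (rule Bochner_Integration.integrable_bound)
    show "integrable N (\<lambda>x. 2 * (norm (f x))\<^sup>2 + 2 * (norm (g x))\<^sup>2)"
      using assms by (auto simp: square_int_def)
    show "AE x in N. norm ((norm (f x + g x))\<^sup>2) \<le> norm (2 * (norm (f x))\<^sup>2 + 2 * (norm (g x))\<^sup>2)"
    proof (rule AE_I2)
      fix x
      have "(norm (f x + g x))\<^sup>2 \<le> (norm (f x) + norm (g x))\<^sup>2"
        by (intro power_mono norm_triangle_ineq) auto
      also have "\<dots> \<le> 2 * (norm (f x))\<^sup>2 + 2 * (norm (g x))\<^sup>2"
        using sum_squares_bound[of "norm (f x)" "norm (g x)"] by (simp add: power2_sum)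
      finally show "norm ((norm (f x + g x))\<^sup>2) \<le> norm (2 * (norm (f x))\<^sup>2 + 2 * (norm (g x))\<^sup>2)" by simp
    qed
  qed measurable
  then show ?thesis by (simp add: square_int_def)
qed

lemma square_int_scaleR:
  fixes f :: "real^'n \<Rightarrow> 'b::{banach, second_countable_topology}"
  assumes "f \<in> square_int N" shows "(\<lambda>x. c *\<^sub>R f x) \<in> square_int N"
  using assms by (auto simp: square_int_def power_mult_distrib)

lemma square_int_diff:
  fixes f g :: "real^'n \<Rightarrow> 'b::{banach, second_countable_topology}"
  assumes "f \<in> square_int N" "g \<in> square_int N" shows "(\<lambda>x. f x - g x) \<in> square_int N"
  using square_int_add[OF assms(1) square_int_scaleR[OF assms(2), of "-1"]] by simp

lemma square_int_nth:
  fixes g :: "real^'n \<Rightarrow> real^'n"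
  assumes "g \<in> square_int N" shows "(\<lambda>x. g x $ i) \<in> square_int N"
proof -
  have [measurable]: "g \<in> borel_measurable N" using assms by (auto simp: square_int_def)
  have m: "(\<lambda>x. g x $ i) \<in> borel_measurable N"
    by (rule measurable_compose[of g N borel]) (auto intro!: borel_measurable_continuous_onI continuous_intros)
  have "integrable N (\<lambda>x. (norm (g x $ i))\<^sup>2)"
  proof (rule Bochner_Integration.integrable_bound)
    show "integrable N (\<lambda>x. (norm (g x))\<^sup>2)" using assms by (auto simp: square_int_def)
    show "AE x in N. norm ((norm (g x $ i))\<^sup>2) \<le> norm ((norm (g x))\<^sup>2)"
    proof (rule AE_I2)
      fix x
      show "norm ((norm (g x $ i))\<^sup>2) \<le> norm ((norm (g x))\<^sup>2)"
        using power_mono[OF component_le_norm_cart[of "g x" i], of 2] by simp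
    qed
  qed (use m in measurable)
  with m show ?thesis by (simp add: square_int_def)
qed

subsection \<open>Density of test functions in \<open>L\<^sup>2\<close>\<close>

lemma lattice_mono: "L \<le> L' \<Longrightarrow> lattice L \<subseteq> lattice L'"
  unfolding lattice_def by (intro PiE_mono) auto

text \<open>Summing exactly those cells of a fine lattice that are nonzero somewhere on
  \<open>K\<close> gives the value 1 on \<open>K\<close>; small cells cannot reach the complement of
  \<open>U\<close>.\<close>

lemma smooth_cutoff:
  assumes K: "compact K" "K \<subseteq> U" and U: "open U"
  shows "\<exists>\<phi> \<in> smooth_gen \<inter> test_functions U. (\<forall>x :: real^'n. 0 \<le> \<phi> x \<and> \<phi> x \<le> (1::real)) \<and>
    (\<forall>x\<in>K. \<phi> x = 1) \<and> (\<forall>x. x \<notin> U \<longrightarrow> \<phi> x = 0)"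
proof (cases "K = {}")
  case True
  have "(\<lambda>x. 0) \<in> test_functions U"
    by (rule smooth_gen_test_function[OF smooth_gen.const, of "{}"]) auto
  then show ?thesis using smooth_gen.const True by (intro bexI[of _ "\<lambda>x. 0"]) auto
next
  case False
  obtain \<epsilon> where \<epsilon>: "\<epsilon> > 0" "{x. infdist x K \<le> \<epsilon>} \<subseteq> U"
    using compact_in_open_separated[OF False K(1) U K(2)] .
  let ?n = "real CARD('n)"
  \<comment> \<open>Two points where the same cell is nonzero are each within 2n\<rho> of its
    lattice point, hence within 4n\<rho> = \<epsilon> of each other.\<close>
  define \<rho> where "\<rho> = \<epsilon> / (4 * ?n)"
  have \<rho>: "\<rho> > 0" using \<epsilon> by (simp add: \<rho>_def)
  obtain R where R: "\<And>x. x \<in> K \<Longrightarrow> norm x \<le> R"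
    using compact_imp_bounded[OF K(1)] by (auto simp: bounded_iff)
  obtain L :: nat where L: "R / \<rho> + 1 \<le> real L" using real_arch_simple by blast
  have sum1: "(\<Sum>q\<in>lattice L. cell \<rho> q x) \<le> 1" for x :: "real^'n"
  proof -
    \<comment> \<open>At an arbitrary \<open>x\<close> the lattice may be too small for the cells to
      sum to 1; enlarging it to one that covers \<open>x\<close> only increases the sum, as cells
      are nonnegative.\<close>
    obtain L' :: nat where L': "norm x / \<rho> + 1 \<le> real L'" using real_arch_simple by blast
    have "(\<Sum>q\<in>lattice L. cell \<rho> q x) \<le> (\<Sum>q\<in>lattice (max L L'). cell \<rho> q x)"
      using lattice_mono[of L "max L L'"] by (intro sum_mono2) (auto simp: cell_nonneg)
    also have "\<dots> = 1"
    proof (rule sum_cell_eq_1)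
      fix i
      have "\<bar>x $ i / \<rho>\<bar> \<le> norm x / \<rho>"
        using component_le_norm_cart[of x i] \<rho> by (simp add: divide_right_mono)
      then show "\<bar>x $ i / \<rho>\<bar> \<le> real (max L L') - 1" using L' by linarith
    qed
    finally show ?thesis .
  qed
  define Q where "Q = {q \<in> lattice L. \<exists>x\<in>K. cell \<rho> q x \<noteq> 0}"
  have Q: "finite Q" "Q \<subseteq> lattice L" by (auto simp: Q_def)
  define \<phi> where "\<phi> x = (\<Sum>q\<in>Q. cell \<rho> q x)" for x
  have sm: "\<phi> \<in> smooth_gen" unfolding \<phi>_def[abs_def] by (intro smooth_gen_sum cell_smooth)
  have near: "infdist x K \<le> \<epsilon>" if nz: "\<phi> x \<noteq> 0" for x
  proof -
    obtain q where q: "q \<in> Q" "cell \<rho> q x \<noteq> 0" using nz sum.neutral[of Q "\<lambda>q. cell \<rho> q x"] unfolding \<phi>_def by blast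
    then obtain y where y: "y \<in> K" "cell \<rho> q y \<noteq> 0" by (auto simp: Q_def)
    have "dist x (lattice_point \<rho> q) \<le> 2 * ?n * \<rho>" "dist y (lattice_point \<rho> q) \<le> 2 * ?n * \<rho>"
      using near_cells_outside(1) near_cells_dist[OF _ \<rho>] q y by blast+
    then have "dist x y \<le> 4 * ?n * \<rho>"
      using dist_triangle2[of x y "lattice_point \<rho> q"] by linarith
    also have "\<dots> = \<epsilon>" by (simp add: \<rho>_def)
    finally show ?thesis using infdist_le[OF y(1), of x] by linarith
  qed
  show ?thesis
  proof (intro bexI[of _ \<phi>] conjI allI ballI impI IntI sm)
    show "\<phi> \<in> test_functions U"
    proof (rule smooth_gen_test_function[OF sm _ _ \<epsilon>(2)])
      show "compact {x. infdist x K \<le> \<epsilon>}" by (rule compact_infdist_le[OF False K(1) \<epsilon>(1)])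
    qed (use near in auto)
    show "0 \<le> \<phi> x" for x by (simp add: \<phi>_def sum_nonneg cell_nonneg)
    show "\<phi> x \<le> 1" for x
    proof -
      have "\<phi> x \<le> (\<Sum>q\<in>lattice L. cell \<rho> q x)"
        unfolding \<phi>_def using Q by (intro sum_mono2) (auto simp: cell_nonneg)
      then show ?thesis using sum1[of x] by linarith
    qed
    show "\<phi> x = 1" if "x \<in> K" for x
    proof -
      have "\<phi> x = (\<Sum>q\<in>lattice L. cell \<rho> q x)"
        unfolding \<phi>_def using Q that by (intro sum.mono_neutral_left) (auto simp: Q_def)
      also have "\<dots> = 1"
      proof (rule sum_cell_eq_1)
        fix i
        have "\<bar>x $ i / \<rho>\<bar> \<le> norm x / \<rho>"
          using component_le_norm_cart[of x i] \<rho> by (simp add: divide_right_mono)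
        also have "\<dots> \<le> R / \<rho>" using R[OF that] \<rho> by (simp add: divide_right_mono)
        finally show "\<bar>x $ i / \<rho>\<bar> \<le> real L - 1" using L by linarith
      qed
      finally show ?thesis .
    qed
    show "\<phi> x = 0" if "x \<notin> U" for x using near \<epsilon>(2) that by auto
  qed
qed

text \<open>Stated with the nonnegative integral, so that the closure properties below need
  measurability but no integrability of \<open>f\<close>.\<close>

definition L2_approx :: "(real^'n \<Rightarrow> real) \<Rightarrow> bool" where
  "L2_approx f \<longleftrightarrow> (\<forall>e>0. \<exists>\<phi> \<in> smooth_gen \<inter> test_functions \<Omega>. (\<integral>\<^sup>+x. ennreal ((f x - \<phi> x)\<^sup>2) \<partial>N) < ennreal e)"

lemma L2_approxD:
  "L2_approx f \<Longrightarrow> e > 0 \<Longrightarrow> \<exists>\<phi>. \<phi> \<in> smooth_gen \<and> \<phi> \<in> test_functions \<Omega> \<and>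
    (\<integral>\<^sup>+x. ennreal ((f x - \<phi> x)\<^sup>2) \<partial>N) < ennreal e"
  unfolding L2_approx_def by blast

lemma smooth_gen_measurable: "\<phi> \<in> smooth_gen \<Longrightarrow> \<phi> \<in> borel_measurable N"
  using smooth_gen_C_k[of \<phi> 0] by (auto intro: borel_measurable_lebesgue_on borel_measurable_continuous_onI)

lemma ennreal_square_sum_le: "ennreal ((a + b)\<^sup>2) \<le> 2 * ennreal (a\<^sup>2) + 2 * ennreal (b\<^sup>2)"
proof -
  have "(a + b)\<^sup>2 \<le> 2 * a\<^sup>2 + 2 * b\<^sup>2"
    using sum_squares_bound[of a b] by (simp add: power2_sum)
  then have "ennreal ((a + b)\<^sup>2) \<le> ennreal (2 * a\<^sup>2 + 2 * b\<^sup>2)" by (rule ennreal_leI)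
  also have "\<dots> = 2 * ennreal (a\<^sup>2) + 2 * ennreal (b\<^sup>2)"
    by (simp add: ennreal_plus ennreal_mult)
  finally show ?thesis .
qed

lemma nn_integral_square_sum_less:
  assumes [measurable]: "f \<in> borel_measurable N" "g \<in> borel_measurable N"
    and "(\<integral>\<^sup>+x. ennreal ((f x)\<^sup>2) \<partial>N) < ennreal (e / 4)" "(\<integral>\<^sup>+x. ennreal ((g x)\<^sup>2) \<partial>N) < ennreal (e / 4)"
    and e: "e > 0"
  shows "(\<integral>\<^sup>+x. ennreal ((f x + g x)\<^sup>2) \<partial>N) < ennreal e"
proof -
  have "(\<integral>\<^sup>+x. ennreal ((f x + g x)\<^sup>2) \<partial>N) \<le> (\<integral>\<^sup>+x. 2 * ennreal ((f x)\<^sup>2) + 2 * ennreal ((g x)\<^sup>2) \<partial>N)"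
    by (intro nn_integral_mono ennreal_square_sum_le)
  also have "\<dots> = 2 * (\<integral>\<^sup>+x. ennreal ((f x)\<^sup>2) \<partial>N) + 2 * (\<integral>\<^sup>+x. ennreal ((g x)\<^sup>2) \<partial>N)"
    by (simp add: nn_integral_add nn_integral_cmult)
  also have "\<dots> < 2 * ennreal (e / 4) + 2 * ennreal (e / 4)"
    using assms(3,4) by (intro add_strict_mono ennreal_mult_strict_left_mono) auto
  also have "\<dots> = ennreal e"
    using e by (simp add: ennreal_plus[symmetric] ennreal_mult'[symmetric] ennreal_numeral[symmetric]
        del: ennreal_plus ennreal_numeral)
  finally show ?thesis .
qed

lemma L2_approx_add:
  assumes f: "L2_approx f" "f \<in> borel_measurable N" and g: "L2_approx g" "g \<in> borel_measurable N"
  shows "L2_approx (\<lambda>x. f x + g x)"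
  unfolding L2_approx_def
proof (intro allI impI)
  fix e :: real assume e: "e > 0"
  obtain \<phi> where \<phi>: "\<phi> \<in> smooth_gen" "\<phi> \<in> test_functions \<Omega>" "(\<integral>\<^sup>+x. ennreal ((f x - \<phi> x)\<^sup>2) \<partial>N) < ennreal (e / 4)"
    using L2_approxD[OF f(1), of "e / 4"] e by auto
  obtain \<psi> where \<psi>: "\<psi> \<in> smooth_gen" "\<psi> \<in> test_functions \<Omega>" "(\<integral>\<^sup>+x. ennreal ((g x - \<psi> x)\<^sup>2) \<partial>N) < ennreal (e / 4)"
    using L2_approxD[OF g(1), of "e / 4"] e by auto
  note m = smooth_gen_measurable[OF \<phi>(1)] smooth_gen_measurable[OF \<psi>(1)] f(2) g(2)
  have "(\<integral>\<^sup>+x. ennreal (((f x - \<phi> x) + (g x - \<psi> x))\<^sup>2) \<partial>N) < ennreal e"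
    using m by (intro nn_integral_square_sum_less \<phi> \<psi> e borel_measurable_diff)
  moreover have "(\<lambda>x. \<phi> x + \<psi> x) \<in> test_functions \<Omega>"
  proof (rule smooth_gen_test_function[OF smooth_gen.add[OF \<phi>(1) \<psi>(1)]])
    show "compact (closure {x. \<phi> x \<noteq> 0} \<union> closure {x. \<psi> x \<noteq> 0})"
      "closure {x. \<phi> x \<noteq> 0} \<union> closure {x. \<psi> x \<noteq> 0} \<subseteq> \<Omega>"
      using \<phi>(2) \<psi>(2) by (auto simp: test_functions_def)
    show "{x. \<phi> x + \<psi> x \<noteq> 0} \<subseteq> closure {x. \<phi> x \<noteq> 0} \<union> closure {x. \<psi> x \<noteq> 0}"
    proof
      fix x assume "x \<in> {x. \<phi> x + \<psi> x \<noteq> 0}"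
      then have "x \<in> {x. \<phi> x \<noteq> 0} \<or> x \<in> {x. \<psi> x \<noteq> 0}" by auto
      then show "x \<in> closure {x. \<phi> x \<noteq> 0} \<union> closure {x. \<psi> x \<noteq> 0}"
        using subsetD[OF closure_subset, of x "{x. \<phi> x \<noteq> 0}"]
          subsetD[OF closure_subset, of x "{x. \<psi> x \<noteq> 0}"] by blast
    qed
  qed
  ultimately show "\<exists>\<phi>\<in>smooth_gen \<inter> test_functions \<Omega>. (\<integral>\<^sup>+x. ennreal ((f x + g x - \<phi> x)\<^sup>2) \<partial>N) < ennreal e"
    using smooth_gen.add[OF \<phi>(1) \<psi>(1)] by (intro bexI[of _ "\<lambda>x. \<phi> x + \<psi> x"]) (auto simp: algebra_simps)
qed

lemma L2_approx_cmult:
  assumes f: "L2_approx f" "f \<in> borel_measurable N"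
  shows "L2_approx (\<lambda>x. c * f x)"
  unfolding L2_approx_def
proof (intro allI impI)
  fix e :: real assume e: "e > 0"
  then have "e / (c\<^sup>2 + 1) > 0" by (simp add: add_nonneg_pos)
  then obtain \<phi> where \<phi>: "\<phi> \<in> smooth_gen" "\<phi> \<in> test_functions \<Omega>"
      "(\<integral>\<^sup>+x. ennreal ((f x - \<phi> x)\<^sup>2) \<partial>N) < ennreal (e / (c\<^sup>2 + 1))"
    using L2_approxD[OF f(1)] by blast
  note m = smooth_gen_measurable[OF \<phi>(1)] f(2)
  have "(\<integral>\<^sup>+x. ennreal ((c * f x - c * \<phi> x)\<^sup>2) \<partial>N) = (\<integral>\<^sup>+x. ennreal (c\<^sup>2) * ennreal ((f x - \<phi> x)\<^sup>2) \<partial>N)"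
    by (intro nn_integral_cong) (simp add: ennreal_mult'[symmetric] power_mult_distrib[symmetric] right_diff_distrib)
  also have "\<dots> = ennreal (c\<^sup>2) * (\<integral>\<^sup>+x. ennreal ((f x - \<phi> x)\<^sup>2) \<partial>N)"
    using m by (intro nn_integral_cmult) measurable
  also have "\<dots> \<le> ennreal (c\<^sup>2) * ennreal (e / (c\<^sup>2 + 1))"
    using \<phi>(3) by (intro mult_left_mono) auto
  also have "\<dots> < ennreal e"
  proof -
    have "c\<^sup>2 * (e / (c\<^sup>2 + 1)) < e"
    proof -
      have "c\<^sup>2 + 1 > 0" by (simp add: add_nonneg_pos)
      then show ?thesis using e by (simp add: pos_divide_less_eq algebra_simps)
    qed
    then show ?thesis using e by (simp add: ennreal_mult'[symmetric] ennreal_less_iff)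
  qed
  finally have "(\<integral>\<^sup>+x. ennreal ((c * f x - c * \<phi> x)\<^sup>2) \<partial>N) < ennreal e" .
  moreover have "(\<lambda>x. c * \<phi> x) \<in> test_functions \<Omega>"
    by (rule smooth_gen_test_function[OF smooth_gen_cmult[OF \<phi>(1)], of "closure {x. \<phi> x \<noteq> 0}"])
      (use \<phi>(2) closure_subset[of "{x. \<phi> x \<noteq> 0}"] in \<open>auto simp: test_functions_def\<close>)
  ultimately show "\<exists>\<phi>\<in>smooth_gen \<inter> test_functions \<Omega>. (\<integral>\<^sup>+x. ennreal ((c * f x - \<phi> x)\<^sup>2) \<partial>N) < ennreal e"
    using smooth_gen_cmult[OF \<phi>(1)] by (intro bexI[of _ "\<lambda>x. c * \<phi> x"]) auto
qed

text \<open>A set is squeezed between a closed subset and an open superset of nearly the same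
  measure, and a cutoff is placed between them. It differs from the indicator only on the two small
  differences, where the error is at most 1. The closed set is compact because \<Omega> is
  bounded.\<close>

lemma L2_approx_indicator:
  assumes A: "A \<in> sets N" shows "L2_approx (indicator A)"
  unfolding L2_approx_def
proof (intro allI impI)
  fix e :: real assume e: "e > 0"
  have A': "A \<in> sets lebesgue" "A \<subseteq> \<Omega>"
    using A op by (auto simp: sets_restrict_space)
  obtain T where T: "closed T" "T \<subseteq> A" "A - T \<in> lmeasurable" "emeasure lebesgue (A - T) < ennreal (e / 2)"
    using sets_lebesgue_inner_closed[OF A'(1), of "e / 2"] e by auto
  obtain S where S: "open S" "A \<subseteq> S" "S - A \<in> lmeasurable" "emeasure lebesgue (S - A) < ennreal (e / 2)"
    using sets_lebesgue_outer_open[OF A'(1), of "e / 2"] e by auto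
  have cT: "compact T" using T A' bnd bounded_subset by (metis compact_eq_bounded_closed order_trans)
  obtain \<phi> where \<phi>: "\<phi> \<in> smooth_gen" "\<phi> \<in> test_functions (S \<inter> \<Omega>)" "\<And>x. 0 \<le> \<phi> x" "\<And>x. \<phi> x \<le> 1"
    "\<And>x. x \<in> T \<Longrightarrow> \<phi> x = 1" "\<And>x. x \<notin> S \<inter> \<Omega> \<Longrightarrow> \<phi> x = 0"
  proof -
    have "T \<subseteq> S \<inter> \<Omega>" "open (S \<inter> \<Omega>)" using T S A' op by auto
    from smooth_cutoff[OF cT this] show ?thesis using that by blast
  qed
  have "(\<integral>\<^sup>+x. ennreal ((indicator A x - \<phi> x)\<^sup>2) \<partial>N)
      = (\<integral>\<^sup>+x. ennreal ((indicator A x - \<phi> x)\<^sup>2) * indicator \<Omega> x \<partial>lebesgue)"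
    using op by (intro nn_integral_restrict_space) simp
  also have "\<dots> \<le> (\<integral>\<^sup>+x. indicator ((A - T) \<union> (S - A)) x \<partial>lebesgue)"
  proof (intro nn_integral_mono)
    fix x
    have "(indicator A x - \<phi> x)\<^sup>2 \<le> 1\<^sup>2"
      using \<phi>(3,4)[of x] by (intro abs_le_square_iff[THEN iffD1]) (auto simp: indicator_def)
    moreover have "(indicator A x - \<phi> x)\<^sup>2 = 0" if "x \<notin> (A - T) \<union> (S - A)"
      using that \<phi>(5,6)[of x] T(2) S(2) by (auto simp: indicator_def)
    ultimately show "ennreal ((indicator A x - \<phi> x)\<^sup>2) * indicator \<Omega> x \<le> indicator ((A - T) \<union> (S - A)) x"
      by (auto simp: indicator_def)
  qed
  also have "\<dots> = emeasure lebesgue ((A - T) \<union> (S - A))"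
    using T S by (intro nn_integral_indicator) auto
  also have "\<dots> \<le> emeasure lebesgue (A - T) + emeasure lebesgue (S - A)"
    using T S by (intro emeasure_subadditive) auto
  also have "\<dots> < ennreal (e / 2) + ennreal (e / 2)"
    using T S by (intro add_strict_mono)
  also have "\<dots> = ennreal e" using e by (simp add: ennreal_plus[symmetric] del: ennreal_plus)
  finally have "(\<integral>\<^sup>+x. ennreal ((indicator A x - \<phi> x)\<^sup>2) \<partial>N) < ennreal e" .
  moreover have "\<phi> \<in> test_functions \<Omega>" using \<phi>(2) by (auto simp: test_functions_def)
  ultimately show "\<exists>\<phi>\<in>smooth_gen \<inter> test_functions \<Omega>. (\<integral>\<^sup>+x. ennreal ((indicator A x - \<phi> x)\<^sup>2) \<partial>N) < ennreal e"
    using \<phi>(1) by auto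
qed

text \<open>Induction over nonnegative measurable functions. The sum and limit steps pass to
  functions below \<open>f\<close>, so square integrability is inherited, and the square of
  \<open>f\<close> dominates in the limit step.\<close>

lemma L2_approx_nonneg:
  fixes f :: "real^'n \<Rightarrow> real"
  assumes "f \<in> borel_measurable N" "\<And>x. 0 \<le> f x" "integrable N (\<lambda>x. (f x)\<^sup>2)"
  shows "L2_approx f"
  using assms
proof (induction rule: borel_measurable_induct_real)
  case (set A)
  then show ?case by (simp add: L2_approx_indicator)
next
  case (mult u c)
  show ?case
  proof (cases "c = 0")
    case True
    have "L2_approx (indicator {})" by (rule L2_approx_indicator) simp
    then show ?thesis using True by (simp add: indicator_def[abs_def])
  next
    case False
    then have "integrable N (\<lambda>x. (u x)\<^sup>2)"
      using mult.prems by (simp add: power_mult_distrib)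
    with mult show ?thesis by (intro L2_approx_cmult) auto
  qed
next
  case (add u v)
  have "integrable N (\<lambda>x. (u x)\<^sup>2)" "integrable N (\<lambda>x. (v x)\<^sup>2)"
    by (rule Bochner_Integration.integrable_bound[OF add.prems];
      use add in \<open>auto intro!: AE_I2 power_mono\<close>)+
  with add show ?case by (intro L2_approx_add) auto
next
  case (seq U)
  have Ule: "U i x \<le> f x" if "x \<in> \<Omega>" for i x
    using seq.hyps(3,4) that by (intro incseq_le[of "\<lambda>i. U i x"]) (auto simp: incseq_def le_fun_def)
  have int: "integrable N (\<lambda>x. (U i x)\<^sup>2)" for i
    by (rule Bochner_Integration.integrable_bound[OF seq.prems])
      (use seq.hyps Ule in \<open>auto intro!: AE_I2 power_mono\<close>)
  have appr: "L2_approx (U i)" for i using seq.IH int by blast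
  have fm: "f \<in> borel_measurable N"
    by (rule borel_measurable_LIMSEQ_real[OF seq.hyps(4) seq.hyps(1)])
  have lim: "(\<lambda>i. \<integral>\<^sup>+x. ennreal ((f x - U i x)\<^sup>2) \<partial>N) \<longlonglongrightarrow> (\<integral>\<^sup>+x. ennreal 0 \<partial>N)"
  proof (rule nn_integral_dominated_convergence[where w = "\<lambda>x. ennreal ((f x)\<^sup>2)"])
    show "(\<integral>\<^sup>+x. ennreal ((f x)\<^sup>2) \<partial>N) < \<infinity>"
      using seq.prems by (simp add: nn_integral_eq_integral)
    show "AE x in N. ennreal ((f x - U i x)\<^sup>2) \<le> ennreal ((f x)\<^sup>2)" for i
      using Ule seq.hyps(2) by (intro AE_I2 ennreal_leI power_mono) auto
    show "AE x in N. (\<lambda>i. ennreal ((f x - U i x)\<^sup>2)) \<longlonglongrightarrow> ennreal 0"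
    proof (rule AE_I2)
      fix x assume "x \<in> space N"
      from seq.hyps(4)[OF this] have "(\<lambda>i. (f x - U i x)\<^sup>2) \<longlonglongrightarrow> (f x - f x)\<^sup>2"
        by (intro tendsto_intros)
      then show "(\<lambda>i. ennreal ((f x - U i x)\<^sup>2)) \<longlonglongrightarrow> ennreal 0" by (intro tendsto_ennrealI) simp
    qed
  qed (use fm seq.hyps(1) in measurable)
  show ?case
    unfolding L2_approx_def
  proof (intro allI impI)
    fix e :: real assume e: "e > 0"
    then have "0 < ennreal (e / 4)" by simp
    with order_tendstoD(2)[OF lim, of "ennreal (e / 4)"]
    obtain i where i: "(\<integral>\<^sup>+x. ennreal ((f x - U i x)\<^sup>2) \<partial>N) < ennreal (e / 4)"
      by (auto simp: eventually_sequentially)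
    obtain \<phi> where \<phi>: "\<phi> \<in> smooth_gen" "\<phi> \<in> test_functions \<Omega>" "(\<integral>\<^sup>+x. ennreal ((U i x - \<phi> x)\<^sup>2) \<partial>N) < ennreal (e / 4)"
      using L2_approxD[OF appr[of i], of "e / 4"] e by auto
    have "(\<integral>\<^sup>+x. ennreal (((f x - U i x) + (U i x - \<phi> x))\<^sup>2) \<partial>N) < ennreal e"
      using fm seq.hyps(1)[of i] smooth_gen_measurable[OF \<phi>(1)]
      by (intro nn_integral_square_sum_less \<phi> i e borel_measurable_diff)
    then show "\<exists>\<phi>\<in>smooth_gen \<inter> test_functions \<Omega>. (\<integral>\<^sup>+x. ennreal ((f x - \<phi> x)\<^sup>2) \<partial>N) < ennreal e"
      using \<phi> by auto
  qed
qed

lemma test_functions_dense_L2: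
  fixes f :: "real^'n \<Rightarrow> real"
  assumes f: "f \<in> square_int N" and e: "e > 0"
  obtains \<phi> where "\<phi> \<in> smooth_gen" "\<phi> \<in> test_functions \<Omega>" "(\<integral>x. (f x - \<phi> x)\<^sup>2 \<partial>N) < e"
proof -
  have [measurable]: "f \<in> borel_measurable N" and i: "integrable N (\<lambda>x. (f x)\<^sup>2)"
    using f by (auto simp: square_int_def)
  have i1: "integrable N (\<lambda>x. (max 0 (f x))\<^sup>2)"
    by (rule Bochner_Integration.integrable_bound[OF i]) (auto intro!: AE_I2 simp: max_def)
  have i2: "integrable N (\<lambda>x. (max 0 (- f x))\<^sup>2)"
    by (rule Bochner_Integration.integrable_bound[OF i]) (auto intro!: AE_I2 simp: max_def)
  have "L2_approx (\<lambda>x. max 0 (f x) + (-1) * max 0 (- f x))"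
    by (intro L2_approx_add L2_approx_cmult L2_approx_nonneg i1 i2) auto
  also have "(\<lambda>x. max 0 (f x) + (-1) * max 0 (- f x)) = f" by (auto simp: max_def fun_eq_iff)
  finally obtain \<phi> where \<phi>: "\<phi> \<in> smooth_gen" "\<phi> \<in> test_functions \<Omega>" "(\<integral>\<^sup>+x. ennreal ((f x - \<phi> x)\<^sup>2) \<partial>N) < ennreal e"
    using L2_approxD[OF _ e] by blast
  have "\<phi> \<in> square_int N" using smooth_gen_C_k[OF \<phi>(1), of 0] by (intro square_int_continuous) simp
  from square_int_diff[OF f this] have "integrable N (\<lambda>x. (f x - \<phi> x)\<^sup>2)" by (simp add: square_int_def)
  then have "(\<integral>x. (f x - \<phi> x)\<^sup>2 \<partial>N) < e"
    using \<phi>(3) by (simp add: nn_integral_eq_integral ennreal_less_iff)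
  with \<phi> that show thesis by blast
qed

subsection \<open>Weak gradients\<close>

lemma test_function_C1: "\<phi> \<in> test_functions U \<Longrightarrow> C_k (Suc 0) \<phi>"
  unfolding test_functions_def by blast

lemma test_function_continuous:
  assumes "\<phi> \<in> test_functions U"
  shows "continuous_on UNIV \<phi>" "continuous_on UNIV (partial_deriv i \<phi>)"
  using test_function_C1[OF assms]
  by (auto intro!: differentiable_imp_continuous_on simp: differentiable_on_def)

lemma test_function_square_int:
  assumes "\<phi> \<in> test_functions U" shows "\<phi> \<in> square_int N" "partial_deriv i \<phi> \<in> square_int N"
  using test_function_continuous[OF assms] by (auto intro: square_int_continuous)

lemma is_weak_gradD:
  "is_weak_grad \<Omega> u g \<Longrightarrow> \<phi> \<in> test_functions \<Omega> \<Longrightarrow>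
    (\<integral>x. u x * partial_deriv i \<phi> x \<partial>N) = - (\<integral>x. g x $ i * \<phi> x \<partial>N)"
  unfolding is_weak_grad_def by blast

text \<open>A component \<open>h\<close> of the difference is orthogonal to every test function. If
  its squared norm \<open>A\<close> were positive, a test function within squared distance
  \<open>A / 2\<close> would give \<open>A\<^sup>2 \<le> A * (A / 2)\<close> by
  Cauchy-Schwarz.\<close>

lemma weak_grad_unique:
  assumes g: "g \<in> square_int N" "is_weak_grad \<Omega> u g" and g': "g' \<in> square_int N" "is_weak_grad \<Omega> u g'"
  shows "AE x in N. g x = g' x"
proof -
  have "AE x in N. g x $ i = g' x $ i" for i
  proof -
    define h where "h x = g x $ i - g' x $ i" for x
    have h: "h \<in> square_int N" unfolding h_def by (intro square_int_diff square_int_nth g g')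
    have [measurable]: "h \<in> borel_measurable N" and ih: "integrable N (\<lambda>x. (h x)\<^sup>2)"
      using h by (auto simp: square_int_def)
    have orth: "(\<integral>x. h x * \<phi> x \<partial>N) = 0" if \<phi>: "\<phi> \<in> test_functions \<Omega>" for \<phi>
    proof -
      have "(\<integral>x. h x * \<phi> x \<partial>N) = (\<integral>x. g x $ i * \<phi> x \<partial>N) - (\<integral>x. g' x $ i * \<phi> x \<partial>N)"
        unfolding h_def left_diff_distrib
        by (intro Bochner_Integration.integral_diff square_int_mult square_int_nth g g' test_function_square_int[OF \<phi>])
      then show ?thesis using is_weak_gradD[OF g(2) \<phi>, of i] is_weak_gradD[OF g'(2) \<phi>, of i] by simp
    qed
    define A where "A = (\<integral>x. (h x)\<^sup>2 \<partial>N)"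
    have A0: "A \<ge> 0" by (simp add: A_def)
    have "A = 0"
    proof (rule ccontr)
      assume "A \<noteq> 0"
      with A0 have A: "A / 2 > 0" by simp
      obtain \<phi> where \<phi>: "\<phi> \<in> test_functions \<Omega>" "(\<integral>x. (h x - \<phi> x)\<^sup>2 \<partial>N) < A / 2"
        using test_functions_dense_L2[OF h A] by blast
      have hd: "(\<lambda>x. h x - \<phi> x) \<in> square_int N"
        by (intro square_int_diff h test_function_square_int[OF \<phi>(1)])
      have "A = (\<integral>x. h x * (h x - \<phi> x) + h x * \<phi> x \<partial>N)"
        by (simp add: A_def algebra_simps power2_eq_square)
      also have "\<dots> = (\<integral>x. h x * (h x - \<phi> x) \<partial>N)"
        using square_int_mult[OF h hd] square_int_mult[OF h test_function_square_int(1)[OF \<phi>(1)]] orth[OF \<phi>(1)]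
        by (subst Bochner_Integration.integral_add) auto
      finally have "A\<^sup>2 \<le> A * (\<integral>x. (h x - \<phi> x)\<^sup>2 \<partial>N)"
        unfolding A_def using integral_Cauchy_Schwarz[of h N "\<lambda>x. h x - \<phi> x"] h hd
        by (simp add: square_int_def)
      also have "\<dots> \<le> A * (A / 2)" using \<phi>(2) A0 by (intro mult_left_mono) auto
      finally show False using \<open>A \<noteq> 0\<close> A0 by (simp add: power2_eq_square)
    qed
    then have "AE x in N. (h x)\<^sup>2 = 0"
      unfolding A_def using integral_nonneg_eq_0_iff_AE[OF ih] by simp
    then show ?thesis by eventually_elim (simp add: h_def)
  qed
  then have "AE x in N. \<forall>i. g x $ i = g' x $ i" by (simp add: AE_all_countable)
  then show ?thesis by eventually_elim (simp add: vec_eq_iff)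
qed

lemma integral_N_lborel:
  fixes F :: "real^'n \<Rightarrow> real"
  assumes "F \<in> borel_measurable borel" "\<And>x. x \<notin> \<Omega> \<Longrightarrow> F x = 0"
  shows "(\<integral>x. F x \<partial>N) = (\<integral>x. F x \<partial>lborel)"
proof -
  have "(\<integral>x. F x \<partial>N) = (\<integral>x. indicator \<Omega> x *\<^sub>R F x \<partial>lebesgue)"
    using op by (intro integral_restrict_space) simp
  also have "(\<lambda>x. indicator \<Omega> x *\<^sub>R F x) = F" using assms(2) by (auto simp: indicator_def fun_eq_iff)
  also have "integral\<^sup>L lebesgue F = (\<integral>x. F x \<partial>lborel)" using assms(1) by (intro integral_completion) simp
  finally show ?thesis .
qed

lemma grad_mult:
  assumes "f differentiable (at x)" "g differentiable (at x)"
  shows "grad (\<lambda>x. f x * g x) x = g x *\<^sub>R grad f x + f x *\<^sub>R grad g x"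
  by (rule grad_eqI)
    (use has_derivative_grad[OF assms(1)] has_derivative_grad[OF assms(2)] in
      \<open>auto intro!: derivative_eq_intros simp: inner_add_right algebra_simps\<close>)

text \<open>Integration by parts: the product with a test function has compact support inside
  \<Omega>, so the integral of its partial derivative vanishes, both over the whole space and over
  \<Omega>.\<close>

lemma is_weak_grad_C1:
  assumes w: "C_k (Suc 0) w" shows "is_weak_grad \<Omega> w (grad w)"
  unfolding is_weak_grad_def
proof (intro ballI allI)
  fix \<psi> i assume \<psi>: "\<psi> \<in> test_functions \<Omega>"
  note \<psi>1 = test_function_C1[OF \<psi>]
  have cw: "continuous_on UNIV w" "\<And>i. continuous_on UNIV (partial_deriv i w)"
    using w by (auto intro!: differentiable_imp_continuous_on simp: differentiable_on_def)
  note c\<psi> = test_function_continuous[OF \<psi>]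
  let ?f = "\<lambda>x. w x * \<psi> x"
  have pd: "partial_deriv j ?f = (\<lambda>x. \<psi> x * partial_deriv j w x + w x * partial_deriv j \<psi> x)" for j
  proof
    fix x
    have "grad ?f x $ j = (\<psi> x *\<^sub>R grad w x + w x *\<^sub>R grad \<psi> x) $ j"
      using w \<psi>1 by (subst grad_mult) auto
    then show "partial_deriv j ?f x = \<psi> x * partial_deriv j w x + w x * partial_deriv j \<psi> x" by simp
  qed
  have f1: "C_k (Suc 0) ?f"
    unfolding C_k.simps pd using w \<psi>1 cw c\<psi>
    by (auto intro!: continuous_on_add continuous_on_mult differentiable_mult)
  have sup: "compact (closure {x. \<psi> x \<noteq> 0})" "closure {x. \<psi> x \<noteq> 0} \<subseteq> \<Omega>"
    using \<psi> by (auto simp: test_functions_def)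
  have "compact (closure {x. ?f x \<noteq> 0})"
    using closure_subset[of "{x. \<psi> x \<noteq> 0}"] by (intro compact_closure_subset[OF sup(1)]) auto
  from integral_partial_deriv_eq_0[OF f1 this, of i]
  have 0: "(\<integral>x. \<psi> x * partial_deriv i w x + w x * partial_deriv i \<psi> x \<partial>lborel) = 0"
    by (simp add: pd)
  have \<psi>0: "\<psi> x = 0" "partial_deriv i \<psi> x = 0" if "x \<notin> \<Omega>" for x
  proof -
    have "x \<notin> closure {x. \<psi> x \<noteq> 0}" using that sup by auto
    then show "\<psi> x = 0" using closure_subset[of "{x. \<psi> x \<noteq> 0}"] by auto
    have "grad \<psi> x = 0"
      by (rule grad_eq_0_open[of "- closure {x. \<psi> x \<noteq> 0}"])
        (use \<open>x \<notin> closure _\<close> closure_subset[of "{x. \<psi> x \<noteq> 0}"] in auto)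
    then show "partial_deriv i \<psi> x = 0" by (metis grad_nth zero_index)
  qed
  have "(\<integral>x. \<psi> x * partial_deriv i w x + w x * partial_deriv i \<psi> x \<partial>N) = 0"
    using \<psi>0 cw c\<psi> by (subst integral_N_lborel)
      (auto simp: 0 intro!: borel_measurable_continuous_onI continuous_on_add continuous_on_mult)
  moreover have "integrable N (\<lambda>x. \<psi> x * partial_deriv i w x)" "integrable N (\<lambda>x. w x * partial_deriv i \<psi> x)"
    using cw c\<psi> by (auto intro!: integrable_continuous continuous_on_mult)
  ultimately have "(\<integral>x. \<psi> x * partial_deriv i w x \<partial>N) + (\<integral>x. w x * partial_deriv i \<psi> x \<partial>N) = 0"
    by simp
  then show "(\<integral>x. w x * partial_deriv i \<psi> x \<partial>N) = - (\<integral>x. grad w x $ i * \<psi> x \<partial>N)"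
    by (simp add: mult.commute)
qed

lemma is_weak_grad_diff:
  assumes u: "u \<in> square_int N" "g \<in> square_int N" "is_weak_grad \<Omega> u g"
    and v: "v \<in> square_int N" "h \<in> square_int N" "is_weak_grad \<Omega> v h"
  shows "is_weak_grad \<Omega> (\<lambda>x. u x - v x) (\<lambda>x. g x - h x)"
  unfolding is_weak_grad_def
proof (intro ballI allI)
  fix \<phi> i assume \<phi>: "\<phi> \<in> test_functions \<Omega>"
  note i = square_int_mult[OF _ test_function_square_int(1)[OF \<phi>]] square_int_mult[OF _ test_function_square_int(2)[OF \<phi>]]
  show "(\<integral>x. (u x - v x) * partial_deriv i \<phi> x \<partial>N) = - (\<integral>x. (g x - h x) $ i * \<phi> x \<partial>N)"
    using is_weak_gradD[OF u(3) \<phi>, of i] is_weak_gradD[OF v(3) \<phi>, of i] u v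
    by (simp add: left_diff_distrib i square_int_nth)
qed

lemma W12_weak_grad:
  assumes "u \<in> W12 \<Omega>"
  shows "u \<in> square_int N" "weak_grad \<Omega> u \<in> square_int N" "is_weak_grad \<Omega> u (weak_grad \<Omega> u)"
proof -
  show "u \<in> square_int N" using assms by (simp add: W12_def)
  have "\<exists>g. g \<in> square_int N \<and> is_weak_grad \<Omega> u g" using assms by (auto simp: W12_def)
  then show "weak_grad \<Omega> u \<in> square_int N" "is_weak_grad \<Omega> u (weak_grad \<Omega> u)"
    unfolding weak_grad_def by (metis (mono_tags, lifting) someI_ex)+
qed

lemma W12I: "u \<in> square_int N \<Longrightarrow> g \<in> square_int N \<Longrightarrow> is_weak_grad \<Omega> u g \<Longrightarrow> u \<in> W12 \<Omega>"
  by (auto simp: W12_def)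

text \<open>By uniqueness, the representative picked by \<open>SOME\<close> may be exchanged almost
  everywhere for any weak gradient at hand.\<close>

lemma weak_grad_AE:
  assumes "u \<in> square_int N" "g \<in> square_int N" "is_weak_grad \<Omega> u g"
  shows "AE x in N. weak_grad \<Omega> u x = g x"
  using weak_grad_unique W12_weak_grad[OF W12I[OF assms]] assms by blast

subsection \<open>Mollified values of functions with a weak gradient\<close>

text \<open>Defined for every centre, but it is a genuine mean of \<open>u\<close> only when the
  support of the kernel lies in \<Omega>; the integral over \<open>N\<close> cuts the kernel off
  otherwise.\<close>

definition mollified :: "(real^'n \<Rightarrow> real) \<Rightarrow> real \<Rightarrow> real^'n \<Rightarrow> real" where
  "mollified u s a = (\<integral>x. u x * kernel s a x \<partial>N)"

lemma kernel_square_int: "kernel s a \<in> square_int N"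
  by (rule square_int_continuous[OF continuous_kernel])

text \<open>The kernel is at most the constant on the right, and its total mass is 1.\<close>

lemma integral_kernel_square_le:
  assumes s: "s > 0"
  shows "(\<integral>x. (kernel s a x)\<^sup>2 \<partial>N) \<le> 1 / (bump_integral TYPE('n) * s ^ CARD('n))"
proof -
  let ?c = "1 / (bump_integral TYPE('n) * s ^ CARD('n))"
  have c: "?c \<ge> 0" using s bump_integral_pos[where 'n='n] by simp
  have i: "integrable N (\<lambda>x. (kernel s a x)\<^sup>2)" using kernel_square_int[of s a] by (simp add: square_int_def)
  have "ennreal (\<integral>x. (kernel s a x)\<^sup>2 \<partial>N) = (\<integral>\<^sup>+x. ennreal ((kernel s a x)\<^sup>2) \<partial>N)"
    using i by (simp add: nn_integral_eq_integral)
  also have "\<dots> = (\<integral>\<^sup>+x. ennreal ((kernel s a x)\<^sup>2) * indicator \<Omega> x \<partial>lborel)"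
    using op by (simp add: nn_integral_restrict_space nn_integral_completion)
  also have "\<dots> \<le> (\<integral>\<^sup>+x. ennreal ?c * ennreal (kernel s a x) \<partial>lborel)"
  proof (intro nn_integral_mono)
    fix x
    have "(kernel s a x)\<^sup>2 \<le> ?c * kernel s a x"
      unfolding power2_eq_square using kernel_le[OF s, of a x] kernel_nonneg[OF s, of a x]
      by (intro mult_right_mono) auto
    then show "ennreal ((kernel s a x)\<^sup>2) * indicator \<Omega> x \<le> ennreal ?c * ennreal (kernel s a x)"
      using c by (auto simp: indicator_def ennreal_mult'[symmetric] ennreal_leI)
  qed
  also have "\<dots> = ennreal ?c"
    by (subst nn_integral_cmult) (simp_all add: nn_integral_kernel[OF s])
  finally show ?thesis using c by (simp only: ennreal_le_iff)
qed

lemma local_energy_real: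
  fixes f :: "real^'n \<Rightarrow> real"
  assumes f: "f \<in> square_int N" and J: "(\<integral>\<^sup>+y. ennreal ((f y)\<^sup>2) * indicator (ball x R) y \<partial>N) \<le> ennreal J" "J \<ge> 0"
  shows "(\<lambda>y. f y * indicator (ball x R) y) \<in> square_int N" "(\<integral>y. (f y * indicator (ball x R) y)\<^sup>2 \<partial>N) \<le> J"
proof -
  have [measurable]: "f \<in> borel_measurable N" and i: "integrable N (\<lambda>x. (f x)\<^sup>2)"
    using f by (auto simp: square_int_def)
  have [measurable]: "(\<lambda>y. indicator (ball x R) y :: real) \<in> borel_measurable N"
    by (intro borel_measurable_lebesgue_on borel_measurable_indicator) simp
  have m: "(\<lambda>y. (f y * indicator (ball x R) y)\<^sup>2) \<in> borel_measurable N" by measurable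
  have i2: "integrable N (\<lambda>y. (f y * indicator (ball x R) y)\<^sup>2)"
    by (rule Bochner_Integration.integrable_bound[OF i m]) (auto simp: indicator_def)
  then show "(\<lambda>y. f y * indicator (ball x R) y) \<in> square_int N" by (simp add: square_int_def)
  have "ennreal (\<integral>y. (f y * indicator (ball x R) y)\<^sup>2 \<partial>N) = (\<integral>\<^sup>+y. ennreal ((f y * indicator (ball x R) y)\<^sup>2) \<partial>N)"
    using i2 by (simp add: nn_integral_eq_integral)
  also have "\<dots> = (\<integral>\<^sup>+y. ennreal ((f y)\<^sup>2) * indicator (ball x R) y \<partial>N)"
    by (intro nn_integral_cong) (simp add: indicator_def)
  also have "\<dots> \<le> ennreal J" by (rule J(1))
  finally show "(\<integral>y. (f y * indicator (ball x R) y)\<^sup>2 \<partial>N) \<le> J"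
    using J(2) by (simp only: ennreal_le_iff)
qed

lemma mollified_bound:
  fixes f :: "real^'n \<Rightarrow> real"
  assumes f: "f \<in> square_int N" and J: "(\<integral>\<^sup>+y. ennreal ((f y)\<^sup>2) * indicator (ball x R) y \<partial>N) \<le> ennreal J" "J \<ge> 0"
    and s: "s > 0" and sub: "ball a (real CARD('n) * s) \<subseteq> ball x R"
  shows "\<bar>mollified f s a\<bar> \<le> sqrt (J / (bump_integral TYPE('n) * s ^ CARD('n)))"
proof -
  let ?f = "\<lambda>y. f y * indicator (ball x R) y" and ?c = "bump_integral TYPE('n) * s ^ CARD('n)"
  note J' = local_energy_real[OF f J]
  have "mollified f s a = (\<integral>y. ?f y * kernel s a y \<partial>N)"
    unfolding mollified_def
  proof (intro Bochner_Integration.integral_cong refl)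
    fix y
    show "f y * kernel s a y = ?f y * kernel s a y"
      using kernel_support[OF s, of a y] sub by (cases "kernel s a y = 0") auto
  qed
  then have "(mollified f s a)\<^sup>2 \<le> (\<integral>y. (?f y)\<^sup>2 \<partial>N) * (\<integral>y. (kernel s a y)\<^sup>2 \<partial>N)"
    using integral_Cauchy_Schwarz[of ?f N "kernel s a"] J'(1) kernel_square_int[of s a]
    by (simp add: square_int_def)
  also have "\<dots> \<le> J * (1 / ?c)"
    by (intro mult_mono J' integral_kernel_square_le s J) auto
  finally have "(mollified f s a)\<^sup>2 \<le> J / ?c" by simp
  then show ?thesis by (metis real_sqrt_abs real_sqrt_le_mono)
qed

text \<open>A Poincare-type estimate along a segment. By the mean value theorem the difference is
  the derivative at one intermediate centre; there the kernel is a test function in \<Omega>, so the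
  derivative equals a mollified value of the directional component of \<open>g\<close>, which
  Cauchy-Schwarz bounds by the energy in the ball.\<close>

lemma mollified_oscillation:
  assumes u: "u \<in> square_int N" and g: "g \<in> square_int N" "is_weak_grad \<Omega> u g"
    and s: "s > 0" and J: "(\<integral>\<^sup>+y. ennreal ((norm (g y))\<^sup>2) * indicator (ball x R) y \<partial>N) \<le> ennreal J" "J \<ge> 0"
    and seg: "\<And>w. w \<in> closed_segment p q \<Longrightarrow> cball w (real CARD('n) * s) \<subseteq> \<Omega>"
      "\<And>w. w \<in> closed_segment p q \<Longrightarrow> ball w (real CARD('n) * s) \<subseteq> ball x R"
  shows "\<bar>mollified u s p - mollified u s q\<bar> \<le> sqrt (J / (bump_integral TYPE('n) * s ^ CARD('n))) * dist p q"
proof -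
  let ?c = "bump_integral TYPE('n) * s ^ CARD('n)"
  define v where "v = q - p"
  define w where "w t = p + t *\<^sub>R v" for t
  have [measurable]: "u \<in> borel_measurable N" "g \<in> borel_measurable N"
    using u g by (auto simp: square_int_def)
  \<comment> \<open>This bound depends on \<open>s\<close> and serves only to dominate the
    differentiation under the integral; it does not enter the final estimate.\<close>
  obtain B where B: "B \<ge> 0" "\<And>x. norm (grad (kernel s (0 :: real^'n)) x) \<le> B"
    using bounded_grad[OF smooth_gen_C_k[OF kernel_smooth] kernel_support_compact[OF s]] by blast
  have der: "((\<lambda>t. \<integral>x. u x * kernel s (w t) x \<partial>N) has_real_derivative
      (\<integral>x. u x * - (v \<bullet> grad (kernel s (w t)) x) \<partial>N)) (at t)" for t
  proof (rule has_real_derivative_integral[where B = "\<lambda>x. \<bar>u x\<bar> * (norm v * B)"])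
    show "integrable N (\<lambda>x. u x * kernel s (w t) x)" for t
      by (rule square_int_mult[OF u kernel_square_int])
    show "((\<lambda>t. u x * kernel s (w t) x) has_real_derivative u x * - (v \<bullet> grad (kernel s (w t)) x)) (at t)" for t x
      unfolding w_def by (intro DERIV_cmult kernel_has_derivative_center)
    show "\<bar>u x * - (v \<bullet> grad (kernel s (w t)) x)\<bar> \<le> \<bar>u x\<bar> * (norm v * B)" for t x
    proof -
      have "\<bar>v \<bullet> grad (kernel s (w t)) x\<bar> \<le> norm v * norm (grad (kernel s (w t)) x)"
        by (rule Cauchy_Schwarz_ineq2)
      also have "\<dots> \<le> norm v * B"
        unfolding grad_kernel_translate[of s "w t"] by (intro mult_left_mono B) auto
      finally show ?thesis by (simp add: abs_mult mult_left_mono)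
    qed
    show "integrable N (\<lambda>x. \<bar>u x\<bar> * (norm v * B))" using square_int_integrable[OF u] by simp
  qed
  from MVT2[of 0 1 "\<lambda>t. \<integral>x. u x * kernel s (w t) x \<partial>N", OF _ der]
  obtain \<xi> where \<xi>: "0 < \<xi>" "\<xi> < 1"
    "mollified u s (w 1) - mollified u s (w 0) = (\<integral>x. u x * - (v \<bullet> grad (kernel s (w \<xi>)) x) \<partial>N)"
    unfolding mollified_def by auto
  have "w \<xi> = (1 - \<xi>) *\<^sub>R p + \<xi> *\<^sub>R q" by (simp add: w_def v_def algebra_simps)
  then have w\<xi>: "w \<xi> \<in> closed_segment p q" using \<xi> unfolding in_segment by (metis less_imp_le)
  have test: "kernel s (w \<xi>) \<in> test_functions \<Omega>"
    by (rule kernel_test_function[OF s seg(1)[OF w\<xi>]])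
  note ti = test_function_square_int[OF test]
  have "(\<integral>x. u x * - (v \<bullet> grad (kernel s (w \<xi>)) x) \<partial>N)
      = (\<integral>x. (\<Sum>i\<in>UNIV. - (v $ i) * (u x * partial_deriv i (kernel s (w \<xi>)) x)) \<partial>N)"
    by (simp add: inner_vec_def sum_distrib_left sum_negf[symmetric] mult.left_commute)
  also have "\<dots> = (\<Sum>i\<in>UNIV. - (v $ i) * (\<integral>x. u x * partial_deriv i (kernel s (w \<xi>)) x \<partial>N))"
    by (simp add: Bochner_Integration.integral_sum square_int_mult[OF u ti(2)])
  also have "\<dots> = (\<Sum>i\<in>UNIV. v $ i * (\<integral>x. g x $ i * kernel s (w \<xi>) x \<partial>N))"
    by (simp add: is_weak_gradD[OF g(2) test])
  also have "\<dots> = (\<integral>x. (\<Sum>i\<in>UNIV. v $ i * (g x $ i * kernel s (w \<xi>) x)) \<partial>N)"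
    by (simp add: Bochner_Integration.integral_sum square_int_mult[OF square_int_nth[OF g(1)] ti(1)])
  also have "\<dots> = mollified (\<lambda>x. v \<bullet> g x) s (w \<xi>)"
    by (simp add: mollified_def inner_vec_def sum_distrib_right mult.assoc)
  finally have diff: "mollified u s q - mollified u s p = mollified (\<lambda>x. v \<bullet> g x) s (w \<xi>)"
    using \<xi>(3) by (simp add: w_def v_def)
  have le: "(v \<bullet> g y)\<^sup>2 \<le> (norm v)\<^sup>2 * (norm (g y))\<^sup>2" for y
    using power_mono[OF Cauchy_Schwarz_ineq2[of v "g y"], of 2] by (simp add: power_mult_distrib)
  have vg: "(\<lambda>x. v \<bullet> g x) \<in> square_int N"
  proof -
    have "integrable N (\<lambda>x. (norm v)\<^sup>2 * (norm (g x))\<^sup>2)" using g(1) by (auto simp: square_int_def)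
    then have "integrable N (\<lambda>x. (norm (v \<bullet> g x))\<^sup>2)"
      by (rule Bochner_Integration.integrable_bound) (use le in auto)
    then show ?thesis by (simp add: square_int_def)
  qed
  have "(\<integral>\<^sup>+y. ennreal ((v \<bullet> g y)\<^sup>2) * indicator (ball x R) y \<partial>N)
      \<le> (\<integral>\<^sup>+y. ennreal ((norm v)\<^sup>2) * (ennreal ((norm (g y))\<^sup>2) * indicator (ball x R) y) \<partial>N)"
    using le by (intro nn_integral_mono) (auto simp: indicator_def ennreal_mult'[symmetric] ennreal_leI)
  also have "\<dots> = ennreal ((norm v)\<^sup>2) * (\<integral>\<^sup>+y. ennreal ((norm (g y))\<^sup>2) * indicator (ball x R) y \<partial>N)"
  proof (rule nn_integral_cmult)
    have [measurable]: "(\<lambda>y. indicator (ball x R) y :: ennreal) \<in> borel_measurable N"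
      by (intro borel_measurable_lebesgue_on borel_measurable_indicator) simp
    show "(\<lambda>y. ennreal ((norm (g y))\<^sup>2) * indicator (ball x R) y) \<in> borel_measurable N" by measurable
  qed
  also have "\<dots> \<le> ennreal ((norm v)\<^sup>2) * ennreal J" by (intro mult_left_mono J) auto
  also have "\<dots> = ennreal ((norm v)\<^sup>2 * J)" using J by (simp add: ennreal_mult)
  finally have "\<bar>mollified (\<lambda>x. v \<bullet> g x) s (w \<xi>)\<bar> \<le> sqrt ((norm v)\<^sup>2 * J / ?c)"
    by (rule mollified_bound[OF vg _ _ s seg(2)[OF w\<xi>]]) (use J in simp)
  also have "\<dots> = sqrt (J / ?c) * dist p q"
    by (simp add: real_sqrt_mult real_sqrt_divide v_def dist_norm norm_minus_commute)
  finally show ?thesis using diff by (simp add: abs_minus_commute)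
qed

lemma mollified_diff:
  assumes "u \<in> square_int N" "v \<in> square_int N"
  shows "mollified (\<lambda>x. u x - v x) s a = mollified u s a - mollified v s a"
  unfolding mollified_def left_diff_distrib
  by (intro Bochner_Integration.integral_diff square_int_mult assms kernel_square_int)

text \<open>When its support lies in \<Omega>, the kernel has mass 1 for \<open>N\<close>, so the
  difference is a weighted mean of \<open>v - b\<close> over the support.\<close>

lemma mollified_approx:
  assumes v: "v \<in> square_int N" and s: "s > 0" and sub: "cball a (real CARD('n) * s) \<subseteq> \<Omega>"
    and e: "\<And>y. dist a y \<le> real CARD('n) * s \<Longrightarrow> \<bar>v y - b\<bar> \<le> e" "e \<ge> 0"
  shows "\<bar>mollified v s a - b\<bar> \<le> e"
proof -
  have ik: "integrable N (kernel s a)" by (rule square_int_integrable[OF kernel_square_int])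
  have "ennreal (\<integral>x. kernel s a x \<partial>N) = (\<integral>\<^sup>+x. ennreal (kernel s a x) \<partial>N)"
    by (rule nn_integral_eq_integral[OF ik, symmetric]) (simp add: kernel_nonneg[OF s])
  also have "\<dots> = (\<integral>\<^sup>+x. ennreal (kernel s a x) * indicator \<Omega> x \<partial>lborel)"
    using op by (simp add: nn_integral_restrict_space nn_integral_completion)
  also have "\<dots> = (\<integral>\<^sup>+x. ennreal (kernel s a x) \<partial>lborel)"
  proof (intro nn_integral_cong)
    fix x
    show "ennreal (kernel s a x) * indicator \<Omega> x = ennreal (kernel s a x)"
      using kernel_support[OF s, of a x] sub by (cases "kernel s a x = 0") (auto simp: subset_iff)
  qed
  also have "\<dots> = 1" by (rule nn_integral_kernel[OF s])
  finally have one: "(\<integral>x. kernel s a x \<partial>N) = 1" by (simp add: ennreal_eq_1)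
  have ivk: "integrable N (\<lambda>x. v x * kernel s a x)" by (rule square_int_mult[OF v kernel_square_int])
  have "mollified v s a - b = (\<integral>x. (v x - b) * kernel s a x \<partial>N)"
    using ivk ik by (simp add: mollified_def left_diff_distrib one)
  also have "\<bar>\<dots>\<bar> \<le> (\<integral>x. \<bar>(v x - b) * kernel s a x\<bar> \<partial>N)" by (rule integral_abs_bound)
  also have "\<dots> \<le> (\<integral>x. e * kernel s a x \<partial>N)"
  proof (intro integral_mono)
    show "integrable N (\<lambda>x. \<bar>(v x - b) * kernel s a x\<bar>)" "integrable N (\<lambda>x. e * kernel s a x)"
      using ivk ik by (auto simp: left_diff_distrib)
    show "\<bar>(v x - b) * kernel s a x\<bar> \<le> e * kernel s a x" for x
      using kernel_support[OF s, of a x] kernel_nonneg[OF s, of a x] e(1)[of x]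
      by (cases "kernel s a x = 0") (auto simp: abs_mult intro!: mult_right_mono)
  qed
  also have "\<dots> = e" by (simp add: one)
  finally show ?thesis .
qed

end

section \<open>Geometry of one-sided NTA domains\<close>

lemma bdist_le_bdist: "bdist \<Omega> x \<le> bdist \<Omega> y + dist x y"
  unfolding bdist_def by (rule infdist_triangle)

text \<open>A ball is connected: if it meets \<Omega> without being contained in it, it meets the
  frontier, at a distance smaller than the distance to the frontier.\<close>

lemma ball_bdist_subset:
  assumes "x \<in> \<Omega>" shows "ball x (bdist \<Omega> x) \<subseteq> \<Omega>"
proof (rule ccontr)
  assume *: "\<not> ball x (bdist \<Omega> x) \<subseteq> \<Omega>"
  then have "bdist \<Omega> x > 0" by (metis ball_eq_empty empty_subsetI not_le)
  then have "x \<in> ball x (bdist \<Omega> x) \<inter> \<Omega>" using assms by simp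
  with * have "ball x (bdist \<Omega> x) \<inter> frontier \<Omega> \<noteq> {}"
    by (intro connected_Int_frontier[OF connected_ball]) blast+
  then obtain z where "z \<in> frontier \<Omega>" "dist x z < bdist \<Omega> x" by auto
  with infdist_le[of z "frontier \<Omega>" x] show False by (simp add: bdist_def)
qed

lemma frontier_nonempty:
  fixes \<Omega> :: "(real^'n) set"
  assumes "bounded \<Omega>" "\<Omega> \<noteq> {}" shows "frontier \<Omega> \<noteq> {}"
  using assms not_bounded_UNIV by (auto simp: frontier_eq_empty)

text \<open>A point at distance at least \<rho> from the boundary serves as its own corkscrew point.
  Otherwise the nearest frontier point is closer than \<rho>, and a corkscrew point of radius \<rho>
  there lies within 2\<rho>.\<close>

lemma corkscrew_closure:
  fixes \<Omega> :: "(real^'n) set"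
  assumes NTA: "one_sided_NTA M \<Omega>" and bnd: "bounded \<Omega>"
    and x: "x \<in> closure \<Omega>" and \<rho>: "0 < \<rho>" "\<rho> \<le> diameter \<Omega>"
  obtains a where "a \<in> \<Omega>" "dist a x \<le> 2 * \<rho>" "\<rho> / real M \<le> bdist \<Omega> a"
proof (cases "x \<in> \<Omega> \<and> \<rho> \<le> bdist \<Omega> x")
  case True
  have "\<rho> / real M \<le> \<rho>" using NTA \<rho> by (simp add: one_sided_NTA_def field_simps)
  with True \<rho> that[of x] show ?thesis by simp
next
  case False
  have op: "open \<Omega>" using NTA by (simp add: one_sided_NTA_def)
  have ne: "frontier \<Omega> \<noteq> {}"
    using frontier_nonempty[OF bnd] x by (metis closure_empty empty_iff)
  have "bdist \<Omega> x < \<rho>"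
  proof (cases "x \<in> \<Omega>")
    case True with False show ?thesis by simp
  next
    case f: False
    then have "x \<in> frontier \<Omega>" using x op by (simp add: frontier_def interior_open)
    then show ?thesis using \<rho> by (simp add: bdist_def)
  qed
  obtain z where z: "z \<in> frontier \<Omega>" "infdist x (frontier \<Omega>) = dist x z"
    using infdist_attains_inf[OF frontier_closed ne] by blast
  have "interior_corkscrew M \<Omega>" "admissible_radius \<Omega> \<rho>"
    using NTA \<rho> by (auto simp: one_sided_NTA_def admissible_radius_def)
  then obtain a where a: "a \<in> \<Omega>" "dist z a < \<rho>" "\<rho> / real M \<le> bdist \<Omega> a"
    using z(1) unfolding interior_corkscrew_def by (metis IntD1 IntD2 mem_ball)
  have "dist a x \<le> dist z a + dist x z" by (metis dist_commute dist_triangle)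
  also have "\<dots> \<le> 2 * \<rho>" using a z \<open>bdist \<Omega> x < \<rho>\<close> by (simp add: bdist_def)
  finally show ?thesis using that a by blast
qed

text \<open>A function that is Lipschitz along every segment staying away from the boundary at scale
  \<open>\<rho>\<close> oscillates little between points joined by a Harnack chain of that scale.\<close>

lemma harnack_chain_oscillation:
  fixes L :: real and M :: nat
  assumes "M > 1" "L \<ge> 1"
  obtains \<theta> C :: real where "\<theta> > 0" "C \<ge> 1" "\<theta> * L \<le> 1"
    "\<And>(\<Omega> :: (real^'n) set) x y \<rho> (F :: real^'n \<Rightarrow> real) A.
      one_sided_NTA M \<Omega> \<Longrightarrow> bounded \<Omega> \<Longrightarrow> x \<in> \<Omega> \<Longrightarrow> y \<in> \<Omega> \<Longrightarrow> \<rho> > 0 \<Longrightarrow> dist x y \<le> L * \<rho> \<Longrightarrow>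
      \<rho> / L \<le> bdist \<Omega> x \<Longrightarrow> \<rho> / L \<le> bdist \<Omega> y \<Longrightarrow> A \<ge> 0 \<Longrightarrow>
      (\<And>p q. closed_segment p q \<subseteq> {w \<in> \<Omega>. \<theta> * \<rho> \<le> bdist \<Omega> w \<and> dist x w \<le> C * \<rho>} \<Longrightarrow>
        \<bar>F p - F q\<bar> \<le> A * dist p q) \<Longrightarrow> \<bar>F x - F y\<bar> \<le> A * (C * \<rho>)"
proof -
  obtain k0 :: nat where "L\<^sup>2 < 2 ^ k0" using real_arch_pow[of 2 "L\<^sup>2"] by auto
  \<comment> \<open>The Harnack condition is used with \<epsilon> = \<rho> / L at distances up to
    L\<rho>, so 2^k must reach L^2; the successor also ensures \<open>k \<ge> 1\<close>.\<close>
  define k where "k = Suc k0"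
  have k: "L\<^sup>2 \<le> 2 ^ k" "k \<ge> 1"
    using \<open>L\<^sup>2 < 2 ^ k0\<close> by (auto simp: k_def) (metis add_increasing2 less_eq_real_def mult_2 zero_le_numeral zero_le_power)
  define N where "N = M * k"
  have N: "N \<ge> 1" using assms k by (simp add: N_def)
  \<comment> \<open>Each link at most halves the distance to the boundary, so it stays above 2^(-N)
    \<rho> / L along the chain; the extra factor 2 accounts for the segments between chain points.
    In \<open>C\<close>, each of the at most \<open>N\<close> links has length at most 2^N L
    \<rho>.\<close>
  define \<theta> where "\<theta> = 1 / (2 ^ (N + 1) * L)"
  define C where "C = real N * 2 ^ N * L"
  have \<theta>: "\<theta> > 0" using assms by (simp add: \<theta>_def)
  have "\<theta> * L = 1 / 2 ^ (N + 1)" using assms by (simp add: \<theta>_def)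
  also have "\<dots> \<le> 1" using one_le_power[of "2::real" "N + 1"] by (simp del: power_Suc)
  finally have \<theta>L: "\<theta> * L \<le> 1" .
  have "\<theta> * 1 \<le> \<theta> * L" using \<theta> assms by (intro mult_left_mono) auto
  with \<theta>L have \<theta>1: "\<theta> \<le> 1" by simp
  have "1 * 1 \<le> real N * 2 ^ N" using N by (intro mult_mono) auto
  then have CL: "L \<le> C" using assms mult_right_mono[of 1 "real N * 2 ^ N" L] by (simp add: C_def)
  show thesis
  proof (rule that)
    show "\<theta> > 0" "\<theta> * L \<le> 1" by fact+
    show "C \<ge> 1" using CL assms by simp
    fix \<Omega> :: "(real^'n) set" and x y \<rho> and F :: "real^'n \<Rightarrow> real" and A
    assume NTA: "one_sided_NTA M \<Omega>" "bounded \<Omega>" and xy: "x \<in> \<Omega>" "y \<in> \<Omega>" and \<rho>: "\<rho> > 0"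
      and d: "dist x y \<le> L * \<rho>" and bx: "\<rho> / L \<le> bdist \<Omega> x" and b_y: "\<rho> / L \<le> bdist \<Omega> y"
      and A: "A \<ge> 0"
      and F: "\<And>p q. closed_segment p q \<subseteq> {w \<in> \<Omega>. \<theta> * \<rho> \<le> bdist \<Omega> w \<and> dist x w \<le> C * \<rho>} \<Longrightarrow>
        \<bar>F p - F q\<bar> \<le> A * dist p q"
    \<comment> \<open>Links are as long as half the distance to the boundary, so a chain starting
      deep inside could run far away. If \<open>x\<close> is deep at scale \<rho>, the straight
      segment to \<open>y\<close> is used instead; otherwise the starting distance is below 2L\<rho>
      and at most doubles per link.\<close>
    consider "x = y" | "2 * L * \<rho> \<le> bdist \<Omega> x" | "x \<noteq> y" "bdist \<Omega> x < 2 * L * \<rho>" by linarith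
    then show "\<bar>F x - F y\<bar> \<le> A * (C * \<rho>)"
    proof cases
      case 1
      then show ?thesis using A \<rho> assms CL by (auto intro!: mult_nonneg_nonneg)
    next
      case 2
      have "closed_segment x y \<subseteq> {w \<in> \<Omega>. \<theta> * \<rho> \<le> bdist \<Omega> w \<and> dist x w \<le> C * \<rho>}"
      proof
        fix w assume "w \<in> closed_segment x y"
        then have w: "dist x w \<le> L * \<rho>" using dist_in_closed_segment[of w x y] d
          by (simp add: dist_commute)
        have Lp: "L * \<rho> > 0" using \<rho> assms by simp
        have "\<theta> * \<rho> \<le> L * \<rho>" using \<theta>1 assms \<rho> by simp
        then have "\<theta> * \<rho> \<le> bdist \<Omega> w"
          using bdist_le_bdist[of \<Omega> x w] w 2 by linarith
        moreover have "w \<in> \<Omega>"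
          using ball_bdist_subset[OF xy(1)] w 2 Lp by auto
        moreover have "dist x w \<le> C * \<rho>" using w CL \<rho>
          by (meson mult_right_mono less_imp_le order_trans)
        ultimately show "w \<in> {w \<in> \<Omega>. \<theta> * \<rho> \<le> bdist \<Omega> w \<and> dist x w \<le> C * \<rho>}" by simp
      qed
      from F[OF this] have "\<bar>F x - F y\<bar> \<le> A * dist x y" .
      also have "\<dots> \<le> A * (C * \<rho>)"
        using d CL \<rho> A by (intro mult_left_mono) (meson mult_right_mono less_imp_le order_trans)+
      finally show ?thesis .
    next
      case 3
      let ?r = "dist x y" and ?\<epsilon> = "\<rho> / L"
      have "admissible_radius \<Omega> ?r"
        using 3 xy NTA diameter_bounded_bound by (auto simp: admissible_radius_def)
      moreover have "?\<epsilon> > 0" using \<rho> assms by simp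
      moreover have "2 ^ k * ?\<epsilon> \<ge> ?r"
      proof -
        have "L * \<rho> = L\<^sup>2 * ?\<epsilon>" using assms by (simp add: power2_eq_square)
        also have "\<dots> \<le> 2 ^ k * ?\<epsilon>" using k \<open>?\<epsilon> > 0\<close> by (intro mult_right_mono) auto
        finally show ?thesis using d by simp
      qed
      ultimately obtain X where X: "\<And>i. i \<in> {1..N} \<Longrightarrow> X i \<in> \<Omega>" "X 1 = x" "X N = y"
        "\<And>i. i \<in> {1..<N} \<Longrightarrow> X (i + 1) \<in> ball (X i) (bdist \<Omega> (X i) / 2)"
        using NTA(1) xy bx b_y k unfolding one_sided_NTA_def harnack_chain_def N_def
        by (metis (no_types, lifting) min.bounded_iff)
      define D where "D = 2 ^ N * L * \<rho>"
      have D: "D \<ge> 0" using assms \<rho> by (simp add: D_def)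
      have ND: "real N * D = C * \<rho>" by (simp add: D_def C_def)
      have *: "?\<epsilon> \<le> 2 ^ j * bdist \<Omega> (X (Suc j)) \<and> bdist \<Omega> (X (Suc j)) \<le> 2 ^ j * (2 * L * \<rho>) \<and>
        dist x (X (Suc j)) \<le> real j * D \<and> \<bar>F x - F (X (Suc j))\<bar> \<le> A * (real j * D)" if "j < N" for j
        using that
      proof (induction j)
        case 0
        then show ?case using X(2) bx 3 by simp
      next
        case (Suc j)
        let ?p = "X (Suc j)" and ?q = "X (Suc (Suc j))"
        from Suc have IH: "?\<epsilon> \<le> 2 ^ j * bdist \<Omega> ?p" "bdist \<Omega> ?p \<le> 2 ^ j * (2 * L * \<rho>)"
          "dist x ?p \<le> real j * D" "\<bar>F x - F ?p\<bar> \<le> A * (real j * D)" by auto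
        have pq: "dist ?p ?q < bdist \<Omega> ?p / 2" using X(4)[of "Suc j"] Suc.prems by simp
        have "(2::real) ^ j \<le> 2 ^ N" using Suc.prems by (intro power_increasing) auto
        then have "bdist \<Omega> ?p / 2 \<le> D"
        proof -
          have "2 ^ j * (2 * L * \<rho>) \<le> 2 ^ N * (2 * L * \<rho>)"
            using \<open>(2::real) ^ j \<le> 2 ^ N\<close> assms \<rho> by (intro mult_right_mono) auto
          also have "\<dots> = 2 * D" by (simp add: D_def)
          finally show ?thesis using IH(2) by linarith
        qed
        with pq have pqD: "dist ?p ?q \<le> D" by linarith
        have "closed_segment ?p ?q \<subseteq> {w \<in> \<Omega>. \<theta> * \<rho> \<le> bdist \<Omega> w \<and> dist x w \<le> C * \<rho>}"
        proof
          fix w assume "w \<in> closed_segment ?p ?q"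
          then have w: "dist ?p w \<le> dist ?p ?q" using dist_in_closed_segment[of w ?p ?q]
            by (simp add: dist_commute)
          have "?p \<in> \<Omega>" using X(1) Suc.prems by auto
          moreover have "dist ?p w < bdist \<Omega> ?p" using w pq zero_le_dist[of ?p ?q] by linarith
          ultimately have "w \<in> \<Omega>" using ball_bdist_subset by fastforce
          moreover have "\<theta> * \<rho> \<le> bdist \<Omega> w"
          proof -
            have "?\<epsilon> \<le> 2 ^ N * bdist \<Omega> ?p"
              using IH(1) mult_right_mono[OF \<open>(2::real) ^ j \<le> 2 ^ N\<close>, of "bdist \<Omega> ?p"]
              by (simp add: bdist_def infdist_nonneg)
            then have "\<theta> * \<rho> \<le> bdist \<Omega> ?p / 2"
              using assms by (simp add: \<theta>_def field_simps)
            then show ?thesis using bdist_le_bdist[of \<Omega> ?p w] w pq by linarith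
          qed
          moreover have "dist x w \<le> C * \<rho>"
          proof -
            have "dist x w \<le> dist x ?p + dist ?p w" by (rule dist_triangle)
            also have "\<dots> \<le> real j * D + D" using IH(3) w pqD by linarith
            also have "\<dots> = real (Suc j) * D" by (simp add: algebra_simps)
            also have "\<dots> \<le> real N * D" using Suc.prems D by (intro mult_right_mono) auto
            finally show ?thesis using ND by simp
          qed
          ultimately show "w \<in> {w \<in> \<Omega>. \<theta> * \<rho> \<le> bdist \<Omega> w \<and> dist x w \<le> C * \<rho>}" by simp
        qed
        from F[OF this] have Fpq: "\<bar>F ?p - F ?q\<bar> \<le> A * D"
          using mult_left_mono[OF pqD A] by linarith
        have "?\<epsilon> \<le> 2 ^ Suc j * bdist \<Omega> ?q"
        proof -
          have "bdist \<Omega> ?p \<le> 2 * bdist \<Omega> ?q"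
            using bdist_le_bdist[of \<Omega> ?p ?q] pq by linarith
          then have "2 ^ j * bdist \<Omega> ?p \<le> 2 ^ j * (2 * bdist \<Omega> ?q)" by (intro mult_left_mono) auto
          also have "\<dots> = 2 ^ Suc j * bdist \<Omega> ?q" by simp
          finally show ?thesis using IH(1) by linarith
        qed
        moreover have "bdist \<Omega> ?q \<le> 2 ^ Suc j * (2 * L * \<rho>)"
        proof -
          have "bdist \<Omega> ?q \<le> 2 * bdist \<Omega> ?p"
            using bdist_le_bdist[of \<Omega> ?q ?p] pq zero_le_dist[of ?p ?q]
            unfolding dist_commute[of ?q ?p] by linarith
          also have "\<dots> \<le> 2 * (2 ^ j * (2 * L * \<rho>))" using IH(2) by linarith
          finally show ?thesis by simp
        qed
        moreover have "dist x ?q \<le> real (Suc j) * D"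
          using dist_triangle[of x ?q ?p] IH(3) pqD by (simp add: algebra_simps)
        moreover have "\<bar>F x - F ?q\<bar> \<le> A * (real (Suc j) * D)"
          using IH(4) Fpq by (simp add: algebra_simps)
        ultimately show ?case by blast
      qed
      from *[of "N - 1"] N X(3) have "\<bar>F x - F y\<bar> \<le> A * (real (N - 1) * D)" by simp
      also have "\<dots> \<le> A * (real N * D)" using A D by (intro mult_left_mono mult_right_mono) auto
      finally show ?thesis by (simp add: ND)
    qed
  qed
qed

section \<open>The trace inequality for smooth functions\<close>

abbreviation unit_ball_measure :: "(real^'n) measure" where
  "unit_ball_measure \<equiv> restrict_space lborel (ball 0 1)"

definition unit_ball_volume :: "'n::finite itself \<Rightarrow> real" where
  "unit_ball_volume _ = measure lborel (ball (0 :: real^'n) 1)"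

lemma unit_ball_volume_pos: "unit_ball_volume TYPE('n::finite) > 0"
  unfolding unit_ball_volume_def
  by (rule content_ball_pos) simp

text \<open>Written over the fixed unit ball, so that centre and radius sit in the integrand and can
  be differentiated.\<close>

definition ball_mean :: "(real^'n \<Rightarrow> real) \<Rightarrow> real^'n \<Rightarrow> real \<Rightarrow> real" where
  "ball_mean u a s = (\<integral>y. u (a + s *\<^sub>R y) \<partial>unit_ball_measure) / unit_ball_volume TYPE('n)"

lemma finite_unit_ball_measure: "finite_measure (unit_ball_measure :: (real^'n) measure)"
  using emeasure_lborel_ball_finite[of "0 :: real^'n" 1]
  by (intro finite_measureI) (auto simp: emeasure_restrict_space)

lemma measure_unit_ball:
  "measure (unit_ball_measure :: (real^'n) measure) (ball 0 1) = unit_ball_volume TYPE('n)"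
  by (simp add: unit_ball_volume_def measure_restrict_space)

lemma measurable_unit_ball:
  "f \<in> borel_measurable borel \<Longrightarrow> f \<in> borel_measurable (unit_ball_measure :: (real^'n) measure)"
  by (rule measurable_restrict_space1) simp

lemma C1_continuous:
  assumes "C_k (Suc 0) u" shows "continuous_on UNIV u" "continuous_on UNIV (grad u)"
proof -
  show "continuous_on UNIV u"
    using assms by (intro differentiable_imp_continuous_on) (simp add: differentiable_on_def)
  show "continuous_on UNIV (grad u)"
    unfolding grad_def using assms by (intro continuous_on_vec_lambda) simp
qed

lemma integrable_unit_ball:
  fixes f :: "real^'n \<Rightarrow> real"
  assumes "continuous_on UNIV f" shows "integrable unit_ball_measure f"
proof -
  interpret finite_measure "unit_ball_measure :: (real^'n) measure" by (rule finite_unit_ball_measure)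
  have "compact (f ` cball 0 1)"
    by (intro compact_continuous_image continuous_on_subset[OF assms]) auto
  then obtain B where B: "\<And>x. x \<in> cball 0 1 \<Longrightarrow> norm (f x) \<le> B"
    by (metis bounded_iff compact_imp_bounded imageI)
  show ?thesis
    by (rule integrable_const_bound[of _ B])
      (use B in \<open>auto intro!: AE_I2 measurable_unit_ball borel_measurable_continuous_onI[OF assms]
        simp: space_restrict_space\<close>)
qed

lemma nn_integral_unit_ball_affine:
  fixes f :: "real^'n \<Rightarrow> ennreal"
  assumes [measurable]: "f \<in> borel_measurable borel" and s: "s > 0"
  shows "ennreal (s ^ CARD('n)) * (\<integral>\<^sup>+y. f (a + s *\<^sub>R y) \<partial>unit_ball_measure)
    = (\<integral>\<^sup>+x. f x * indicator (ball a s) x \<partial>lborel)"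
proof -
  have "(\<integral>\<^sup>+x. f x * indicator (ball a s) x \<partial>lborel)
    = ennreal (s ^ CARD('n)) * (\<integral>\<^sup>+y. f (a + s *\<^sub>R y) * indicator (ball a s) (a + s *\<^sub>R y) \<partial>lborel)"
    by (rule nn_integral_lborel_affine[of _ s a, simplified DIM_cart DIM_real mult_1_right])
      (use s in \<open>auto intro!: borel_measurable_times_ennreal borel_measurable_indicator\<close>)
  also have "(\<lambda>y. indicator (ball a s) (a + s *\<^sub>R y) :: ennreal) = indicator (ball 0 1)"
    using s by (auto simp: fun_eq_iff indicator_def dist_norm)
  then have "(\<integral>\<^sup>+y. f (a + s *\<^sub>R y) * indicator (ball a s) (a + s *\<^sub>R y) \<partial>lborel)
    = (\<integral>\<^sup>+y. f (a + s *\<^sub>R y) * indicator (ball 0 1) y \<partial>lborel)"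
    by (simp add: fun_eq_iff)
  also have "\<dots> = (\<integral>\<^sup>+y. f (a + s *\<^sub>R y) \<partial>unit_ball_measure)"
    by (simp add: nn_integral_restrict_space)
  finally show ?thesis by simp
qed

text \<open>Centre and radius are interpolated linearly and the mean is differentiated in the
  parameter. The speed of each point is at most \<open>dist a b + \<bar>s - t\<bar>\<close>, and
  Cauchy-Schwarz on one intermediate ball brings in the energy. Varying the radius together with the
  centre covers both the change of scale and the motion along a chain.\<close>

lemma ball_mean_oscillation:
  fixes u :: "real^'n \<Rightarrow> real"
  assumes u: "C_k (Suc 0) u" and bd: "\<And>x. norm (grad u x) \<le> Bd"
    and st: "\<sigma> > 0" "s \<ge> \<sigma>" "t \<ge> \<sigma>"
    and U: "\<And>\<tau>. 0 \<le> \<tau> \<Longrightarrow> \<tau> \<le> 1 \<Longrightarrow> ball (a + \<tau> *\<^sub>R (b - a)) (s + \<tau> * (t - s)) \<subseteq> U"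
    and J: "(\<integral>\<^sup>+x. ennreal ((norm (grad u x))\<^sup>2) * indicator U x \<partial>lborel) \<le> ennreal J" "J \<ge> 0"
  shows "\<bar>ball_mean u a s - ball_mean u b t\<bar> \<le>
    (dist a b + \<bar>s - t\<bar>) * sqrt (J / (unit_ball_volume TYPE('n) * \<sigma> ^ CARD('n)))"
proof -
  let ?\<omega> = "unit_ball_volume TYPE('n)" and ?M = "unit_ball_measure :: (real^'n) measure"
  interpret finite_measure ?M by (rule finite_unit_ball_measure)
  note cu = C1_continuous[OF u]
  let ?D = "dist a b + \<bar>s - t\<bar>"
  define P where "P \<tau> y = a + \<tau> *\<^sub>R (b - a) + (s + \<tau> * (t - s)) *\<^sub>R y" for \<tau> and y :: "real^'n"
  have P: "((\<lambda>\<tau>. P \<tau> y) has_derivative (\<lambda>h. h *\<^sub>R ((b - a) + (t - s) *\<^sub>R y))) (at \<tau>)" for \<tau> y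
    unfolding P_def by (auto intro!: derivative_eq_intros simp: algebra_simps)
  have D: "norm ((b - a) + (t - s) *\<^sub>R y) \<le> ?D" if "y \<in> space ?M" for y
  proof -
    have "norm ((b - a) + (t - s) *\<^sub>R y) \<le> norm (b - a) + \<bar>t - s\<bar> * norm y"
      by (rule order_trans[OF norm_triangle_ineq]) simp
    also have "\<dots> \<le> norm (b - a) + \<bar>t - s\<bar> * 1"
      using that by (intro add_left_mono mult_left_mono) (auto simp: space_restrict_space)
    finally show ?thesis by (simp add: dist_norm norm_minus_commute abs_minus_commute)
  qed
  have contP: "continuous_on UNIV (P \<tau>)" for \<tau>
    unfolding P_def by (intro continuous_intros)
  have cuP: "continuous_on UNIV (\<lambda>y. u (P \<tau> y))" "continuous_on UNIV (\<lambda>y. grad u (P \<tau> y))" for \<tau>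
    by (auto intro: continuous_on_compose2[OF cu(1) contP] continuous_on_compose2[OF cu(2) contP])
  define f' where "f' \<tau> y = ((b - a) + (t - s) *\<^sub>R y) \<bullet> grad u (P \<tau> y)" for \<tau> y
  have der: "((\<lambda>\<tau>. \<integral>y. u (P \<tau> y) \<partial>?M) has_real_derivative (\<integral>y. f' \<tau> y \<partial>?M)) (at \<tau>)" for \<tau>
  proof (rule has_real_derivative_integral[where B = "\<lambda>_. ?D * Bd"])
    show "integrable ?M (\<lambda>y. u (P \<tau> y))" for \<tau>
      by (intro integrable_unit_ball cuP)
    show "((\<lambda>\<tau>. u (P \<tau> y)) has_real_derivative f' \<tau> y) (at \<tau>)" for \<tau> y
    proof -
      have "u differentiable (at (P \<tau> y))" using u by simp
      from has_derivative_compose[OF P has_derivative_grad[OF this]]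
      show ?thesis by (simp add: has_field_derivative_def f'_def mult_commute_abs)
    qed
    show "\<bar>f' \<tau> y\<bar> \<le> ?D * Bd" if "y \<in> space ?M" for \<tau> y
    proof -
      have "\<bar>f' \<tau> y\<bar> \<le> norm ((b - a) + (t - s) *\<^sub>R y) * norm (grad u (P \<tau> y))"
        unfolding f'_def by (rule Cauchy_Schwarz_ineq2)
      also have "\<dots> \<le> ?D * Bd" using D[OF that] bd by (intro mult_mono) auto
      finally show ?thesis .
    qed
  qed simp
  from MVT2[of 0 1 "\<lambda>\<tau>. \<integral>y. u (P \<tau> y) \<partial>?M", OF _ der]
  obtain \<xi> where \<xi>: "0 < \<xi>" "\<xi> < 1"
    "(\<integral>y. u (P 1 y) \<partial>?M) - (\<integral>y. u (P 0 y) \<partial>?M) = (\<integral>y. f' \<xi> y \<partial>?M)" by auto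
  define g where "g y = norm (grad u (P \<xi> y))" for y
  have cg: "continuous_on UNIV g" unfolding g_def by (intro continuous_intros cuP)
  have ig: "integrable ?M g" by (intro integrable_unit_ball cg)
  have ig2: "integrable ?M (\<lambda>y. (g y)\<^sup>2)" by (intro integrable_unit_ball continuous_intros cg)
  have if': "integrable ?M (f' \<xi>)"
    unfolding f'_def by (intro integrable_unit_ball continuous_intros cuP)
  have "\<bar>\<integral>y. f' \<xi> y \<partial>?M\<bar> \<le> (\<integral>y. \<bar>f' \<xi> y\<bar> \<partial>?M)" by (rule integral_abs_bound)
  also have "\<dots> \<le> (\<integral>y. ?D * g y \<partial>?M)"
  proof (intro integral_mono)
    show "integrable ?M (\<lambda>y. \<bar>f' \<xi> y\<bar>)" using if' by simp
    show "integrable ?M (\<lambda>y. ?D * g y)" using ig by simp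
    show "\<bar>f' \<xi> y\<bar> \<le> ?D * g y" if "y \<in> space ?M" for y
      unfolding f'_def g_def
      by (rule order_trans[OF Cauchy_Schwarz_ineq2]) (intro mult_right_mono D[OF that] norm_ge_zero)
  qed
  also have "\<dots> = ?D * (\<integral>y. g y \<partial>?M)" by simp
  finally have 1: "\<bar>\<integral>y. f' \<xi> y \<partial>?M\<bar> \<le> ?D * (\<integral>y. g y \<partial>?M)" .
  have "(\<integral>y. g y * 1 \<partial>?M)\<^sup>2 \<le> (\<integral>y. (g y)\<^sup>2 \<partial>?M) * (\<integral>y. 1\<^sup>2 \<partial>?M)"
    by (rule integral_Cauchy_Schwarz) (use ig ig2 in auto)
  then have 2: "(\<integral>y. g y \<partial>?M)\<^sup>2 \<le> (\<integral>y. (g y)\<^sup>2 \<partial>?M) * ?\<omega>"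
    by (simp add: measure_unit_ball)
  \<comment> \<open>The intermediate radius is a convex combination of the two given ones, hence not
    below their common lower bound; returning to the ball of this radius therefore costs a
    controlled volume factor.\<close>
  define S where "S = s + \<xi> * (t - s)"
  have "S = (1 - \<xi>) * s + \<xi> * t" by (simp add: S_def algebra_simps)
  also have "\<dots> \<ge> (1 - \<xi>) * \<sigma> + \<xi> * \<sigma>"
    using st \<xi> by (intro add_mono mult_left_mono) auto
  finally have S: "S \<ge> \<sigma>" by (simp add: algebra_simps)
  with st have S0: "S > 0" by simp
  have [measurable]: "grad u \<in> borel_measurable borel"
    by (rule borel_measurable_continuous_onI[OF cu(2)])
  have "ennreal (S ^ CARD('n) * (\<integral>y. (g y)\<^sup>2 \<partial>?M)) = ennreal (S ^ CARD('n)) * (\<integral>\<^sup>+y. ennreal ((g y)\<^sup>2) \<partial>?M)"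
    using ig2 S0 by (simp add: nn_integral_eq_integral ennreal_mult)
  also have "\<dots> = (\<integral>\<^sup>+x. ennreal ((norm (grad u x))\<^sup>2) * indicator (ball (a + \<xi> *\<^sub>R (b - a)) S) x \<partial>lborel)"
    unfolding g_def P_def S_def[symmetric]
    by (rule nn_integral_unit_ball_affine[OF _ S0, of "\<lambda>x. ennreal ((norm (grad u x))\<^sup>2)"]) measurable
  also have "\<dots> \<le> (\<integral>\<^sup>+x. ennreal ((norm (grad u x))\<^sup>2) * indicator U x \<partial>lborel)"
    using U[of \<xi>] \<xi> by (intro nn_integral_mono mult_left_mono) (auto simp: indicator_def S_def)
  also have "\<dots> \<le> ennreal J" by fact
  finally have "S ^ CARD('n) * (\<integral>y. (g y)\<^sup>2 \<partial>?M) \<le> J" using J by simp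
  moreover have "\<sigma> ^ CARD('n) * (\<integral>y. (g y)\<^sup>2 \<partial>?M) \<le> S ^ CARD('n) * (\<integral>y. (g y)\<^sup>2 \<partial>?M)"
    using S st by (intro mult_right_mono power_mono) auto
  ultimately have "\<sigma> ^ CARD('n) * (\<integral>y. (g y)\<^sup>2 \<partial>?M) \<le> J" by linarith
  then have "(\<integral>y. (g y)\<^sup>2 \<partial>?M) \<le> J / \<sigma> ^ CARD('n)"
    using st by (simp add: field_simps)
  then have "(\<integral>y. (g y)\<^sup>2 \<partial>?M) * ?\<omega> \<le> J / \<sigma> ^ CARD('n) * ?\<omega>"
    using less_imp_le[OF unit_ball_volume_pos[where 'n='n]] by (rule mult_right_mono)
  with 2 have "(\<integral>y. g y \<partial>?M)\<^sup>2 \<le> J / \<sigma> ^ CARD('n) * ?\<omega>" by (rule order_trans)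
  then have "\<integral>y. g y \<partial>?M \<le> sqrt (J / \<sigma> ^ CARD('n) * ?\<omega>)" by (rule real_le_rsqrt)
  also have "\<dots> = ?\<omega> * sqrt (J / (?\<omega> * \<sigma> ^ CARD('n)))"
  proof -
    have "J / \<sigma> ^ CARD('n) * ?\<omega> = ?\<omega>\<^sup>2 * (J / (?\<omega> * \<sigma> ^ CARD('n)))"
      using unit_ball_volume_pos[where 'n='n] by (simp add: power2_eq_square)
    then show ?thesis using unit_ball_volume_pos[where 'n='n]
      by (simp only: real_sqrt_mult real_sqrt_abs abs_of_pos)
  qed
  finally have 3: "(\<integral>y. g y \<partial>?M) \<le> ?\<omega> * sqrt (J / (?\<omega> * \<sigma> ^ CARD('n)))" .
  have "ball_mean u b t - ball_mean u a s = (\<integral>y. f' \<xi> y \<partial>?M) / ?\<omega>"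
    unfolding \<xi>(3)[symmetric] by (simp add: ball_mean_def P_def diff_divide_distrib)
  then have "\<bar>ball_mean u a s - ball_mean u b t\<bar> = \<bar>\<integral>y. f' \<xi> y \<partial>?M\<bar> / ?\<omega>"
    using unit_ball_volume_pos[where 'n='n]
    by (metis abs_divide abs_minus_commute abs_of_pos)
  also have "\<dots> \<le> ?D * (?\<omega> * sqrt (J / (?\<omega> * \<sigma> ^ CARD('n)))) / ?\<omega>"
    using 1 3 unit_ball_volume_pos[where 'n='n]
    by (intro divide_right_mono order_trans[OF 1] mult_left_mono) auto
  also have "\<dots> = ?D * sqrt (J / (?\<omega> * \<sigma> ^ CARD('n)))"
    using unit_ball_volume_pos[where 'n='n] by simp
  finally show ?thesis .
qed

text \<open>All sample points stay in one compact set, on which \<open>u\<close> is bounded, so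
  dominated convergence applies.\<close>

lemma ball_mean_tendsto:
  fixes u :: "real^'n \<Rightarrow> real"
  assumes u: "continuous_on UNIV u" and a: "a \<longlonglongrightarrow> x" and s: "s \<longlonglongrightarrow> 0"
  shows "(\<lambda>j. ball_mean u (a j) (s j)) \<longlonglongrightarrow> u x"
proof -
  let ?\<omega> = "unit_ball_volume TYPE('n)" and ?M = "unit_ball_measure :: (real^'n) measure"
  interpret finite_measure ?M by (rule finite_unit_ball_measure)
  have \<omega>: "?\<omega> > 0" by (rule unit_ball_volume_pos)
  have "bounded (range a)" "bounded (range s)"
    using a s by (auto dest: convergent_imp_bounded)
  then obtain A S where AS: "\<And>j. norm (a j) \<le> A" "\<And>j. \<bar>s j\<bar> \<le> S"
    by (auto simp: bounded_iff)
  have "compact (u ` cball 0 (A + S))"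
    by (intro compact_continuous_image continuous_on_subset[OF u]) auto
  then obtain B where B: "\<And>x. norm x \<le> A + S \<Longrightarrow> norm (u x) \<le> B"
    by (metis bounded_iff compact_imp_bounded imageI mem_cball_0)
  have "(\<lambda>j. \<integral>y. u (a j + s j *\<^sub>R y) \<partial>?M) \<longlonglongrightarrow> (\<integral>y. u x \<partial>?M)"
  proof (rule integral_dominated_convergence[where w = "\<lambda>_. B"])
    show "(\<lambda>y. u (a j + s j *\<^sub>R y)) \<in> borel_measurable ?M" for j
      by (intro measurable_unit_ball borel_measurable_continuous_onI continuous_on_compose2[OF u] continuous_intros) auto
    show "AE y in ?M. (\<lambda>j. u (a j + s j *\<^sub>R y)) \<longlonglongrightarrow> u x"
    proof (rule AE_I2)
      fix y
      have "(\<lambda>j. a j + s j *\<^sub>R y) \<longlonglongrightarrow> x + 0 *\<^sub>R y" by (intro tendsto_intros a s)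
      then show "(\<lambda>j. u (a j + s j *\<^sub>R y)) \<longlonglongrightarrow> u x"
        using u by (intro isCont_tendsto_compose[of _ u]) (auto simp: continuous_on_eq_continuous_at)
    qed
    show "AE y in ?M. norm (u (a j + s j *\<^sub>R y)) \<le> B" for j
    proof (rule AE_I2, rule B)
      fix y assume "y \<in> space ?M"
      then have "norm y \<le> 1" by (simp add: space_restrict_space)
      then have "\<bar>s j\<bar> * norm y \<le> S * 1" using AS(2)[of j] by (intro mult_mono) auto
      then show "norm (a j + s j *\<^sub>R y) \<le> A + S"
        using AS(1)[of j] norm_triangle_ineq[of "a j" "s j *\<^sub>R y"] by simp
    qed
  qed auto
  from tendsto_divide[OF this tendsto_const, of ?\<omega>]
  show ?thesis using \<omega> by (simp add: ball_mean_def measure_unit_ball)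
qed

lemma dist_triangle_4: "dist a d \<le> dist a b + dist b c + dist c d"
  using dist_triangle[of a d b] dist_triangle[of b d c] by linarith

section \<open>Local energies and the pointwise bound\<close>

definition local_energy ::
    "(real^'n) set \<Rightarrow> (real^'n \<Rightarrow> 'b::real_normed_vector) \<Rightarrow> real^'n \<Rightarrow> real \<Rightarrow> ennreal" where
  "local_energy \<Omega> f x R = (\<integral>\<^sup>+y. ennreal ((norm (f y))\<^sup>2) * indicator (ball x R) y \<partial>lebesgue_on \<Omega>)"

lemma nn_integral_lebesgue_on_open:
  "open \<Omega> \<Longrightarrow> (\<integral>\<^sup>+y. f y \<partial>lebesgue_on \<Omega>) = (\<integral>\<^sup>+y. f y * indicator \<Omega> y \<partial>lborel)"
  by (simp add: nn_integral_restrict_space nn_integral_completion)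

lemma local_energy_lborel:
  assumes "open \<Omega>"
  shows "local_energy \<Omega> f x R =
    (\<integral>\<^sup>+y. ennreal ((norm (f y))\<^sup>2) * indicator (\<Omega> \<inter> ball x R) y \<partial>lborel)"
  unfolding local_energy_def nn_integral_lebesgue_on_open[OF assms]
  by (intro nn_integral_cong) (auto simp: indicator_def)

lemma local_energy_mono:
  "ball x R \<subseteq> ball y S \<Longrightarrow> local_energy \<Omega> f x R \<le> local_energy \<Omega> f y S"
  unfolding local_energy_def by (intro nn_integral_mono mult_left_mono) (auto simp: indicator_def)

lemma local_energy_le: "local_energy \<Omega> f x R \<le> (\<integral>\<^sup>+y. ennreal ((norm (f y))\<^sup>2) \<partial>lebesgue_on \<Omega>)"
  unfolding local_energy_def by (intro nn_integral_mono) (auto simp: indicator_def)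

lemma local_energy_finite:
  assumes op: "open \<Omega>" "bounded \<Omega>" and bd: "\<And>x. norm (f x) \<le> B"
  shows "local_energy \<Omega> f x R < \<infinity>"
proof -
  have "local_energy \<Omega> f x R \<le> (\<integral>\<^sup>+y. ennreal (B\<^sup>2) * indicator \<Omega> y \<partial>lborel)"
    unfolding local_energy_lborel[OF op(1)]
    by (intro nn_integral_mono mult_mono ennreal_leI power_mono bd) (auto simp: indicator_def)
  also have "\<dots> = ennreal (B\<^sup>2) * emeasure lborel \<Omega>"
    using op by (intro nn_integral_cmult_indicator) simp
  also have "\<dots> < \<infinity>"
    using emeasure_bounded_finite[OF op(2)] by (simp add: ennreal_mult_less_top)
  finally show ?thesis .
qed

text \<open>Telescoping along a sequence of corkscrew points converging to \<open>x\<close>, with Harnack chains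
  between consecutive ones.\<close>

lemma pointwise_chain_bound:
  fixes M :: nat
  assumes M: "M > 1"
  obtains K C :: real where "K \<ge> 1" "C > 0"
    "\<And>(\<Omega> :: (real^'n) set) u Bd z\<^sub>0 r. one_sided_NTA M \<Omega> \<Longrightarrow> bounded \<Omega> \<Longrightarrow> C_k (Suc 0) u \<Longrightarrow>
      (\<And>x. norm (grad u x) \<le> Bd) \<Longrightarrow> z\<^sub>0 \<in> frontier \<Omega> \<Longrightarrow> 0 < r \<Longrightarrow> r \<le> diameter \<Omega> \<Longrightarrow>
      \<exists>c. \<forall>x \<in> closure \<Omega> \<inter> ball z\<^sub>0 r. \<forall>S.
        (\<forall>J::nat. (\<Sum>j\<le>J. (r / 2 ^ j) * sqrt (enn2real (local_energy \<Omega> (grad u) x (K * (r / 2 ^ j)))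
          / (r / 2 ^ j) ^ CARD('n))) \<le> S) \<longrightarrow> \<bar>u x - c\<bar> \<le> C * S"
proof -
  \<comment> \<open>The summand \<open>M\<close> covers the corkscrew depth. The 6 comes from two
    consecutive corkscrew points, within 2\<rho> and \<rho> of \<open>x\<close>, being at most
    3\<rho> = 6 (\<rho> / 2) apart at the finer scale \<rho> / 2.\<close>
  define L where "L = real M + 6"
  have L: "L \<ge> 1" by (simp add: L_def)
  show thesis
  proof (rule harnack_chain_oscillation[OF M L, where 'n='n])
  fix \<theta> C :: real
  assume \<theta>0: "\<theta> > 0" and C: "C \<ge> 1" and \<theta>L: "\<theta> * L \<le> 1" and chain:
    "\<And>(\<Omega> :: (real^'n) set) x y \<rho> (F :: real^'n \<Rightarrow> real) A.
      one_sided_NTA M \<Omega> \<Longrightarrow> bounded \<Omega> \<Longrightarrow> x \<in> \<Omega> \<Longrightarrow> y \<in> \<Omega> \<Longrightarrow> \<rho> > 0 \<Longrightarrow> dist x y \<le> L * \<rho> \<Longrightarrow>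
      \<rho> / L \<le> bdist \<Omega> x \<Longrightarrow> \<rho> / L \<le> bdist \<Omega> y \<Longrightarrow> A \<ge> 0 \<Longrightarrow>
      (\<And>p q. closed_segment p q \<subseteq> {w \<in> \<Omega>. \<theta> * \<rho> \<le> bdist \<Omega> w \<and> dist x w \<le> C * \<rho>} \<Longrightarrow>
        \<bar>F p - F q\<bar> \<le> A * dist p q) \<Longrightarrow> \<bar>F x - F y\<bar> \<le> A * (C * \<rho>)"
  note \<theta> = \<theta>0 \<theta>L
  have \<theta>M: "\<theta> \<le> 1 / real M" "\<theta> \<le> 1"
  proof -
    have "\<theta> * real M \<le> \<theta> * L" "\<theta> * 1 \<le> \<theta> * L" using \<theta> L by (auto simp: L_def)
    then have "\<theta> * real M \<le> 1" "\<theta> \<le> 1" using \<theta>(2) by auto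
    then show "\<theta> \<le> 1 / real M" "\<theta> \<le> 1" using M by (auto simp: field_simps)
  qed
  \<comment> \<open>Measured from \<open>x\<close> in units of the scale: 2 to reach the corkscrew
    point, \<open>C\<close> for the chain, and 1 for the radius of the moving ball, as \<theta>
    \<le> 1.\<close>
  define K where "K = C + 3"
  let ?\<omega> = "unit_ball_volume TYPE('n)"
  have \<omega>: "?\<omega> > 0" by (rule unit_ball_volume_pos)
  \<comment> \<open>Collects the volume constants. It is taken with \<theta> / 2 because a step
    between scales works at half the scale; the full scale is then covered with a smaller
    constant.\<close>
  define \<kappa> where "\<kappa> = sqrt (1 / (?\<omega> * (\<theta> / 2) ^ CARD('n)))"
  have \<kappa>: "\<kappa> > 0" using \<omega> \<theta> by (simp add: \<kappa>_def)
  have \<kappa>_half: "sqrt (J / (?\<omega> * (\<theta> * (\<rho> / 2)) ^ CARD('n))) = \<kappa> * sqrt (J / \<rho> ^ CARD('n))" for J \<rho>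
    unfolding \<kappa>_def by (simp add: real_sqrt_mult[symmetric] power_divide power_mult_distrib ac_simps)
  have \<kappa>_full: "sqrt (J / (?\<omega> * (\<theta> * \<rho>) ^ CARD('n))) \<le> \<kappa> * sqrt (J / \<rho> ^ CARD('n))" if "\<rho> > 0" "J \<ge> 0" for J \<rho>
    unfolding \<kappa>_half[symmetric] using that \<omega> \<theta>
    by (intro real_sqrt_le_mono divide_left_mono mult_left_mono power_mono mult_pos_pos) auto
  show thesis
  proof (rule that)
    show "K \<ge> 1" using C by (simp add: K_def)
    show "3 * (C * \<kappa>) > 0" using C \<kappa> by simp
    fix \<Omega> :: "(real^'n) set" and u :: "real^'n \<Rightarrow> real" and Bd z\<^sub>0 r
    assume NTA: "one_sided_NTA M \<Omega>" and bnd: "bounded \<Omega>" and u: "C_k (Suc 0) u"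
      and Bd: "\<And>x. norm (grad u x) \<le> Bd" and z0: "z\<^sub>0 \<in> frontier \<Omega>" and r: "0 < r" "r \<le> diameter \<Omega>"
    have op: "open \<Omega>" using NTA by (simp add: one_sided_NTA_def)
    define H where "H x R = enn2real (local_energy \<Omega> (grad u) x R)" for x R
    have H0: "H x R \<ge> 0" for x R by (simp add: H_def)
    have HU: "(\<integral>\<^sup>+y. ennreal ((norm (grad u y))\<^sup>2) * indicator (\<Omega> \<inter> ball x R) y \<partial>lborel) \<le> ennreal (H x R)" for x R
      using local_energy_finite[OF op bnd Bd, where x = x and R = R] unfolding H_def local_energy_lborel[OF op]
      by (simp add: ennreal_enn2real)
    have seg: "\<bar>ball_mean u p (\<theta> * \<rho>) - ball_mean u q (\<theta> * \<rho>)\<bar>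
        \<le> sqrt (H x R / (?\<omega> * (\<theta> * \<rho>) ^ CARD('n))) * dist p q"
      if \<rho>: "\<rho> > 0" and R: "dist x a + (C + 1) * \<rho> \<le> R"
        and pq: "closed_segment p q \<subseteq> {w \<in> \<Omega>. \<theta> * \<rho> \<le> bdist \<Omega> w \<and> dist a w \<le> C * \<rho>}" for p q \<rho> x a R
    proof -
      have "\<bar>ball_mean u p (\<theta> * \<rho>) - ball_mean u q (\<theta> * \<rho>)\<bar>
        \<le> (dist p q + \<bar>\<theta> * \<rho> - \<theta> * \<rho>\<bar>) * sqrt (H x R / (?\<omega> * (\<theta> * \<rho>) ^ CARD('n)))"
      proof (rule ball_mean_oscillation[OF u Bd _ _ _ _ HU H0])
        show "0 < \<theta> * \<rho>" using \<theta> \<rho> by simp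
        fix \<tau> :: real assume \<tau>: "0 \<le> \<tau>" "\<tau> \<le> 1"
        let ?w = "p + \<tau> *\<^sub>R (q - p)"
        have "?w = (1 - \<tau>) *\<^sub>R p + \<tau> *\<^sub>R q" by (simp add: algebra_simps)
        then have "?w \<in> closed_segment p q" using \<tau> unfolding in_segment by blast
        with pq have w: "?w \<in> \<Omega>" "\<theta> * \<rho> \<le> bdist \<Omega> ?w" "dist a ?w \<le> C * \<rho>" by auto
        have "ball ?w (\<theta> * \<rho>) \<subseteq> \<Omega>"
          using ball_bdist_subset[OF w(1)] w(2) subset_ball by blast
        moreover have "ball ?w (\<theta> * \<rho>) \<subseteq> ball x R"
        proof
          fix y assume "y \<in> ball ?w (\<theta> * \<rho>)"
          moreover have "\<theta> * \<rho> \<le> 1 * \<rho>" using \<theta>M \<rho> by (intro mult_right_mono) auto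
          ultimately have "dist ?w y < \<rho>" by simp
          moreover have "dist x y \<le> dist x a + dist a ?w + dist ?w y"
            by (rule dist_triangle_4)
          ultimately have "dist x y < dist x a + C * \<rho> + \<rho>" using w(3) by linarith
          then show "y \<in> ball x R" using R by (simp add: algebra_simps)
        qed
        ultimately show "ball ?w (\<theta> * \<rho> + \<tau> * (\<theta> * \<rho> - \<theta> * \<rho>)) \<subseteq> \<Omega> \<inter> ball x R" by simp
      qed auto
      then show ?thesis by (simp add: mult.commute)
    qed
    have move: "\<bar>ball_mean u a (\<theta> * \<rho>) - ball_mean u b (\<theta> * \<rho>)\<bar>
        \<le> sqrt (H x R / (?\<omega> * (\<theta> * \<rho>) ^ CARD('n))) * (C * \<rho>)"
      if \<rho>: "\<rho> > 0" and R: "dist x a + (C + 1) * \<rho> \<le> R" and ab: "a \<in> \<Omega>" "b \<in> \<Omega>" "dist a b \<le> 6 * \<rho>"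
        "\<rho> / real M \<le> bdist \<Omega> a" "\<rho> / real M \<le> bdist \<Omega> b" for a b \<rho> x R
    proof (rule chain[OF NTA bnd ab(1,2) \<rho>, where F = "\<lambda>p. ball_mean u p (\<theta> * \<rho>)"])
      have "6 * \<rho> \<le> L * \<rho>" using \<rho> by (intro mult_right_mono) (auto simp: L_def)
      then show "dist a b \<le> L * \<rho>" using ab by linarith
      have "\<rho> / L \<le> \<rho> / real M" using \<rho> M by (intro divide_left_mono) (auto simp: L_def)
      then show "\<rho> / L \<le> bdist \<Omega> a" "\<rho> / L \<le> bdist \<Omega> b" using ab by linarith+
      show "0 \<le> sqrt (H x R / (?\<omega> * (\<theta> * \<rho>) ^ CARD('n)))" using \<rho> \<theta> \<omega> H0 by simp
      show "\<bar>ball_mean u p (\<theta> * \<rho>) - ball_mean u q (\<theta> * \<rho>)\<bar>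
          \<le> sqrt (H x R / (?\<omega> * (\<theta> * \<rho>) ^ CARD('n))) * dist p q"
        if "closed_segment p q \<subseteq> {w \<in> \<Omega>. \<theta> * \<rho> \<le> bdist \<Omega> w \<and> dist a w \<le> C * \<rho>}" for p q
        by (rule seg[OF \<rho> R that])
    qed
    have scale: "\<bar>ball_mean u a (\<theta> * \<rho>) - ball_mean u a (\<theta> * (\<rho> / 2))\<bar>
        \<le> (\<theta> * (\<rho> / 2)) * sqrt (H x R / (?\<omega> * (\<theta> * (\<rho> / 2)) ^ CARD('n)))"
      if \<rho>: "\<rho> > 0" and R: "dist x a + \<rho> \<le> R" and a: "a \<in> \<Omega>" "\<rho> / real M \<le> bdist \<Omega> a" for a \<rho> x R
    proof -
      have half: "\<theta> * (\<rho> / 2) \<le> \<theta> * \<rho>" using \<theta> \<rho> by simp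
      have "\<bar>ball_mean u a (\<theta> * \<rho>) - ball_mean u a (\<theta> * (\<rho> / 2))\<bar>
        \<le> (dist a a + \<bar>\<theta> * \<rho> - \<theta> * (\<rho> / 2)\<bar>) * sqrt (H x R / (?\<omega> * (\<theta> * (\<rho> / 2)) ^ CARD('n)))"
      proof (rule ball_mean_oscillation[OF u Bd _ _ _ _ HU H0])
        show "0 < \<theta> * (\<rho> / 2)" "\<theta> * (\<rho> / 2) \<le> \<theta> * \<rho>" using \<theta> \<rho> by simp_all
        fix \<tau> :: real assume \<tau>: "0 \<le> \<tau>" "\<tau> \<le> 1"
        have "\<theta> * \<rho> \<le> 1 / real M * \<rho>" using \<theta>M \<rho> by (intro mult_right_mono) auto
        then have "ball a (\<theta> * \<rho>) \<subseteq> \<Omega>"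
          using ball_bdist_subset[OF a(1)] a(2) subset_ball[of "\<theta> * \<rho>" "bdist \<Omega> a" a] by auto
        moreover have "ball a (\<theta> * \<rho>) \<subseteq> ball x R"
        proof
          fix y assume "y \<in> ball a (\<theta> * \<rho>)"
          moreover have "\<theta> * \<rho> \<le> 1 * \<rho>" using \<theta>M \<rho> by (intro mult_right_mono) auto
          ultimately have "dist a y < \<rho>" by simp
          then show "y \<in> ball x R" using R dist_triangle[of x y a] by simp
        qed
        moreover have "ball (a + \<tau> *\<^sub>R (a - a)) (\<theta> * \<rho> + \<tau> * (\<theta> * (\<rho> / 2) - \<theta> * \<rho>)) \<subseteq> ball a (\<theta> * \<rho>)"
          using mult_nonneg_nonpos[of \<tau> "\<theta> * (\<rho> / 2) - \<theta> * \<rho>"] \<tau> half by (auto intro!: subset_ball)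
        ultimately show "ball (a + \<tau> *\<^sub>R (a - a)) (\<theta> * \<rho> + \<tau> * (\<theta> * (\<rho> / 2) - \<theta> * \<rho>)) \<subseteq> \<Omega> \<inter> ball x R"
          by blast
      qed auto
      moreover have "\<bar>\<theta> * \<rho> - \<theta> * (\<rho> / 2)\<bar> = \<theta> * (\<rho> / 2)" using \<theta> \<rho> by simp
      ultimately show ?thesis by simp
    qed
    have z0c: "z\<^sub>0 \<in> closure \<Omega>" using z0 by (simp add: frontier_def)
    obtain a0 where a0: "a0 \<in> \<Omega>" "dist a0 z\<^sub>0 \<le> 2 * r" "r / real M \<le> bdist \<Omega> a0"
      using corkscrew_closure[OF NTA bnd z0c r] .
    \<comment> \<open>The reference constant belongs to \<open>z\<^sub>0\<close> and not to
      \<open>x\<close>; one further chain at the coarsest scale connects it to the corkscrew point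
      of each \<open>x\<close>.\<close>
    define c where "c = ball_mean u a0 (\<theta> * r)"
    show "\<exists>c. \<forall>x \<in> closure \<Omega> \<inter> ball z\<^sub>0 r. \<forall>S.
        (\<forall>J::nat. (\<Sum>j\<le>J. (r / 2 ^ j) * sqrt (enn2real (local_energy \<Omega> (grad u) x (K * (r / 2 ^ j)))
          / (r / 2 ^ j) ^ CARD('n))) \<le> S) \<longrightarrow> \<bar>u x - c\<bar> \<le> 3 * (C * \<kappa>) * S"
    proof (intro exI ballI allI impI)
      fix x S assume x: "x \<in> closure \<Omega> \<inter> ball z\<^sub>0 r"
      define \<rho> where "\<rho> j = r / 2 ^ j" for j :: nat
      define T where "T j = \<rho> j * sqrt (H x (K * \<rho> j) / \<rho> j ^ CARD('n))" for j
      assume "\<forall>J. (\<Sum>j\<le>J. (r / 2 ^ j) * sqrt (enn2real (local_energy \<Omega> (grad u) x (K * (r / 2 ^ j)))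
          / (r / 2 ^ j) ^ CARD('n))) \<le> S"
      then have S: "(\<Sum>j\<le>J. T j) \<le> S" for J by (simp add: T_def H_def \<rho>_def)
      have \<rho>: "\<rho> j > 0" for j using r by (simp add: \<rho>_def)
      have \<rho>r: "\<rho> j \<le> r" for j
        using r divide_left_mono[of 1 "2 ^ j" r] by (simp add: \<rho>_def)
      have T0: "T j \<ge> 0" for j using \<rho>[of j] H0 by (simp add: T_def)
      have "\<forall>j. \<exists>a. a \<in> \<Omega> \<and> dist a x \<le> 2 * \<rho> j \<and> \<rho> j / real M \<le> bdist \<Omega> a"
      proof
        fix j show "\<exists>a. a \<in> \<Omega> \<and> dist a x \<le> 2 * \<rho> j \<and> \<rho> j / real M \<le> bdist \<Omega> a"
          by (rule corkscrew_closure[OF NTA bnd _ \<rho>, of x j]) (use x \<rho>r[of j] r in auto)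
      qed
      then obtain a where a: "\<And>j. a j \<in> \<Omega>" "\<And>j. dist (a j) x \<le> 2 * \<rho> j" "\<And>j. \<rho> j / real M \<le> bdist \<Omega> (a j)"
        by metis
      have base: "\<bar>ball_mean u (a 0) (\<theta> * \<rho> 0) - c\<bar> \<le> C * \<kappa> * T 0"
      proof -
        have \<rho>0: "\<rho> 0 = r" by (simp add: \<rho>_def)
        have "dist (a 0) a0 \<le> dist (a 0) x + dist x z\<^sub>0 + dist z\<^sub>0 a0"
          by (rule dist_triangle_4)
        then have d: "dist (a 0) a0 \<le> 6 * r" using a(2)[of 0] x a0 \<rho>0 r by (simp add: dist_commute)
        have R: "dist x (a 0) + (C + 1) * r \<le> K * r"
          using a(2)[of 0] \<rho>0 by (simp add: dist_commute K_def algebra_simps)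
        have "\<bar>ball_mean u (a 0) (\<theta> * r) - c\<bar> \<le> sqrt (H x (K * r) / (?\<omega> * (\<theta> * r) ^ CARD('n))) * (C * r)"
          unfolding c_def
          by (rule move[OF r(1) R a(1) a0(1) d _ a0(3)]) (use a(3)[of 0] \<rho>0 in simp)
        also have "\<dots> \<le> (\<kappa> * sqrt (H x (K * r) / r ^ CARD('n))) * (C * r)"
          using r C H0 by (intro mult_right_mono \<kappa>_full) auto
        also have "\<dots> = C * \<kappa> * T 0" by (simp add: T_def \<rho>0)
        finally show ?thesis by (simp add: \<rho>0)
      qed
      \<comment> \<open>Two moves: the radius is halved at the same centre, then a chain at the
        smaller scale leads to the next centre. Both stay inside the ball of radius
        \<open>K * \<rho> j\<close> around \<open>x\<close>.\<close>
      have step: "\<bar>ball_mean u (a j) (\<theta> * \<rho> j) - ball_mean u (a (Suc j)) (\<theta> * \<rho> (Suc j))\<bar> \<le> C * \<kappa> * T j" for j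
      proof -
        have \<rho>S: "\<rho> (Suc j) = \<rho> j / 2" by (simp add: \<rho>_def)
        let ?R = "K * \<rho> j" and ?q = "sqrt (H x (K * \<rho> j) / \<rho> j ^ CARD('n))"
        have q0: "?q \<ge> 0" using H0 \<rho>[of j] by simp
        have d: "dist x (a j) \<le> 2 * \<rho> j" using a(2)[of j] by (simp add: dist_commute)
        have Cp: "C * \<rho> j \<ge> 0" using C \<rho>[of j] by simp
        have aM: "\<rho> j / 2 / real M \<le> bdist \<Omega> (a j)"
          using a(3)[of j] \<rho>[of j] divide_right_mono[of "\<rho> j / 2" "\<rho> j" "real M"] by simp
        have "\<bar>ball_mean u (a j) (\<theta> * \<rho> j) - ball_mean u (a j) (\<theta> * (\<rho> j / 2))\<bar> \<le> (\<theta> * (\<rho> j / 2)) * (\<kappa> * ?q)"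
          unfolding \<kappa>_half[symmetric] by (rule scale[OF \<rho> _ a(1) a(3)]) (use d Cp in \<open>simp add: K_def algebra_simps\<close>)
        also have "\<dots> \<le> (C * (\<rho> j / 2)) * (\<kappa> * ?q)"
          using \<theta>M C \<rho>[of j] \<kappa> q0 by (intro mult_right_mono mult_nonneg_nonneg) auto
        finally have 1: "\<bar>ball_mean u (a j) (\<theta> * \<rho> j) - ball_mean u (a j) (\<theta> * (\<rho> j / 2))\<bar> \<le> C * \<kappa> * T j / 2"
          by (simp add: T_def algebra_simps)
        have "\<bar>ball_mean u (a j) (\<theta> * (\<rho> j / 2)) - ball_mean u (a (Suc j)) (\<theta> * (\<rho> j / 2))\<bar> \<le> (\<kappa> * ?q) * (C * (\<rho> j / 2))"
          unfolding \<kappa>_half[symmetric]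
        proof (rule move[OF _ _ a(1) a(1)])
          show "0 < \<rho> j / 2" using \<rho> by simp
          have "(C + 1) * (\<rho> j / 2) = C * \<rho> j / 2 + \<rho> j / 2" "K * \<rho> j = C * \<rho> j + 3 * \<rho> j"
            by (simp_all add: K_def field_simps)
          then show "dist x (a j) + (C + 1) * (\<rho> j / 2) \<le> K * \<rho> j" using d \<rho>[of j] Cp by linarith
          have "dist (a j) (a (Suc j)) \<le> dist (a j) x + dist (a (Suc j)) x" by (rule dist_triangle2)
          then show "dist (a j) (a (Suc j)) \<le> 6 * (\<rho> j / 2)" using a(2)[of j] a(2)[of "Suc j"] \<rho>S by simp
          show "\<rho> j / 2 / real M \<le> bdist \<Omega> (a j)" by (rule aM)
          show "\<rho> j / 2 / real M \<le> bdist \<Omega> (a (Suc j))" using a(3)[of "Suc j"] \<rho>S by simp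
        qed
        then have 2: "\<bar>ball_mean u (a j) (\<theta> * (\<rho> j / 2)) - ball_mean u (a (Suc j)) (\<theta> * (\<rho> j / 2))\<bar> \<le> C * \<kappa> * T j / 2"
          by (simp add: T_def algebra_simps)
        from 1 2 show ?thesis unfolding \<rho>S by linarith
      qed
      have tele: "\<bar>ball_mean u (a J) (\<theta> * \<rho> J) - c\<bar> \<le> C * \<kappa> * T 0 + (\<Sum>j<J. C * \<kappa> * T j)" for J
      proof (induction J)
        case (Suc J)
        then show ?case using step[of J] by simp
      qed (use base in simp)
      have C\<kappa>: "C * \<kappa> \<ge> 0" using C \<kappa> by simp
      have bound: "\<bar>ball_mean u (a J) (\<theta> * \<rho> J) - c\<bar> \<le> 3 * (C * \<kappa>) * S" for J
      proof -
        have "(\<Sum>j<J. C * \<kappa> * T j) \<le> (\<Sum>j\<le>J. C * \<kappa> * T j)"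
          using T0 C\<kappa> by (intro sum_mono2) auto
        also have "\<dots> = C * \<kappa> * (\<Sum>j\<le>J. T j)" by (simp add: sum_distrib_left)
        also have "\<dots> \<le> C * \<kappa> * S" using S C\<kappa> by (intro mult_left_mono)
        finally have "(\<Sum>j<J. C * \<kappa> * T j) \<le> C * \<kappa> * S" .
        moreover have "C * \<kappa> * T 0 \<le> C * \<kappa> * S" using S[of 0] C\<kappa> by (intro mult_left_mono) auto
        moreover have "0 \<le> C * \<kappa> * S" using S[of 0] T0[of 0] C\<kappa> by simp
        ultimately show ?thesis using tele[of J] by linarith
      qed
      have \<rho>0: "\<rho> \<longlonglongrightarrow> 0"
        unfolding \<rho>_def using LIMSEQ_divide_realpow_zero[of 2 r] by simp
      have "(\<lambda>j. dist (a j) x) \<longlonglongrightarrow> 0"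
      proof (rule tendsto_sandwich[OF _ _ tendsto_const])
        show "(\<lambda>j. 2 * \<rho> j) \<longlonglongrightarrow> 0" using tendsto_mult[OF tendsto_const \<rho>0, of 2] by simp
      qed (use a in auto)
      then have alim: "a \<longlonglongrightarrow> x" by (subst tendsto_dist_iff)
      have slim: "(\<lambda>j. \<theta> * \<rho> j) \<longlonglongrightarrow> 0" using tendsto_mult[OF tendsto_const \<rho>0, of \<theta>] by simp
      have "(\<lambda>j. \<bar>ball_mean u (a j) (\<theta> * \<rho> j) - c\<bar>) \<longlonglongrightarrow> \<bar>u x - c\<bar>"
        by (intro tendsto_rabs tendsto_diff tendsto_const ball_mean_tendsto C1_continuous(1)[OF u] alim slim)
      then show "\<bar>u x - c\<bar> \<le> 3 * (C * \<kappa>) * S"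
        by (rule LIMSEQ_le_const2) (use bound in blast)
    qed
  qed
  qed
qed

text \<open>The weighted bound on the p-th powers makes each \<open>T j\<close> at most
  \<open>W powr (1 / p)\<close> times 2^(-j \<epsilon>), and the geometric series does the rest. A
  sum of scales is thereby controlled by a supremum.\<close>

lemma sum_geometric_decay_le:
  fixes T :: "nat \<Rightarrow> real"
  assumes p: "p > 0" and \<epsilon>: "\<epsilon> > 0" and T: "\<And>j. T j \<ge> 0" and W: "W \<ge> 0"
    and le: "\<And>j. 2 powr (real j * \<epsilon> * p) * T j powr p \<le> W"
  shows "(\<Sum>j\<le>J. T j) \<le> W powr (1 / p) / (1 - 2 powr (- \<epsilon>))"
proof -
  define q where "q = (2::real) powr (- \<epsilon>)"
  have q: "0 < q" "q < 1" using \<epsilon> by (simp_all add: q_def powr_less_one)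
  have qj: "q ^ j = 2 powr (- (real j * \<epsilon>))" for j
    by (simp add: q_def powr_realpow[symmetric] powr_powr mult.commute)
  have "T j \<le> W powr (1 / p) * q ^ j" for j
  proof -
    have "(2 powr (real j * \<epsilon>) * T j) powr p \<le> W"
      using le[of j] T by (simp add: powr_mult powr_powr)
    then have "((2 powr (real j * \<epsilon>) * T j) powr p) powr (1 / p) \<le> W powr (1 / p)"
      using p by (intro powr_mono2) auto
    then have "2 powr (real j * \<epsilon>) * T j \<le> W powr (1 / p)"
      using p T by (simp add: powr_powr)
    then show ?thesis by (simp add: qj powr_minus field_simps)
  qed
  then have "(\<Sum>j\<le>J. T j) \<le> (\<Sum>j\<le>J. W powr (1 / p) * q ^ j)" by (rule sum_mono)
  also have "\<dots> = W powr (1 / p) * (\<Sum>j\<le>J. q ^ j)" by (simp add: sum_distrib_left)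
  also have "\<dots> \<le> W powr (1 / p) * (1 / (1 - q))"
  proof (rule mult_left_mono)
    have "(\<Sum>j\<le>J. q ^ j) \<le> (\<Sum>j. q ^ j)"
      using q by (intro sum_le_suminf) (auto simp: summable_geometric)
    then show "(\<Sum>j\<le>J. q ^ j) \<le> 1 / (1 - q)" using q by (simp add: suminf_geometric)
  qed simp
  finally show ?thesis by (simp add: q_def)
qed

text \<open>All but two of the \<open>p\<close> powers are spent on the total energy bound, leaving
  \<open>H\<close> to the first power so that it can be integrated by Tonelli. This is where p \<ge>
  2 is essential.\<close>

lemma powr_sqrt_split:
  assumes "H \<ge> 0" "G \<ge> 0" "H \<le> G\<^sup>2" "p \<ge> 2"
  shows "sqrt H powr p \<le> G powr (p - 2) * H"
proof (cases "H = 0")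
  case False
  with assms have H: "H > 0" by simp
  have "sqrt H powr p = sqrt H powr (p - 2) * sqrt H powr 2"
    by (simp add: powr_add[symmetric])
  also have "sqrt H powr 2 = H" using H by (simp add: powr_numeral)
  also have "sqrt H powr (p - 2) \<le> G powr (p - 2)"
    using assms by (intro powr_mono2) (auto intro: real_le_lsqrt)
  finally show ?thesis using H by simp
qed simp

text \<open>Because \<open>p\<close> is strictly below the critical exponent, a factor \<open>2\<^sup>-\<^sup>j\<^sup>\<epsilon>\<close> can be spared in
  every scale; this replaces the sum of the scales by their supremum, hence \<open>p\<close>-th powers can be
  integrated scale by scale.\<close>

lemma integrate_chain_bound:
  fixes K C p d :: real
  assumes K: "K \<ge> 1" and C: "C > 0" and p: "p \<ge> 2" and d: "d > 0"
    and crit: "p * (real CARD('n) - 2) / 2 < d"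
  obtains C' where "C' > 0"
    "\<And>(\<Omega> :: (real^'n) set) (g :: real^'n \<Rightarrow> real^'n) u A \<mu> \<Lambda> z\<^sub>0 r c G.
      open \<Omega> \<Longrightarrow> bounded \<Omega> \<Longrightarrow> g \<in> borel_measurable (lebesgue_on \<Omega>) \<Longrightarrow> A \<subseteq> ball z\<^sub>0 r \<Longrightarrow>
      (AE x in \<mu>. x \<in> A) \<Longrightarrow> sets \<mu> = sets borel \<Longrightarrow> finite_measure \<mu> \<Longrightarrow> \<Lambda> \<ge> 0 \<Longrightarrow>
      (\<And>y \<rho>. \<rho> > 0 \<Longrightarrow> emeasure \<mu> (ball y \<rho>) \<le> ennreal (\<Lambda> * \<rho> powr d)) \<Longrightarrow> r > 0 \<Longrightarrow> G \<ge> 0 \<Longrightarrow>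
      local_energy \<Omega> g z\<^sub>0 ((K + 1) * r) \<le> ennreal (G\<^sup>2) \<Longrightarrow>
      (\<And>x S. x \<in> A \<Longrightarrow> (\<And>J::nat. (\<Sum>j\<le>J. (r / 2 ^ j) * sqrt (enn2real (local_energy \<Omega> g x (K * (r / 2 ^ j)))
          / (r / 2 ^ j) ^ CARD('n))) \<le> S) \<Longrightarrow> \<bar>u x - c\<bar> \<le> C * S) \<Longrightarrow>
      (\<integral>\<^sup>+x. ennreal (\<bar>u x - c\<bar> powr p) \<partial>\<mu>)
        \<le> ennreal (C' * \<Lambda> * (G * r powr (1 - real CARD('n) / 2)) powr p * r powr d)"
proof -
  let ?n = "real CARD('n)"
  define \<gamma> where "\<gamma> = 1 - ?n / 2"
  \<comment> \<open>The distance from the critical exponent: after integration, scale \<rho>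
    contributes \<rho> to the power p\<beta>, and \<beta> is positive exactly by
    \<open>crit\<close>.\<close>
  define \<beta> where "\<beta> = \<gamma> + d / p"
  have \<beta>: "\<beta> > 0" using crit p by (simp add: \<beta>_def \<gamma>_def field_simps)
  have p\<beta>: "p * \<beta> = p * \<gamma> + d" using p by (simp add: \<beta>_def field_simps)
  \<comment> \<open>Half of the margin \<beta> is spent on the weights that make the sum of the
    scales geometric; the other half makes the integrated series converge.\<close>
  define \<epsilon> where "\<epsilon> = \<beta> / 2"
  have \<epsilon>: "\<epsilon> > 0" using \<beta> by (simp add: \<epsilon>_def)
  define q where "q = (2::real) powr (- (p * \<epsilon>))"
  have q: "0 < q" "q < 1" using p \<epsilon> by (simp_all add: q_def powr_less_one)
  define D where "D = (C / (1 - 2 powr (- \<epsilon>))) powr p"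
  have q1: "2 powr (- \<epsilon>) < (1::real)" using \<epsilon> by (simp add: powr_less_one)
  have D: "D > 0" using C q1 \<epsilon> by (simp add: D_def)
  define C' where "C' = D * K powr d / (1 - q)"
  show thesis
  proof (rule that)
    show "C' > 0" using D K q by (simp add: C'_def)
    fix \<Omega> :: "(real^'n) set" and g :: "real^'n \<Rightarrow> real^'n" and u :: "real^'n \<Rightarrow> real" and A \<mu> \<Lambda> z\<^sub>0 r c G
    assume op: "open \<Omega>" "bounded \<Omega>" and g[measurable]: "g \<in> borel_measurable (lebesgue_on \<Omega>)"
      and A: "A \<subseteq> ball z\<^sub>0 r" "AE x in \<mu>. x \<in> A"
      and \<mu>: "sets \<mu> = sets borel" "finite_measure \<mu>" and \<Lambda>: "\<Lambda> \<ge> 0"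
      and \<mu>\<Lambda>: "\<And>y \<rho>. \<rho> > 0 \<Longrightarrow> emeasure \<mu> (ball y \<rho>) \<le> ennreal (\<Lambda> * \<rho> powr d)"
      and r: "r > 0" and G: "G \<ge> 0" "local_energy \<Omega> g z\<^sub>0 ((K + 1) * r) \<le> ennreal (G\<^sup>2)"
      and pw: "\<And>x S. x \<in> A \<Longrightarrow> (\<And>J::nat. (\<Sum>j\<le>J. (r / 2 ^ j) *
          sqrt (enn2real (local_energy \<Omega> g x (K * (r / 2 ^ j))) / (r / 2 ^ j) ^ CARD('n))) \<le> S)
          \<Longrightarrow> \<bar>u x - c\<bar> \<le> C * S"
    define N where "N = lebesgue_on \<Omega>"
    have N: "finite_measure N" "\<And>A. A \<in> sets borel \<Longrightarrow> A \<inter> space N \<in> sets N"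
      using op by (auto simp: N_def sets_restrict_space image_iff space_restrict_space
          intro!: finite_measure_lebesgue_on bounded_set_imp_lmeasurable)
    have sN: "sigma_finite_measure N" "sigma_finite_measure \<mu>"
      using N \<mu> by (auto simp: finite_measure_def)
    \<comment> \<open>The energy density is cut off to the large ball, so that \<open>h j\<close> is
      at most \<open>G\<^sup>2\<close> at every point. For \<open>x\<close> in \<open>A\<close> the
      cut-off changes nothing, because the ball of radius \<open>K * \<rho> j\<close> around
      \<open>x\<close> lies inside the large one.\<close>
    define f where "f y = ennreal ((norm (g y))\<^sup>2) * indicator (ball z\<^sub>0 ((K + 1) * r)) y" for y
    have "(\<lambda>y. indicator (ball z\<^sub>0 ((K + 1) * r)) y :: ennreal) \<in> borel_measurable N"
      by (rule borel_measurable_indicator') (use N(2)[of "ball z\<^sub>0 ((K + 1) * r)"] in \<open>simp add: vimage_def Int_def conj_commute\<close>)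
    then have f: "f \<in> borel_measurable N"
      using g unfolding f_def N_def by measurable
    have fG: "(\<integral>\<^sup>+y. f y \<partial>N) \<le> ennreal (G\<^sup>2)"
      using G(2) by (simp add: f_def local_energy_def N_def)
    define \<rho> where "\<rho> j = r / 2 ^ j" for j :: nat
    have \<rho>: "\<rho> j > 0" "\<rho> j \<le> r" for j
      using r divide_left_mono[of 1 "2 ^ j" r] by (simp_all add: \<rho>_def)
    define h where "h j x = (\<integral>\<^sup>+y. f y * indicator (ball x (K * \<rho> j)) y \<partial>N)" for j x
    have h_meas[measurable]: "h j \<in> borel_measurable \<mu>" for j
      unfolding h_def by (rule borel_measurable_nn_integral_ball[OF \<mu>(1) sN(1) N(2) f])
    have h_eq: "h j x = local_energy \<Omega> g x (K * \<rho> j)" if "x \<in> A" for j x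
    proof -
      have x: "dist z\<^sub>0 x < r" using that A by auto
      have "ball x (K * \<rho> j) \<subseteq> ball z\<^sub>0 ((K + 1) * r)"
      proof
        fix y assume "y \<in> ball x (K * \<rho> j)"
        moreover have "K * \<rho> j \<le> K * r" using \<rho> K by (intro mult_left_mono) auto
        ultimately show "y \<in> ball z\<^sub>0 ((K + 1) * r)"
          using x dist_triangle[of z\<^sub>0 y x] by (simp add: algebra_simps)
      qed
      then show ?thesis
        unfolding h_def local_energy_def N_def f_def by (intro nn_integral_cong) (auto simp: indicator_def)
    qed
    have h_le: "h j x \<le> ennreal (G\<^sup>2)" for j x
    proof -
      have "h j x \<le> (\<integral>\<^sup>+y. f y \<partial>N)" unfolding h_def by (intro nn_integral_mono) (auto simp: indicator_def)
      with fG show ?thesis by simp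
    qed
    then have h_fin: "h j x < \<infinity>" for j x using le_less_trans ennreal_less_top infinity_ennreal_def by metis
    define H where "H j x = enn2real (h j x)" for j x
    have H: "H j x \<ge> 0" "ennreal (H j x) = h j x" "H j x \<le> G\<^sup>2" for j x
      using h_fin[of j x] h_le[of j x] by (auto simp: H_def ennreal_enn2real enn2real_leI)
    define w where "w j = 2 powr (real j * \<epsilon> * p) * \<rho> j powr (\<gamma> * p) * G powr (p - 2)" for j
    have w0: "w j \<ge> 0" for j by (simp add: w_def)
    \<comment> \<open>The sum over \<open>j\<close> dominates the supremum required pointwise and,
      unlike it, commutes with the integral. Where \<open>W\<close> is infinite, the pointwise bound
      is trivial.\<close>
    define W where "W x = (\<Sum>j. ennreal (w j) * h j x)" for x
    have W_meas[measurable]: "W \<in> borel_measurable \<mu>" unfolding W_def by measurable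
    have main: "ennreal (\<bar>u x - c\<bar> powr p) \<le> ennreal D * W x" if x: "x \<in> A" for x
    proof (cases "W x = \<infinity>")
      case True
      then show ?thesis using D by (simp add: ennreal_mult_top)
    next
      case False
      define Wr where "Wr = enn2real (W x)"
      have Wr: "Wr \<ge> 0" "ennreal Wr = W x"
        using False by (auto simp: Wr_def ennreal_enn2real less_top)
      define T where "T j = \<rho> j * sqrt (H j x / \<rho> j ^ CARD('n))" for j
      have T0: "T j \<ge> 0" for j using H(1) \<rho>(1)[of j] by (simp add: T_def)
      have T_eq: "T j = \<rho> j powr \<gamma> * sqrt (H j x)" for j
      proof -
        have "sqrt (\<rho> j ^ CARD('n)) = \<rho> j powr (?n / 2)"
          using \<rho>(1)[of j] by (simp add: powr_half_sqrt[symmetric] powr_realpow[symmetric] powr_powr)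
        moreover have "\<rho> j / \<rho> j powr (?n / 2) = \<rho> j powr \<gamma>"
          using \<rho>(1)[of j] by (simp add: \<gamma>_def powr_diff)
        ultimately show ?thesis
          by (simp add: T_def real_sqrt_divide) (metis times_divide_eq_left mult.commute)
      qed
      have "2 powr (real j * \<epsilon> * p) * T j powr p \<le> Wr" for j
      proof -
        have "T j powr p = \<rho> j powr (\<gamma> * p) * sqrt (H j x) powr p"
          using H(1) by (simp add: T_eq powr_mult powr_powr)
        also have "\<dots> \<le> \<rho> j powr (\<gamma> * p) * (G powr (p - 2) * H j x)"
          using H G p by (intro mult_left_mono powr_sqrt_split) auto
        finally have "2 powr (real j * \<epsilon> * p) * T j powr p \<le> w j * H j x"
          by (simp add: w_def mult.assoc)
        moreover have "ennreal (w j * H j x) \<le> W x"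
        proof -
          have "ennreal (w j * H j x) = (\<Sum>i\<in>{j}. ennreal (w i) * h i x)"
            using w0 H by (simp add: ennreal_mult)
          also have "\<dots> \<le> W x" unfolding W_def by (rule sum_le_suminf) auto
          finally show ?thesis .
        qed
        then have "w j * H j x \<le> Wr" using Wr by (metis ennreal_le_iff)
        ultimately show ?thesis by linarith
      qed
      then have "(\<Sum>j\<le>J. T j) \<le> Wr powr (1 / p) / (1 - 2 powr (- \<epsilon>))" for J
        using p \<epsilon> T0 Wr by (intro sum_geometric_decay_le) auto
      then have "\<bar>u x - c\<bar> \<le> C * (Wr powr (1 / p) / (1 - 2 powr (- \<epsilon>)))"
        by (intro pw[OF x]) (simp add: T_def H_def h_eq[OF x] \<rho>_def)
      also have "\<dots> = C / (1 - 2 powr (- \<epsilon>)) * Wr powr (1 / p)" by simp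
      finally have "\<bar>u x - c\<bar> powr p \<le> (C / (1 - 2 powr (- \<epsilon>)) * Wr powr (1 / p)) powr p"
        using p by (intro powr_mono2) auto
      also have "\<dots> = D * Wr"
        unfolding D_def using C q1 Wr p
        by (subst powr_mult) (auto simp: powr_powr powr_one)
      finally show ?thesis
        using D Wr by (simp add: ennreal_mult[symmetric] Wr(2)[symmetric] ennreal_leI)
    qed
    have "(\<integral>\<^sup>+x. ennreal (\<bar>u x - c\<bar> powr p) \<partial>\<mu>) \<le> (\<integral>\<^sup>+x. ennreal D * W x \<partial>\<mu>)"
      by (intro nn_integral_mono_AE) (use A(2) main in \<open>auto elim: eventually_mono\<close>)
    also have "\<dots> = ennreal D * (\<Sum>j. ennreal (w j) * (\<integral>\<^sup>+x. h j x \<partial>\<mu>))"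
      unfolding W_def by (simp add: nn_integral_cmult nn_integral_suminf)
    also have "\<dots> \<le> ennreal D * (\<Sum>j. ennreal (w j) * ennreal (\<Lambda> * (K * \<rho> j) powr d * G\<^sup>2))"
    proof (intro mult_left_mono suminf_le)
      fix j
      have "(\<integral>\<^sup>+x. h j x \<partial>\<mu>) \<le> ennreal (\<Lambda> * (K * \<rho> j) powr d) * (\<integral>\<^sup>+y. f y \<partial>N)"
        unfolding h_def using \<rho>(1)[of j] K by (intro nn_integral_ball_le sN \<mu> N f \<mu>\<Lambda>) auto
      also have "\<dots> \<le> ennreal (\<Lambda> * (K * \<rho> j) powr d) * ennreal (G\<^sup>2)"
        by (intro mult_left_mono fG) auto
      also have "\<dots> = ennreal (\<Lambda> * (K * \<rho> j) powr d * G\<^sup>2)"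
        using \<Lambda> by (simp add: ennreal_mult)
      finally show "(\<integral>\<^sup>+x. h j x \<partial>\<mu>) \<le> ennreal (\<Lambda> * (K * \<rho> j) powr d * G\<^sup>2)" .
    qed auto
    also have "(\<Sum>j. ennreal (w j) * ennreal (\<Lambda> * (K * \<rho> j) powr d * G\<^sup>2))
        = (\<Sum>j. ennreal (\<Lambda> * K powr d * (G powr p * r powr (p * \<beta>)) * q ^ j))"
    proof (intro suminf_cong)
      fix j
      have \<rho>p: "\<rho> j powr a = r powr a * 2 powr (- (real j * a))" for a
      proof -
        have "\<rho> j = r * 2 powr (- real j)"
          by (simp add: \<rho>_def powr_minus powr_realpow divide_inverse)
        then show ?thesis using r by (simp add: powr_mult powr_powr)
      qed
      have "\<rho> j powr (\<gamma> * p) * \<rho> j powr d = \<rho> j powr (p * \<beta>)"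
        unfolding p\<beta> by (simp only: powr_add[symmetric] mult.commute[of \<gamma> p])
      \<comment> \<open>The weight contributes the exponent j\<epsilon>p of 2 and the scales
        contribute -jp\<beta>; as \<beta> = 2\<epsilon>, the exponent -jp\<epsilon> remains, which
        is the j-th power of \<open>q\<close>.\<close>
      then have 1: "2 powr (real j * \<epsilon> * p) * (\<rho> j powr (\<gamma> * p) * \<rho> j powr d) = r powr (p * \<beta>) * q ^ j"
      proof -
        have "2 powr (real j * \<epsilon> * p) * 2 powr (- (real j * (p * \<beta>))) = (2::real) powr (- (p * \<epsilon>) * real j)"
          by (simp add: powr_add[symmetric] \<epsilon>_def field_simps)
        also have "\<dots> = q ^ j" using q(1) by (simp add: powr_realpow[symmetric] q_def powr_powr)
        finally have *: "2 powr (real j * \<epsilon> * p) * 2 powr (- (real j * (p * \<beta>))) = q ^ j" .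
        then show ?thesis
          unfolding \<open>\<rho> j powr (\<gamma> * p) * \<rho> j powr d = \<rho> j powr (p * \<beta>)\<close> \<rho>p[of "p * \<beta>"]
          unfolding mult.left_commute[of "2 powr (real j * \<epsilon> * p)"] * by simp
      qed
      have 2: "G powr (p - 2) * G\<^sup>2 = G powr p"
      proof (cases "G = 0")
        case False
        then have "G\<^sup>2 = G powr 2" using G(1) by simp
        then show ?thesis by (simp only: powr_add[symmetric]) simp
      qed simp
      have "w j * (\<Lambda> * (K * \<rho> j) powr d * G\<^sup>2)
        = \<Lambda> * K powr d * ((G powr (p - 2) * G\<^sup>2) * (2 powr (real j * \<epsilon> * p) * (\<rho> j powr (\<gamma> * p) * \<rho> j powr d)))"
        using K \<rho>(1)[of j] by (simp add: w_def powr_mult)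
      also have "\<dots> = \<Lambda> * K powr d * (G powr p * r powr (p * \<beta>)) * q ^ j"
        unfolding 1 2 by simp
      finally show "ennreal (w j) * ennreal (\<Lambda> * (K * \<rho> j) powr d * G\<^sup>2)
        = ennreal (\<Lambda> * K powr d * (G powr p * r powr (p * \<beta>)) * q ^ j)"
        using w0[of j] by (simp only: ennreal_mult'[symmetric])
    qed
    also have "\<dots> = ennreal (\<Lambda> * K powr d * (G powr p * r powr (p * \<beta>)) * (1 / (1 - q)))"
      using q \<Lambda> by (intro suminf_ennreal_eq sums_mult geometric_sums) auto
    also have "ennreal D * ennreal (\<Lambda> * K powr d * (G powr p * r powr (p * \<beta>)) * (1 / (1 - q)))
        = ennreal (C' * \<Lambda> * (G powr p * r powr (p * \<beta>)))"
      using D by (simp add: ennreal_mult'[symmetric] C'_def ac_simps)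
    also have "C' * \<Lambda> * (G powr p * r powr (p * \<beta>)) = C' * \<Lambda> * (G * r powr \<gamma>) powr p * r powr d"
      using G(1) by (simp add: powr_mult powr_powr p\<beta> powr_add mult.commute[of \<gamma> p])
    finally show "(\<integral>\<^sup>+x. ennreal (\<bar>u x - c\<bar> powr p) \<partial>\<mu>)
        \<le> ennreal (C' * \<Lambda> * (G * r powr (1 - ?n / 2)) powr p * r powr d)"
      by (simp add: \<gamma>_def)
  qed
qed

section \<open>Means over sets and growth of the surface measure\<close>

lemma powr_add_le:
  fixes a b p :: real
  assumes "a \<ge> 0" "b \<ge> 0" "p \<ge> 0"
  shows "(a + b) powr p \<le> 2 powr p * (a powr p + b powr p)"
proof -
  have "(a + b) powr p \<le> (2 * max a b) powr p"
    using assms by (intro powr_mono2) auto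
  also have "\<dots> = 2 powr p * max a b powr p" using assms by (simp add: powr_mult)
  also have "max a b powr p \<le> a powr p + b powr p" by (simp add: max_def)
  finally show ?thesis by simp
qed

lemma avg_deviation_le:
  fixes u :: "real^'n \<Rightarrow> real"
  assumes E: "E \<in> sets lebesgue" "bounded E" "measure lebesgue E > 0"
    and u: "continuous_on UNIV u"
    and Q: "(\<integral>\<^sup>+x. ennreal ((u x - c)\<^sup>2) \<partial>lebesgue_on E) \<le> ennreal Q" "Q \<ge> 0"
  shows "(avg lebesgue E u - c)\<^sup>2 \<le> Q / measure lebesgue E"
proof -
  let ?m = "measure lebesgue E"
  have Em: "E \<in> lmeasurable" using E by (intro bounded_set_imp_lmeasurable)
  interpret finite_measure "lebesgue_on E" by (rule finite_measure_lebesgue_on[OF Em])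
  have sp: "space (lebesgue_on E) = E" by (simp add: space_restrict_space)
  have m: "measure (lebesgue_on E) E = ?m" using E by (simp add: measure_restrict_space)
  obtain B where B: "\<And>x. x \<in> E \<Longrightarrow> norm (u x) \<le> B"
  proof -
    have "compact (u ` closure E)"
      using E by (intro compact_continuous_image continuous_on_subset[OF u]) auto
    then show ?thesis
      using that closure_subset by (metis bounded_iff compact_imp_bounded imageI subsetD)
  qed
  have um: "u \<in> borel_measurable (lebesgue_on E)"
    using borel_measurable_continuous_onI[OF u]
    by (intro measurable_restrict_space1 measurable_completion) simp
  have iu: "integrable (lebesgue_on E) u"
    by (rule integrable_const_bound[of _ B]) (use B um in \<open>auto intro!: AE_I2 simp: sp\<close>)
  have iu2: "integrable (lebesgue_on E) (\<lambda>x. (u x - c)\<^sup>2)"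
  proof (rule integrable_const_bound[of _ "(B + \<bar>c\<bar>)\<^sup>2"])
    show "AE x in lebesgue_on E. norm ((u x - c)\<^sup>2) \<le> (B + \<bar>c\<bar>)\<^sup>2"
    proof (rule AE_I2)
      fix x assume "x \<in> space (lebesgue_on E)"
      then have "\<bar>u x\<bar> \<le> B" using B sp by auto
      then have "\<bar>u x - c\<bar> \<le> \<bar>B + \<bar>c\<bar>\<bar>" by linarith
      then show "norm ((u x - c)\<^sup>2) \<le> (B + \<bar>c\<bar>)\<^sup>2" by (simp add: abs_le_square_iff)
    qed
  qed (use um in measurable)
  have "(\<integral>x. (u x - c) * 1 \<partial>lebesgue_on E)\<^sup>2
      \<le> (\<integral>x. (u x - c)\<^sup>2 \<partial>lebesgue_on E) * (\<integral>x. 1\<^sup>2 \<partial>lebesgue_on E)"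
    by (rule integral_Cauchy_Schwarz) (use um iu2 in auto)
  also have "(\<integral>x. 1\<^sup>2 \<partial>lebesgue_on E) = ?m" by (simp add: sp m)
  also have "(\<integral>x. (u x - c)\<^sup>2 \<partial>lebesgue_on E) \<le> Q"
    using Q iu2 by (subst (asm) nn_integral_eq_integral) auto
  also have "(\<integral>x. (u x - c) * 1 \<partial>lebesgue_on E) = ?m * (avg lebesgue E u - c)"
  proof -
    have "(LINT x:E|lebesgue. u x) = (\<integral>x. u x \<partial>lebesgue_on E)"
      unfolding set_lebesgue_integral_def using E by (subst integral_restrict_space) auto
    then show ?thesis
      using iu E(3) by (simp add: avg_def sp m algebra_simps)
  qed
  finally have "(?m * (avg lebesgue E u - c))\<^sup>2 \<le> Q * ?m" using E(3) by (simp add: mult_right_mono)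
  then have "?m * (?m * (avg lebesgue E u - c)\<^sup>2) \<le> ?m * Q"
    by (simp add: power_mult_distrib power2_eq_square algebra_simps)
  then have "?m * (avg lebesgue E u - c)\<^sup>2 \<le> Q" using E(3) by simp
  then show ?thesis using E(3) by (simp add: field_simps)
qed

lemma ahlfors_regular_surface_ball:
  assumes \<sigma>: "ahlfors_regular M' d \<Omega> \<sigma>" and bnd: "bounded \<Omega>"
    and z: "z \<in> frontier \<Omega>" and r: "0 < r" "r \<le> diameter \<Omega>"
  shows "emeasure \<sigma> (surface_ball \<Omega> z r) \<le> ennreal (M' * r powr d)"
    and "ennreal (r powr d / M') \<le> emeasure \<sigma> (surface_ball \<Omega> z r)"
    and "surface_ball \<Omega> z r \<in> sets \<sigma>"
  using assms by (auto simp: ahlfors_regular_def admissible_radius_def surface_ball_def)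

text \<open>Regularity speaks only of balls centred on the frontier and of limited radius. A ball
  around any \<open>y\<close> that meets the surface ball sits, within the frontier, in one of twice
  the radius centred there; if that radius exceeds \<open>r\<close>, the whole surface ball is
  already small enough.\<close>

lemma ahlfors_regular_ball_le:
  assumes \<sigma>: "ahlfors_regular M' d \<Omega> \<sigma>" and bnd: "bounded \<Omega>" and d: "d > 0"
    and z: "z\<^sub>0 \<in> frontier \<Omega>" and r: "0 < r" "r \<le> diameter \<Omega>" and \<rho>: "\<rho> > 0"
  shows "emeasure \<sigma> (surface_ball \<Omega> z\<^sub>0 r \<inter> ball y \<rho>) \<le> ennreal (M' * 2 powr d * \<rho> powr d)"
proof (cases "surface_ball \<Omega> z\<^sub>0 r \<inter> ball y \<rho> = {}")
  case False
  have M': "M' \<ge> 1" and sets: "sets \<sigma> = sets borel" using \<sigma> by (auto simp: ahlfors_regular_def)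
  from False obtain z where z': "z \<in> frontier \<Omega>" "dist y z < \<rho>" by (auto simp: surface_ball_def)
  have eq: "M' * 2 powr d * \<rho> powr d = M' * (2 * \<rho>) powr d" using \<rho> by (simp add: powr_mult)
  show ?thesis
  proof (cases "2 * \<rho> \<le> r")
    case True
    have "surface_ball \<Omega> z\<^sub>0 r \<inter> ball y \<rho> \<subseteq> surface_ball \<Omega> z (2 * \<rho>)"
    proof
      fix x assume x: "x \<in> surface_ball \<Omega> z\<^sub>0 r \<inter> ball y \<rho>"
      have "dist z x \<le> dist y z + dist y x" by (rule dist_triangle3)
      with x z' show "x \<in> surface_ball \<Omega> z (2 * \<rho>)" by (auto simp: surface_ball_def)
    qed
    then have "emeasure \<sigma> (surface_ball \<Omega> z\<^sub>0 r \<inter> ball y \<rho>) \<le> emeasure \<sigma> (surface_ball \<Omega> z (2 * \<rho>))"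
      by (rule emeasure_mono) (simp add: sets surface_ball_def)
    also have "\<dots> \<le> ennreal (M' * (2 * \<rho>) powr d)"
      using True r \<rho> by (intro ahlfors_regular_surface_ball[OF \<sigma> bnd z'(1)]) auto
    finally show ?thesis unfolding eq .
  next
    case False
    have "emeasure \<sigma> (surface_ball \<Omega> z\<^sub>0 r \<inter> ball y \<rho>) \<le> emeasure \<sigma> (surface_ball \<Omega> z\<^sub>0 r)"
      by (rule emeasure_mono) (auto simp: sets surface_ball_def)
    also have "\<dots> \<le> ennreal (M' * r powr d)"
      by (rule ahlfors_regular_surface_ball[OF \<sigma> bnd z r])
    also have "\<dots> \<le> ennreal (M' * (2 * \<rho>) powr d)"
      using False r M' d by (intro ennreal_leI mult_left_mono powr_mono2) auto
    finally show ?thesis unfolding eq .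
  qed
qed simp

lemma emeasure_lborel_ball:
  fixes y :: "real^'n"
  assumes "\<rho> > 0"
  shows "emeasure lborel (ball y \<rho>) = ennreal (unit_ball_volume TYPE('n) * \<rho> ^ CARD('n))"
proof -
  have fin: "emeasure lborel (ball (0::real^'n) 1) = ennreal (unit_ball_volume TYPE('n))"
    unfolding unit_ball_volume_def using emeasure_lborel_ball_finite[of "0::real^'n" 1]
    by (simp add: emeasure_eq_ennreal_measure less_top)
  have "emeasure lborel (ball y \<rho>) = ennreal (\<rho> ^ CARD('n)) * emeasure lborel (ball (0::real^'n) 1)"
    using emeasure_lebesgue_ball_conv_unit_ball[of \<rho> y] assms by simp
  then show ?thesis
    using assms unit_ball_volume_pos[where 'n='n] by (simp add: fin ennreal_mult'[symmetric] mult.commute)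
qed

text \<open>\<open>K\<close> is obtained before \<open>p\<close> and \<open>c\<close>, since it
  stems from the chains alone. The bound \<open>Bd\<close> only guarantees finite local energies,
  and \<open>C\<close> does not depend on it. The right side keeps \<open>G\<close> as a free upper
  bound so that the estimate survives a limit.\<close>

theorem trace_inequality_C1:
  fixes M :: nat and M' d :: real
  assumes M: "M > 1" "M' \<ge> 1" and d: "real CARD('n) - 2 < d" "d > 0"
  obtains K where "K > 1"
    "\<And>p c. p \<ge> 2 \<Longrightarrow> p * (real CARD('n) - 2) / 2 < d \<Longrightarrow> c > 0 \<Longrightarrow>
      \<exists>C > 0. \<forall>(\<Omega> :: (real^'n) set) \<sigma> z\<^sub>0 r E u Bd G.
        bounded \<Omega> \<and> one_sided_NTA M \<Omega> \<and> ahlfors_regular M' d \<Omega> \<sigma> \<and> z\<^sub>0 \<in> frontier \<Omega> \<and>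
        0 < r \<and> r \<le> diameter \<Omega> \<and> E \<in> sets lebesgue \<and> E \<subseteq> ball z\<^sub>0 r \<inter> \<Omega> \<and>
        c * r ^ CARD('n) \<le> measure lebesgue E \<and> C_k (Suc 0) u \<and> (\<forall>x. norm (grad u x) \<le> Bd) \<and>
        G \<ge> 0 \<and> local_energy \<Omega> (grad u) z\<^sub>0 (K * r) \<le> ennreal (G\<^sup>2) \<longrightarrow>
        (\<integral>\<^sup>+x. ennreal (\<bar>u x - avg lebesgue E u\<bar> powr p) * indicator (surface_ball \<Omega> z\<^sub>0 r) x \<partial>\<sigma>)
          \<le> ennreal (C * (G * r powr (1 - real CARD('n) / 2)) powr p * r powr d)"
proof -
  let ?n = "real CARD('n)" and ?\<omega> = "unit_ball_volume TYPE('n)"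
  have \<omega>: "?\<omega> > 0" by (rule unit_ball_volume_pos)
  show thesis
  proof (rule pointwise_chain_bound[OF M(1), where 'n='n])
  fix K C\<^sub>0 :: real
  assume K: "K \<ge> 1" and C\<^sub>0: "C\<^sub>0 > 0" and pw:
    "\<And>(\<Omega> :: (real^'n) set) u Bd z\<^sub>0 r. one_sided_NTA M \<Omega> \<Longrightarrow> bounded \<Omega> \<Longrightarrow> C_k (Suc 0) u \<Longrightarrow>
      (\<And>x. norm (grad u x) \<le> Bd) \<Longrightarrow> z\<^sub>0 \<in> frontier \<Omega> \<Longrightarrow> 0 < r \<Longrightarrow> r \<le> diameter \<Omega> \<Longrightarrow>
      \<exists>c. \<forall>x \<in> closure \<Omega> \<inter> ball z\<^sub>0 r. \<forall>S.
        (\<forall>J::nat. (\<Sum>j\<le>J. (r / 2 ^ j) * sqrt (enn2real (local_energy \<Omega> (grad u) x (K * (r / 2 ^ j)))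
          / (r / 2 ^ j) ^ CARD('n))) \<le> S) \<longrightarrow> \<bar>u x - c\<bar> \<le> C\<^sub>0 * S"
  show thesis
  proof (rule that)
    show "K + 1 > 1" using K by simp
    fix p c :: real assume p: "p \<ge> 2" "p * (?n - 2) / 2 < d" and c: "c > 0"
    show "\<exists>C > 0. \<forall>(\<Omega> :: (real^'n) set) \<sigma> z\<^sub>0 r E u Bd G.
        bounded \<Omega> \<and> one_sided_NTA M \<Omega> \<and> ahlfors_regular M' d \<Omega> \<sigma> \<and> z\<^sub>0 \<in> frontier \<Omega> \<and>
        0 < r \<and> r \<le> diameter \<Omega> \<and> E \<in> sets lebesgue \<and> E \<subseteq> ball z\<^sub>0 r \<inter> \<Omega> \<and>
        c * r ^ CARD('n) \<le> measure lebesgue E \<and> C_k (Suc 0) u \<and> (\<forall>x. norm (grad u x) \<le> Bd) \<and>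
        G \<ge> 0 \<and> local_energy \<Omega> (grad u) z\<^sub>0 ((K + 1) * r) \<le> ennreal (G\<^sup>2) \<longrightarrow>
        (\<integral>\<^sup>+x. ennreal (\<bar>u x - avg lebesgue E u\<bar> powr p) * indicator (surface_ball \<Omega> z\<^sub>0 r) x \<partial>\<sigma>)
          \<le> ennreal (C * (G * r powr (1 - ?n / 2)) powr p * r powr d)"
    proof (rule integrate_chain_bound[OF K C\<^sub>0 p(1) d(2) p(2)])
    fix C\<^sub>1 :: real assume C\<^sub>1: "C\<^sub>1 > 0" and int\<sigma>:
    "\<And>(\<Omega> :: (real^'n) set) (g :: real^'n \<Rightarrow> real^'n) u A \<mu> \<Lambda> z\<^sub>0 r c G.
      open \<Omega> \<Longrightarrow> bounded \<Omega> \<Longrightarrow> g \<in> borel_measurable (lebesgue_on \<Omega>) \<Longrightarrow> A \<subseteq> ball z\<^sub>0 r \<Longrightarrow>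
      (AE x in \<mu>. x \<in> A) \<Longrightarrow> sets \<mu> = sets borel \<Longrightarrow> finite_measure \<mu> \<Longrightarrow> \<Lambda> \<ge> 0 \<Longrightarrow>
      (\<And>y \<rho>. \<rho> > 0 \<Longrightarrow> emeasure \<mu> (ball y \<rho>) \<le> ennreal (\<Lambda> * \<rho> powr d)) \<Longrightarrow> r > 0 \<Longrightarrow> G \<ge> 0 \<Longrightarrow>
      local_energy \<Omega> g z\<^sub>0 ((K + 1) * r) \<le> ennreal (G\<^sup>2) \<Longrightarrow>
      (\<And>x S. x \<in> A \<Longrightarrow> (\<And>J::nat. (\<Sum>j\<le>J. (r / 2 ^ j) * sqrt (enn2real (local_energy \<Omega> g x (K * (r / 2 ^ j)))
          / (r / 2 ^ j) ^ CARD('n))) \<le> S) \<Longrightarrow> \<bar>u x - c\<bar> \<le> C\<^sub>0 * S) \<Longrightarrow>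
      (\<integral>\<^sup>+x. ennreal (\<bar>u x - c\<bar> powr p) \<partial>\<mu>)
        \<le> ennreal (C\<^sub>1 * \<Lambda> * (G * r powr (1 - real CARD('n) / 2)) powr p * r powr d)"
    \<comment> \<open>Lebesgue measure has dimension n, for which the exponent 2 is always
      subcritical, as n - 2 < n. This is the second use of the integrated bound.\<close>
    have n0: "?n > 0" "2 * (?n - 2) / 2 < ?n" by simp_all
    show ?thesis
    proof (rule integrate_chain_bound[OF K C\<^sub>0 order_refl n0])
    fix C\<^sub>2 :: real assume C\<^sub>2: "C\<^sub>2 > 0" and intE:
    "\<And>(\<Omega> :: (real^'n) set) (g :: real^'n \<Rightarrow> real^'n) u A \<mu> \<Lambda> z\<^sub>0 r c G.
      open \<Omega> \<Longrightarrow> bounded \<Omega> \<Longrightarrow> g \<in> borel_measurable (lebesgue_on \<Omega>) \<Longrightarrow> A \<subseteq> ball z\<^sub>0 r \<Longrightarrow>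
      (AE x in \<mu>. x \<in> A) \<Longrightarrow> sets \<mu> = sets borel \<Longrightarrow> finite_measure \<mu> \<Longrightarrow> \<Lambda> \<ge> 0 \<Longrightarrow>
      (\<And>y \<rho>. \<rho> > 0 \<Longrightarrow> emeasure \<mu> (ball y \<rho>) \<le> ennreal (\<Lambda> * \<rho> powr ?n)) \<Longrightarrow> r > 0 \<Longrightarrow> G \<ge> 0 \<Longrightarrow>
      local_energy \<Omega> g z\<^sub>0 ((K + 1) * r) \<le> ennreal (G\<^sup>2) \<Longrightarrow>
      (\<And>x S. x \<in> A \<Longrightarrow> (\<And>J::nat. (\<Sum>j\<le>J. (r / 2 ^ j) * sqrt (enn2real (local_energy \<Omega> g x (K * (r / 2 ^ j)))
          / (r / 2 ^ j) ^ CARD('n))) \<le> S) \<Longrightarrow> \<bar>u x - c\<bar> \<le> C\<^sub>0 * S) \<Longrightarrow>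
      (\<integral>\<^sup>+x. ennreal (\<bar>u x - c\<bar> powr 2) \<partial>\<mu>)
        \<le> ennreal (C\<^sub>2 * \<Lambda> * (G * r powr (1 - real CARD('n) / 2)) powr 2 * r powr ?n)"
    \<comment> \<open>The only place where \<open>c\<close> enters: the deviation in mean square
      over \<open>E\<close> is divided by the measure of \<open>E\<close>, which is at least
      \<open>c * r ^ CARD('n)\<close>, and the result is raised to the power p / 2.\<close>
    define C\<^sub>3 where "C\<^sub>3 = (C\<^sub>2 * ?\<omega> / c) powr (p / 2)"
    define C where "C = 2 powr p * (C\<^sub>1 * (M' * 2 powr d) + C\<^sub>3 * M')"
    have C0: "C > 0" using M C\<^sub>1 by (simp add: C_def C\<^sub>3_def add_pos_nonneg)
    show ?thesis
    proof (intro exI[of _ C] conjI C0 allI impI, (elim conjE)?)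
      fix \<Omega> :: "(real^'n) set" and \<sigma> z\<^sub>0 r E u Bd G
      assume bnd: "bounded \<Omega>" and NTA: "one_sided_NTA M \<Omega>" and \<sigma>: "ahlfors_regular M' d \<Omega> \<sigma>"
        and z0: "z\<^sub>0 \<in> frontier \<Omega>" and r: "0 < r" "r \<le> diameter \<Omega>" and E: "E \<in> sets lebesgue"
        "E \<subseteq> ball z\<^sub>0 r \<inter> \<Omega>" "c * r ^ CARD('n) \<le> measure lebesgue E" and u: "C_k (Suc 0) u"
        and Bd: "\<forall>x. norm (grad u x) \<le> Bd" and G: "G \<ge> 0"
        "local_energy \<Omega> (grad u) z\<^sub>0 ((K + 1) * r) \<le> ennreal (G\<^sup>2)"
      have op: "open \<Omega>" using NTA by (simp add: one_sided_NTA_def)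
      let ?g = "G * r powr (1 - ?n / 2)"
      have g0: "?g \<ge> 0" using G by simp
      have gm: "grad u \<in> borel_measurable (lebesgue_on \<Omega>)"
        using borel_measurable_continuous_onI[OF C1_continuous(2)[OF u]]
        by (intro measurable_restrict_space1 measurable_completion) simp
      have um: "u \<in> borel_measurable borel"
        by (rule borel_measurable_continuous_onI[OF C1_continuous(1)[OF u]])
      obtain a where a: "\<And>x S. x \<in> closure \<Omega> \<inter> ball z\<^sub>0 r \<Longrightarrow>
        (\<And>J::nat. (\<Sum>j\<le>J. (r / 2 ^ j) * sqrt (enn2real (local_energy \<Omega> (grad u) x (K * (r / 2 ^ j)))
          / (r / 2 ^ j) ^ CARD('n))) \<le> S) \<Longrightarrow> \<bar>u x - a\<bar> \<le> C\<^sub>0 * S"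
        using pw[OF NTA bnd u Bd[rule_format] z0 r] by blast
      have sets\<sigma>: "sets \<sigma> = sets borel" using \<sigma> by (simp add: ahlfors_regular_def)
      let ?\<Delta> = "surface_ball \<Omega> z\<^sub>0 r"
      have \<Delta>: "?\<Delta> \<in> sets \<sigma>" "?\<Delta> \<subseteq> closure \<Omega> \<inter> ball z\<^sub>0 r"
        by (auto simp: sets\<sigma> surface_ball_def frontier_def)
      have um\<sigma>: "u \<in> borel_measurable \<sigma>" using um sets\<sigma> by (simp cong: measurable_cong_sets)
      have ball\<sigma>: "ball y \<rho> \<in> sets \<sigma>" for y \<rho> by (simp add: sets\<sigma>)
      have s1: "(\<integral>\<^sup>+x. ennreal (\<bar>u x - a\<bar> powr p) * indicator ?\<Delta> x \<partial>\<sigma>)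
        \<le> ennreal (C\<^sub>1 * (M' * 2 powr d) * ?g powr p * r powr d)"
      proof -
        \<comment> \<open>Restriction to the surface ball is expressed by a density, which keeps the
          Borel sets and makes the measure finite; it is this restricted measure that has the growth
          bound for all balls.\<close>
        define \<mu> where "\<mu> = density \<sigma> (indicator ?\<Delta>)"
        have e\<mu>: "emeasure \<mu> X = emeasure \<sigma> (?\<Delta> \<inter> X)" if "X \<in> sets \<sigma>" for X
          unfolding \<mu>_def using that \<Delta>(1) by (simp add: emeasure_density indicator_inter_arith[symmetric])
        have "(\<integral>\<^sup>+x. ennreal (\<bar>u x - a\<bar> powr p) \<partial>\<mu>)
          \<le> ennreal (C\<^sub>1 * (M' * 2 powr d) * ?g powr p * r powr d)"
        proof (rule int\<sigma>[OF op bnd gm _ _ _ _ _ _ r(1) G a])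
          show "closure \<Omega> \<inter> ball z\<^sub>0 r \<subseteq> ball z\<^sub>0 r" by simp
          show "AE x in \<mu>. x \<in> closure \<Omega> \<inter> ball z\<^sub>0 r"
            unfolding \<mu>_def using \<Delta> by (subst AE_density) (auto simp: indicator_def split: if_splits intro!: AE_I2)
          show "sets \<mu> = sets borel" by (simp add: \<mu>_def sets\<sigma>)
          have "emeasure \<mu> (space \<mu>) = emeasure \<sigma> ?\<Delta>"
            using e\<mu>[of "space \<sigma>"] sets.sets_into_space[OF \<Delta>(1)] by (simp add: \<mu>_def Int_absorb2)
          also have "\<dots> < \<infinity>"
            using ahlfors_regular_surface_ball(1)[OF \<sigma> bnd z0 r] ennreal_less_top le_less_trans
            unfolding infinity_ennreal_def by blast
          finally show "finite_measure \<mu>" by (intro finite_measureI) auto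
          show "0 \<le> M' * 2 powr d" using M by simp
          show "emeasure \<mu> (ball y \<rho>) \<le> ennreal (M' * 2 powr d * \<rho> powr d)" if "\<rho> > 0" for y \<rho>
            unfolding e\<mu>[OF ball\<sigma>] by (rule ahlfors_regular_ball_le[OF \<sigma> bnd d(2) z0 r that])
        qed auto
        then show ?thesis
          unfolding \<mu>_def using \<Delta>(1) um\<sigma> by (subst (asm) nn_integral_density) (auto simp: mult.commute)
      qed
      have s2: "\<bar>avg lebesgue E u - a\<bar> powr p \<le> C\<^sub>3 * ?g powr p"
      proof -
        define \<mu> where "\<mu> = density lborel (indicator (\<Omega> \<inter> ball z\<^sub>0 r) :: real^'n \<Rightarrow> ennreal)"
        have sb: "\<Omega> \<inter> ball z\<^sub>0 r \<in> sets lborel" using op by simp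
        have e\<mu>: "emeasure \<mu> X = emeasure lborel (\<Omega> \<inter> ball z\<^sub>0 r \<inter> X)" if "X \<in> sets lborel" for X
          unfolding \<mu>_def using that sb by (simp add: emeasure_density indicator_inter_arith[symmetric])
        define Q where "Q = C\<^sub>2 * ?\<omega> * ?g powr 2 * r powr ?n"
        have Q0: "Q \<ge> 0" using C\<^sub>2 \<omega> by (simp add: Q_def)
        have "(\<integral>\<^sup>+x. ennreal (\<bar>u x - a\<bar> powr 2) \<partial>\<mu>) \<le> ennreal Q"
          unfolding Q_def
        proof (rule intE[OF op bnd gm _ _ _ _ _ _ r(1) G a])
          show "closure \<Omega> \<inter> ball z\<^sub>0 r \<subseteq> ball z\<^sub>0 r" by simp
          show "AE x in \<mu>. x \<in> closure \<Omega> \<inter> ball z\<^sub>0 r"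
            unfolding \<mu>_def using sb closure_subset[of \<Omega>]
            by (subst AE_density) (auto simp: indicator_def split: if_splits intro!: AE_I2)
          show "sets \<mu> = sets borel" by (simp add: \<mu>_def)
          have "emeasure \<mu> (space \<mu>) = emeasure lborel (\<Omega> \<inter> ball z\<^sub>0 r)"
            using e\<mu>[of UNIV] by (simp add: \<mu>_def)
          also have "\<dots> < \<infinity>" using bnd by (intro emeasure_bounded_finite bounded_Int) simp
          finally show "finite_measure \<mu>" by (intro finite_measureI) auto
          show "0 \<le> ?\<omega>" using \<omega> by simp
          show "emeasure \<mu> (ball y \<rho>) \<le> ennreal (?\<omega> * \<rho> powr ?n)" if "\<rho> > 0" for y \<rho>
          proof -
            have "emeasure \<mu> (ball y \<rho>) \<le> emeasure lborel (ball y \<rho>)"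
              unfolding e\<mu>[of "ball y \<rho>", simplified] by (intro emeasure_mono) auto
            then show ?thesis using that by (simp add: emeasure_lborel_ball powr_realpow)
          qed
        qed auto
        also have "(\<integral>\<^sup>+x. ennreal (\<bar>u x - a\<bar> powr 2) \<partial>\<mu>)
          = (\<integral>\<^sup>+x. indicator (\<Omega> \<inter> ball z\<^sub>0 r) x * ennreal (\<bar>u x - a\<bar> powr 2) \<partial>lborel)"
          unfolding \<mu>_def using sb um by (subst nn_integral_density) auto
        finally have Q: "(\<integral>\<^sup>+x. indicator (\<Omega> \<inter> ball z\<^sub>0 r) x * ennreal (\<bar>u x - a\<bar> powr 2) \<partial>lborel) \<le> ennreal Q" .
        have m0: "measure lebesgue E > 0" using E(3) c r by (meson mult_pos_pos zero_less_power less_le_trans)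
        have "(avg lebesgue E u - a)\<^sup>2 \<le> Q / measure lebesgue E"
        proof (rule avg_deviation_le[OF E(1) _ m0 C1_continuous(1)[OF u] _ Q0])
          show "bounded E" using E(2) bounded_subset[OF bnd] by blast
          have "(\<integral>\<^sup>+x. ennreal ((u x - a)\<^sup>2) \<partial>lebesgue_on E) = (\<integral>\<^sup>+x. ennreal ((u x - a)\<^sup>2) * indicator E x \<partial>lborel)"
            using E(1) by (simp add: nn_integral_restrict_space nn_integral_completion)
          also have "\<dots> \<le> (\<integral>\<^sup>+x. indicator (\<Omega> \<inter> ball z\<^sub>0 r) x * ennreal (\<bar>u x - a\<bar> powr 2) \<partial>lborel)"
            using E(2) by (intro nn_integral_mono) (auto simp: indicator_def)
          finally show "(\<integral>\<^sup>+x. ennreal ((u x - a)\<^sup>2) \<partial>lebesgue_on E) \<le> ennreal Q" using Q by simp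
        qed
        also have "\<dots> \<le> Q / (c * r ^ CARD('n))"
          using Q0 E(3) m0 c r by (intro divide_left_mono mult_pos_pos) auto
        also have "\<dots> = C\<^sub>2 * ?\<omega> / c * ?g\<^sup>2"
          using r g0 by (simp add: Q_def powr_realpow)
        finally have "(avg lebesgue E u - a)\<^sup>2 \<le> C\<^sub>2 * ?\<omega> / c * ?g\<^sup>2" .
        then have "((avg lebesgue E u - a)\<^sup>2) powr (p / 2) \<le> (C\<^sub>2 * ?\<omega> / c * ?g\<^sup>2) powr (p / 2)"
          using p by (intro powr_mono2) auto
        also have "\<dots> = C\<^sub>3 * (?g\<^sup>2) powr (p / 2)"
          unfolding C\<^sub>3_def by (rule powr_mult)
        also have sq: "(t\<^sup>2) powr (p / 2) = \<bar>t\<bar> powr p" for t :: real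
        proof -
          have "t\<^sup>2 = \<bar>t\<bar> powr 2" by simp
          then show ?thesis by (simp only: powr_powr) (simp add: powr_powr)
        qed
        finally show ?thesis using g0 by (simp only: sq abs_of_nonneg)
      qed
      have "(\<integral>\<^sup>+x. ennreal (\<bar>u x - avg lebesgue E u\<bar> powr p) * indicator ?\<Delta> x \<partial>\<sigma>)
        \<le> (\<integral>\<^sup>+x. ennreal (2 powr p) * (ennreal (\<bar>u x - a\<bar> powr p) * indicator ?\<Delta> x
            + ennreal (C\<^sub>3 * ?g powr p) * indicator ?\<Delta> x) \<partial>\<sigma>)"
      proof (intro nn_integral_mono)
        fix x
        have "\<bar>u x - avg lebesgue E u\<bar> powr p \<le> (\<bar>u x - a\<bar> + \<bar>avg lebesgue E u - a\<bar>) powr p"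
          using p by (intro powr_mono2) auto
        also have "\<dots> \<le> 2 powr p * (\<bar>u x - a\<bar> powr p + \<bar>avg lebesgue E u - a\<bar> powr p)"
          using p by (intro powr_add_le) auto
        also have "\<dots> \<le> 2 powr p * (\<bar>u x - a\<bar> powr p + C\<^sub>3 * ?g powr p)"
          by (intro mult_left_mono add_left_mono s2) auto
        finally have "ennreal (\<bar>u x - avg lebesgue E u\<bar> powr p)
          \<le> ennreal (2 powr p) * (ennreal (\<bar>u x - a\<bar> powr p) + ennreal (C\<^sub>3 * ?g powr p))"
          by (simp add: C\<^sub>3_def ennreal_mult'[symmetric] ennreal_plus[symmetric] del: ennreal_plus)
        then show "ennreal (\<bar>u x - avg lebesgue E u\<bar> powr p) * indicator ?\<Delta> x
          \<le> ennreal (2 powr p) * (ennreal (\<bar>u x - a\<bar> powr p) * indicator ?\<Delta> x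
            + ennreal (C\<^sub>3 * ?g powr p) * indicator ?\<Delta> x)"
          by (auto simp: indicator_def)
      qed
      also have "\<dots> = ennreal (2 powr p) * ((\<integral>\<^sup>+x. ennreal (\<bar>u x - a\<bar> powr p) * indicator ?\<Delta> x \<partial>\<sigma>)
          + ennreal (C\<^sub>3 * ?g powr p) * emeasure \<sigma> ?\<Delta>)"
        using um\<sigma> \<Delta>(1) by (simp add: nn_integral_cmult nn_integral_add nn_integral_cmult_indicator)
      also have "\<dots> \<le> ennreal (2 powr p) * (ennreal (C\<^sub>1 * (M' * 2 powr d) * ?g powr p * r powr d)
          + ennreal (C\<^sub>3 * ?g powr p) * ennreal (M' * r powr d))"
        by (intro mult_left_mono add_mono s1 ahlfors_regular_surface_ball[OF \<sigma> bnd z0 r]) auto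
      also have "\<dots> = ennreal (2 powr p * (C\<^sub>1 * (M' * 2 powr d) * ?g powr p * r powr d
          + C\<^sub>3 * ?g powr p * (M' * r powr d)))"
        using M C\<^sub>1 by (simp add: C\<^sub>3_def ennreal_mult'[symmetric] ennreal_plus[symmetric] del: ennreal_plus)
      also have "2 powr p * (C\<^sub>1 * (M' * 2 powr d) * ?g powr p * r powr d
          + C\<^sub>3 * ?g powr p * (M' * r powr d)) = C * ?g powr p * r powr d"
        by (simp only: C_def ring_distribs ac_simps)
      finally show "(\<integral>\<^sup>+x. ennreal (\<bar>u x - avg lebesgue E u\<bar> powr p) * indicator ?\<Delta> x \<partial>\<sigma>)
        \<le> ennreal (C * ?g powr p * r powr d)" .
    qed
    qed
    qed
  qed
  qed
qed

section \<open>Density of smooth functions in \<open>W\<^sup>1\<^sup>,\<^sup>2\<close>\<close>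

text \<open>The conjuncts are: smooth output with compact support, compatibility with differences,
  local bounds for the function and for its gradient, and closeness to functions of small
  oscillation. The bounds are local with factor \<rho>^(-n), so that integrating them gives bounds
  independent of \<rho>. Compatibility with differences is the only part of linearity required, to
  pass from \<open>u\<close> to a nearby smooth function.\<close>

definition lattice_approximant ::
    "real \<Rightarrow> (real^'n) set \<Rightarrow> real \<Rightarrow> ((real^'n \<Rightarrow> real) \<Rightarrow> real^'n \<Rightarrow> real) \<Rightarrow> bool" where
  "lattice_approximant C \<Omega> \<rho> T \<longleftrightarrow>
    (\<forall>u. T u \<in> smooth_gen \<inter> test_functions UNIV) \<and>
    (\<forall>u \<in> square_int (lebesgue_on \<Omega>). \<forall>v \<in> square_int (lebesgue_on \<Omega>). \<forall>x.
      T (\<lambda>x. u x - v x) x = T u x - T v x) \<and>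
    (\<forall>u \<in> square_int (lebesgue_on \<Omega>). \<forall>x \<in> \<Omega>.
      ennreal ((T u x)\<^sup>2) \<le> ennreal (C / \<rho> ^ CARD('n)) * local_energy \<Omega> u x (C * \<rho>)) \<and>
    (\<forall>u \<in> square_int (lebesgue_on \<Omega>). \<forall>g \<in> square_int (lebesgue_on \<Omega>). is_weak_grad \<Omega> u g \<longrightarrow>
      (\<forall>x \<in> \<Omega>. ennreal ((norm (grad (T u) x))\<^sup>2) \<le> ennreal (C / \<rho> ^ CARD('n)) * local_energy \<Omega> g x (C * \<rho>))) \<and>
    (\<forall>v \<in> square_int (lebesgue_on \<Omega>). \<forall>e \<ge> 0. \<forall>x \<in> \<Omega>.
      (\<forall>y. dist x y \<le> C * \<rho> \<longrightarrow> \<bar>v y - v x\<bar> \<le> e) \<longrightarrow> \<bar>T v x - v x\<bar> \<le> e)"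

text \<open>The approximant at scale \<open>\<rho>\<close> attaches to every lattice cell of size \<open>\<rho>\<close> meeting \<open>\<Omega>\<close> the
  mollified value of \<open>u\<close> at a corkscrew point of that scale, and glues these constants with the
  partition of unity. Harnack chains bound the difference of neighbouring constants by the
  gradient of \<open>u\<close>.\<close>

lemma lattice_approximation:
  fixes M :: nat
  assumes M: "M > 1"
  shows "\<exists>C \<ge> 1. \<forall>(\<Omega> :: (real^'n) set) \<rho>. one_sided_NTA M \<Omega> \<and> bounded \<Omega> \<and> 0 < \<rho> \<and> \<rho> \<le> diameter \<Omega> \<longrightarrow>
    (\<exists>T. lattice_approximant C \<Omega> \<rho> T)"
proof -
  let ?n = "real CARD('n)"
  \<comment> \<open>Two anchors attached to cells near the same point lie within (4n + 2)\<rho> of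
    it, hence within (8n + 4)\<rho> of each other.\<close>
  define L where "L = real M + 8 * ?n + 4"
  have L: "L \<ge> 1" by (simp add: L_def)
  obtain Lc where Lc: "Lc > 0" "\<And>\<rho> (q :: 'n \<Rightarrow> int) x. \<rho> > 0 \<Longrightarrow> norm (grad (cell \<rho> q) x) \<le> Lc / \<rho>"
    using grad_cell_bound by blast
  show ?thesis
  proof (rule harnack_chain_oscillation[OF M L, where 'n='n])
    fix \<theta> C\<^sub>0 :: real
    assume \<theta>: "\<theta> > 0" and C\<^sub>0: "C\<^sub>0 \<ge> 1" and \<theta>L: "\<theta> * L \<le> 1" and chain:
      "\<And>(\<Omega> :: (real^'n) set) x y \<rho> (F :: real^'n \<Rightarrow> real) A.
      one_sided_NTA M \<Omega> \<Longrightarrow> bounded \<Omega> \<Longrightarrow> x \<in> \<Omega> \<Longrightarrow> y \<in> \<Omega> \<Longrightarrow> \<rho> > 0 \<Longrightarrow> dist x y \<le> L * \<rho> \<Longrightarrow>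
      \<rho> / L \<le> bdist \<Omega> x \<Longrightarrow> \<rho> / L \<le> bdist \<Omega> y \<Longrightarrow> A \<ge> 0 \<Longrightarrow>
      (\<And>p q. closed_segment p q \<subseteq> {w \<in> \<Omega>. \<theta> * \<rho> \<le> bdist \<Omega> w \<and> dist x w \<le> C\<^sub>0 * \<rho>} \<Longrightarrow>
        \<bar>F p - F q\<bar> \<le> A * dist p q) \<Longrightarrow> \<bar>F x - F y\<bar> \<le> A * (C\<^sub>0 * \<rho>)"
    have "\<theta> * real M \<le> \<theta> * L" "\<theta> * 1 \<le> \<theta> * L" using \<theta> L by (auto simp: L_def)
    then have "\<theta> * real M \<le> 1" and \<theta>1: "\<theta> \<le> 1" using \<theta>L by auto
    then have \<theta>M: "\<theta> \<le> 1 / real M" using M by (simp add: field_simps)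
    \<comment> \<open>The normalising factor of the kernel in units of \<rho>. Its width is
      \<theta>\<rho> / (2n), so that its support has radius at most \<theta>\<rho> / 2 and stays
      inside \<Omega> along the chains.\<close>
    define \<kappa> where "\<kappa> = bump_integral TYPE('n) * (\<theta> / (2 * ?n)) ^ CARD('n)"
    have \<kappa>: "\<kappa> > 0" using \<theta> bump_integral_pos[where 'n='n] by (simp add: \<kappa>_def)
    define D where "D = 3 ^ CARD('n) * C\<^sub>0 * Lc"
    \<comment> \<open>Reach from \<open>x\<close>: 4n + 2 to an anchor, \<open>C\<^sub>0\<close>
      along a chain and less than 1 for the kernel, all in units of \<rho>.\<close>
    define C\<^sub>1 where "C\<^sub>1 = C\<^sub>0 + 4 * ?n + 3"
    define C where "C = C\<^sub>1 + (1 + D\<^sup>2) / \<kappa>"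
    have C: "C \<ge> 1" "C\<^sub>1 \<le> C" "1 / \<kappa> \<le> C" "D\<^sup>2 / \<kappa> \<le> C"
      using C\<^sub>0 \<kappa> by (auto simp: C_def C\<^sub>1_def add_divide_distrib add_increasing add_increasing2 intro: add_nonneg_nonneg)
    show ?thesis
    proof (intro exI[of _ C] conjI C(1) allI impI, elim conjE)
      fix \<Omega> :: "(real^'n) set" and \<rho> :: real
      assume NTA: "one_sided_NTA M \<Omega>" and bnd: "bounded \<Omega>" and \<rho>: "0 < \<rho>" "\<rho> \<le> diameter \<Omega>"
      interpret bounded_open \<Omega>
        using NTA bnd by unfold_locales (auto simp: one_sided_NTA_def)
      define s where "s = \<theta> * \<rho> / (2 * ?n)"
      have s: "s > 0" using \<theta> \<rho> by (simp add: s_def)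
      have ns: "?n * s = \<theta> * \<rho> / 2" by (simp add: s_def)
      have cs: "bump_integral TYPE('n) * s ^ CARD('n) = \<kappa> * \<rho> ^ CARD('n)"
        by (simp add: s_def \<kappa>_def power_mult_distrib power_divide)
      \<comment> \<open>The anchor may depend on the cell only, not on \<open>x\<close>, so it is
        chosen relative to the lattice point; the radius 2n + 2 is that of a corkscrew point plus
        that of the cell. For cells not near any point of \<Omega> the choice may be arbitrary, and
        no estimate on \<Omega> involves them.\<close>
      define anchor where "anchor q = (SOME a. a \<in> \<Omega> \<and> dist a (lattice_point \<rho> q) \<le> (2 * ?n + 2) * \<rho> \<and>
        \<rho> / real M \<le> bdist \<Omega> a)" for q :: "'n \<Rightarrow> int"
      have anchor: "anchor q \<in> \<Omega>" "\<rho> / real M \<le> bdist \<Omega> (anchor q)" "dist (anchor q) x \<le> (4 * ?n + 2) * \<rho>"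
        if x: "x \<in> \<Omega>" and q: "q \<in> near_cells \<rho> x" for q x
      proof -
        have xq: "dist x (lattice_point \<rho> q) \<le> 2 * ?n * \<rho>" by (rule near_cells_dist[OF q \<rho>(1)])
        have xc: "x \<in> closure \<Omega>" using x closure_subset by blast
        obtain a where a: "a \<in> \<Omega>" "dist a x \<le> 2 * \<rho>" "\<rho> / real M \<le> bdist \<Omega> a"
          using corkscrew_closure[OF NTA bnd xc \<rho>] .
        have "dist a (lattice_point \<rho> q) \<le> 2 * \<rho> + 2 * ?n * \<rho>"
          using dist_triangle[of a "lattice_point \<rho> q" x] a(2) xq by linarith
        then have "a \<in> \<Omega> \<and> dist a (lattice_point \<rho> q) \<le> (2 * ?n + 2) * \<rho> \<and> \<rho> / real M \<le> bdist \<Omega> a"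
          using a by (simp add: algebra_simps)
        then have *: "anchor q \<in> \<Omega> \<and> dist (anchor q) (lattice_point \<rho> q) \<le> (2 * ?n + 2) * \<rho> \<and> \<rho> / real M \<le> bdist \<Omega> (anchor q)"
          unfolding anchor_def by (rule someI)
        then show "anchor q \<in> \<Omega>" "\<rho> / real M \<le> bdist \<Omega> (anchor q)" by auto
        have "dist (anchor q) x \<le> (2 * ?n + 2) * \<rho> + 2 * ?n * \<rho>"
          using dist_triangle2[of "anchor q" x "lattice_point \<rho> q"] * xq by linarith
        then show "dist (anchor q) x \<le> (4 * ?n + 2) * \<rho>" by (simp add: algebra_simps)
      qed
      have sub\<Omega>: "cball w (?n * s) \<subseteq> \<Omega>" if "w \<in> \<Omega>" "\<theta> * \<rho> \<le> bdist \<Omega> w" for w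
      proof
        fix y assume "y \<in> cball w (?n * s)"
        then have "dist w y \<le> \<theta> * \<rho> / 2" by (simp add: ns)
        moreover have "\<theta> * \<rho> > 0" using \<theta> \<rho> by simp
        ultimately have "y \<in> ball w (bdist \<Omega> w)" using that(2) by simp
        then show "y \<in> \<Omega>" using ball_bdist_subset[OF that(1)] by blast
      qed
      have anchor_sub: "cball (anchor q) (?n * s) \<subseteq> \<Omega>" if "x \<in> \<Omega>" "q \<in> near_cells \<rho> x" for q x
      proof (rule sub\<Omega>)
        show "anchor q \<in> \<Omega>" by (rule anchor(1)[OF that])
        have "\<theta> * \<rho> \<le> 1 / real M * \<rho>" using \<theta>M \<rho> by (intro mult_right_mono) auto
        then show "\<theta> * \<rho> \<le> bdist \<Omega> (anchor q)" using anchor(2)[OF that] by simp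
      qed
      have C1\<rho>: "(4 * ?n + 2) * \<rho> + C\<^sub>0 * \<rho> + \<theta> * \<rho> / 2 < C\<^sub>1 * \<rho>"
      proof -
        have "\<theta> * \<rho> \<le> \<rho>" using \<theta>1 \<rho> by simp
        then show ?thesis using \<rho>(1) unfolding C\<^sub>1_def ring_distribs by linarith
      qed
      have C0\<rho>: "C\<^sub>0 * \<rho> \<ge> 0" "\<theta> * \<rho> \<ge> 0" using C\<^sub>0 \<theta> \<rho> by auto
      define c where "c u q = mollified u s (anchor q)" for u q
      obtain R where R: "\<And>x. x \<in> \<Omega> \<Longrightarrow> norm x \<le> R" using bnd by (auto simp: bounded_iff)
      \<comment> \<open>The lattice covers the ball of radius R + 1 and not just \<Omega>, so that
        the cells sum to 1 on a neighbourhood of each point of \<Omega> and this identity can be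
        differentiated.\<close>
      obtain N\<^sub>0 :: nat where N\<^sub>0: "(R + 1) / \<rho> + 1 \<le> real N\<^sub>0" using real_arch_simple by blast
      define T where "T u x = (\<Sum>q\<in>lattice N\<^sub>0. c u q * cell \<rho> q x)" for u x
      have sum1: "(\<Sum>q\<in>lattice N\<^sub>0. cell \<rho> q x) = 1" if "norm x < R + 1" for x :: "real^'n"
      proof (rule sum_cell_eq_1)
        fix i
        have "\<bar>x $ i / \<rho>\<bar> \<le> norm x / \<rho>"
          using component_le_norm_cart[of x i] \<rho> by (simp add: divide_right_mono)
        also have "\<dots> \<le> (R + 1) / \<rho>" using that \<rho> by (simp add: divide_right_mono)
        finally show "\<bar>x $ i / \<rho>\<bar> \<le> real N\<^sub>0 - 1" using N\<^sub>0 by linarith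
      qed
      define Q where "Q x = lattice N\<^sub>0 \<inter> near_cells \<rho> x" for x :: "real^'n"
      have Q: "finite (Q x)" "Q x \<subseteq> near_cells \<rho> x" for x by (auto simp: Q_def)
      have cardQ: "real (card (Q x)) \<le> 3 ^ CARD('n)" for x
      proof -
        have "card (Q x) \<le> card (near_cells \<rho> x)"
          by (intro card_mono Q near_cells_card)
        also have "\<dots> \<le> 3 ^ CARD('n)" by (rule near_cells_card)
        finally have "real (card (Q x)) \<le> real (3 ^ CARD('n))" by (simp only: of_nat_le_iff)
        then show ?thesis by simp
      qed
      have restr: "(\<Sum>q\<in>lattice N\<^sub>0. f q * cell \<rho> q x) = (\<Sum>q\<in>Q x. f q * cell \<rho> q x)" for f and x :: "real^'n"
        by (intro sum.mono_neutral_right) (auto simp: Q_def near_cells_outside)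
      have restrg: "(\<Sum>q\<in>lattice N\<^sub>0. f q *\<^sub>R grad (cell \<rho> q) x) = (\<Sum>q\<in>Q x. f q *\<^sub>R grad (cell \<rho> q) x)" for f and x :: "real^'n"
        by (intro sum.mono_neutral_right) (auto simp: Q_def near_cells_outside)
      have Q1: "(\<Sum>q\<in>Q x. cell \<rho> q x) = 1" if "x \<in> \<Omega>" for x
        using restr[of "\<lambda>_. 1" x] sum1[of x] R[OF that] by simp
      have dersum: "((\<lambda>x. \<Sum>q\<in>lattice N\<^sub>0. f q * cell \<rho> q x) has_derivative
        (\<lambda>v. v \<bullet> (\<Sum>q\<in>lattice N\<^sub>0. f q *\<^sub>R grad (cell \<rho> q) x))) (at x)" for f and x :: "real^'n"
        unfolding inner_sum_right inner_scaleR_right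
        by (intro has_derivative_sum has_derivative_mult_right has_derivative_cell)
      have Qg: "(\<Sum>q\<in>Q x. grad (cell \<rho> q) x) = 0" if x: "x \<in> \<Omega>" for x
      proof -
        let ?f = "\<lambda>x. \<Sum>q\<in>lattice N\<^sub>0. cell \<rho> q x"
        have "((\<lambda>_. 1) has_derivative (\<lambda>v. v \<bullet> 0)) (at x)" by simp
        then have "(?f has_derivative (\<lambda>v. v \<bullet> 0)) (at x)"
        proof (rule has_derivative_transform_within_open[of _ _ _ _ "ball 0 (R + 1)"])
          show "x \<in> ball 0 (R + 1)" using R[OF x] by simp
        qed (use sum1 in auto)
        from grad_eqI[OF this] have "grad ?f x = 0" .
        moreover have "grad ?f x = (\<Sum>q\<in>lattice N\<^sub>0. grad (cell \<rho> q) x)"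
          using grad_eqI[OF dersum[of "\<lambda>_. 1" x]] by simp
        ultimately show ?thesis using restrg[of "\<lambda>_. 1" x] by simp
      qed
      have energy: "\<exists>J \<ge> 0. local_energy \<Omega> f x (C\<^sub>1 * \<rho>) = ennreal J"
        if f: "f \<in> square_int (lebesgue_on \<Omega>)" for f :: "real^'n \<Rightarrow> 'c::real_normed_vector" and x
      proof -
        have "integrable N (\<lambda>x. (norm (f x))\<^sup>2)" using f by (auto simp: square_int_def)
        then have "(\<integral>\<^sup>+y. ennreal ((norm (f y))\<^sup>2) \<partial>N) < \<infinity>" by (simp add: nn_integral_eq_integral)
        then have "local_energy \<Omega> f x (C\<^sub>1 * \<rho>) < \<infinity>" using local_energy_le le_less_trans by blast
        then show ?thesis by (cases "local_energy \<Omega> f x (C\<^sub>1 * \<rho>)") auto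
      qed
      have weaken: "ennreal t \<le> ennreal (C / \<rho> ^ CARD('n)) * local_energy \<Omega> f x (C * \<rho>)"
        if J: "local_energy \<Omega> f x (C\<^sub>1 * \<rho>) = ennreal J" "J \<ge> 0" and t: "t \<le> b * (J / \<rho> ^ CARD('n))" "b \<le> C"
        for t b J f x
      proof -
        have "t \<le> C * (J / \<rho> ^ CARD('n))"
          using t mult_right_mono[OF t(2), of "J / \<rho> ^ CARD('n)"] J(2) \<rho> by simp
        then have "ennreal t \<le> ennreal (C / \<rho> ^ CARD('n)) * ennreal J"
          using C(1) \<rho> J(2) by (simp add: ennreal_mult'[symmetric] ennreal_leI)
        also have "\<dots> \<le> ennreal (C / \<rho> ^ CARD('n)) * local_energy \<Omega> f x (C * \<rho>)"
          unfolding J(1)[symmetric] using C(2) \<rho> by (intro mult_left_mono local_energy_mono subset_ball) auto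
        finally show ?thesis .
      qed
      show "\<exists>T. lattice_approximant C \<Omega> \<rho> T"
        unfolding lattice_approximant_def
      proof (intro exI[of _ T] conjI allI ballI impI)
        fix u
        have sm: "T u \<in> smooth_gen"
          unfolding T_def[abs_def] by (intro smooth_gen_sum smooth_gen_cmult cell_smooth)
        moreover have "T u \<in> test_functions UNIV"
        proof (rule smooth_gen_test_function[OF sm])
          show "compact (\<Union>q\<in>lattice N\<^sub>0. cball (lattice_point \<rho> q :: real^'n) (2 * ?n * \<rho>))"
            by (intro compact_UN) auto
          show "{x. T u x \<noteq> 0} \<subseteq> (\<Union>q\<in>lattice N\<^sub>0. cball (lattice_point \<rho> q) (2 * ?n * \<rho>))"
          proof
            fix x assume "x \<in> {x. T u x \<noteq> 0}"
            then have "(\<Sum>q\<in>lattice N\<^sub>0. c u q * cell \<rho> q x) \<noteq> 0" by (simp add: T_def)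
            then obtain q where q: "q \<in> lattice N\<^sub>0" "c u q * cell \<rho> q x \<noteq> 0"
              using sum.neutral[of "lattice N\<^sub>0" "\<lambda>q. c u q * cell \<rho> q x"] by metis
            then have "x \<in> cball (lattice_point \<rho> q) (2 * ?n * \<rho>)"
              using cell_support_compact[OF \<rho>(1), of q] by auto
            with q(1) show "x \<in> (\<Union>q\<in>lattice N\<^sub>0. cball (lattice_point \<rho> q) (2 * ?n * \<rho>))" by blast
          qed
        qed simp
        ultimately show "T u \<in> smooth_gen \<inter> test_functions UNIV" by simp
      next
        fix u v :: "real^'n \<Rightarrow> real" and x assume "u \<in> square_int N" "v \<in> square_int N"
        then show "T (\<lambda>x. u x - v x) x = T u x - T v x"
          by (simp add: T_def c_def mollified_diff left_diff_distrib sum_subtractf)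
      next
        fix u :: "real^'n \<Rightarrow> real" and x assume u: "u \<in> square_int N" and x: "x \<in> \<Omega>"
        obtain J where J: "J \<ge> 0" "local_energy \<Omega> u x (C\<^sub>1 * \<rho>) = ennreal J" using energy[OF u] by blast
        have cq: "\<bar>c u q\<bar> \<le> sqrt (J / (\<kappa> * \<rho> ^ CARD('n)))" if "q \<in> Q x" for q
          unfolding c_def cs[symmetric]
        proof (rule mollified_bound[OF u _ J(1) s])
          show "(\<integral>\<^sup>+y. ennreal ((u y)\<^sup>2) * indicator (ball x (C\<^sub>1 * \<rho>)) y \<partial>N) \<le> ennreal J"
            using J(2) by (simp add: local_energy_def)
          show "ball (anchor q) (?n * s) \<subseteq> ball x (C\<^sub>1 * \<rho>)"
          proof
            fix y assume "y \<in> ball (anchor q) (?n * s)"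
            then have "dist (anchor q) y < \<theta> * \<rho> / 2" by (simp add: ns)
            then show "y \<in> ball x (C\<^sub>1 * \<rho>)"
              using dist_triangle[of x y "anchor q"] anchor(3)[OF x, of q] that Q(2) C1\<rho> C0\<rho>
              by (simp add: dist_commute subset_iff)
          qed
        qed
        have "\<bar>T u x\<bar> \<le> (\<Sum>q\<in>Q x. \<bar>c u q * cell \<rho> q x\<bar>)" unfolding T_def restr by (rule sum_abs)
        also have "\<dots> \<le> (\<Sum>q\<in>Q x. sqrt (J / (\<kappa> * \<rho> ^ CARD('n))) * cell \<rho> q x)"
          using cq by (intro sum_mono) (simp add: abs_mult cell_nonneg mult_right_mono)
        also have "\<dots> = sqrt (J / (\<kappa> * \<rho> ^ CARD('n)))" by (simp add: sum_distrib_left[symmetric] Q1[OF x])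
        finally have "\<bar>T u x\<bar>\<^sup>2 \<le> (sqrt (J / (\<kappa> * \<rho> ^ CARD('n))))\<^sup>2" by (intro power_mono) auto
        also have "\<dots> = 1 / \<kappa> * (J / \<rho> ^ CARD('n))" using J(1) \<kappa> \<rho> by simp
        finally have "(T u x)\<^sup>2 \<le> 1 / \<kappa> * (J / \<rho> ^ CARD('n))" by simp
        then show "ennreal ((T u x)\<^sup>2) \<le> ennreal (C / \<rho> ^ CARD('n)) * local_energy \<Omega> u x (C * \<rho>)"
          by (rule weaken[OF J(2,1) _ C(3)])
      next
        fix u :: "real^'n \<Rightarrow> real" and g :: "real^'n \<Rightarrow> real^'n" and x assume u: "u \<in> square_int N" and g: "g \<in> square_int N" "is_weak_grad \<Omega> u g" and x: "x \<in> \<Omega>"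
        obtain J where J: "J \<ge> 0" "local_energy \<Omega> g x (C\<^sub>1 * \<rho>) = ennreal J" using energy[OF g(1)] by blast
        let ?A = "sqrt (J / (\<kappa> * \<rho> ^ CARD('n)))"
        have A: "?A \<ge> 0" using J \<kappa> \<rho> by simp
        have osc: "\<bar>c u q - c u q'\<bar> \<le> ?A * (C\<^sub>0 * \<rho>)" if q: "q \<in> Q x" "q' \<in> Q x" for q q'
          unfolding c_def
        proof (rule chain[OF NTA bnd _ _ \<rho>(1), where F = "mollified u s"])
          have qn: "q \<in> near_cells \<rho> x" "q' \<in> near_cells \<rho> x" using q Q by auto
          show "anchor q \<in> \<Omega>" "anchor q' \<in> \<Omega>" using anchor(1)[OF x] qn by auto
          have "\<rho> / L \<le> \<rho> / real M" using \<rho> M by (intro divide_left_mono) (auto simp: L_def)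
          then show "\<rho> / L \<le> bdist \<Omega> (anchor q)" "\<rho> / L \<le> bdist \<Omega> (anchor q')"
            using anchor(2)[OF x] qn by fastforce+
          have "dist (anchor q) (anchor q') \<le> dist (anchor q) x + dist (anchor q') x" by (rule dist_triangle2)
          also have "\<dots> \<le> (4 * ?n + 2) * \<rho> + (4 * ?n + 2) * \<rho>" by (intro add_mono anchor(3)[OF x] qn)
          also have "\<dots> \<le> L * \<rho>" using \<rho> by (simp add: L_def algebra_simps)
          finally show "dist (anchor q) (anchor q') \<le> L * \<rho>" .
          show "0 \<le> ?A" by (rule A)
          fix p p' assume seg: "closed_segment p p' \<subseteq> {w \<in> \<Omega>. \<theta> * \<rho> \<le> bdist \<Omega> w \<and> dist (anchor q) w \<le> C\<^sub>0 * \<rho>}"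
          show "\<bar>mollified u s p - mollified u s p'\<bar> \<le> ?A * dist p p'"
            unfolding cs[symmetric]
          proof (rule mollified_oscillation[OF u g s _ J(1)])
            show "(\<integral>\<^sup>+y. ennreal ((norm (g y))\<^sup>2) * indicator (ball x (C\<^sub>1 * \<rho>)) y \<partial>N) \<le> ennreal J"
              using J(2) by (simp add: local_energy_def)
            fix w assume "w \<in> closed_segment p p'"
            with seg have w: "w \<in> \<Omega>" "\<theta> * \<rho> \<le> bdist \<Omega> w" "dist (anchor q) w \<le> C\<^sub>0 * \<rho>" by auto
            show "cball w (?n * s) \<subseteq> \<Omega>" by (rule sub\<Omega>[OF w(1,2)])
            show "ball w (?n * s) \<subseteq> ball x (C\<^sub>1 * \<rho>)"
            proof
              fix y assume "y \<in> ball w (?n * s)"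
              then have "dist w y < \<theta> * \<rho> / 2" by (simp add: ns)
              moreover have "dist x y \<le> dist x (anchor q) + dist (anchor q) w + dist w y" by (rule dist_triangle_4)
              moreover have "dist x (anchor q) \<le> (4 * ?n + 2) * \<rho>" using anchor(3)[OF x qn(1)] by (simp add: dist_commute)
              ultimately show "y \<in> ball x (C\<^sub>1 * \<rho>)" using w(3) C1\<rho> by simp
            qed
          qed
        qed
        have "Q x \<noteq> {}" using Q1[OF x] by auto
        then obtain q0 where q0: "q0 \<in> Q x" by blast
        \<comment> \<open>The gradients of the cells sum to 0 on \<Omega>, so a reference value may
          be subtracted from all coefficients; only differences of neighbouring values remain, and
          these are controlled by the chains.\<close>
        have "grad (T u) x = (\<Sum>q\<in>Q x. c u q *\<^sub>R grad (cell \<rho> q) x)"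
          using grad_eqI[OF dersum[of "c u" x]] unfolding restrg T_def[abs_def] .
        also have "\<dots> = (\<Sum>q\<in>Q x. (c u q - c u q0) *\<^sub>R grad (cell \<rho> q) x) + c u q0 *\<^sub>R (\<Sum>q\<in>Q x. grad (cell \<rho> q) x)"
          by (simp add: scaleR_sum_right sum.distrib[symmetric] scaleR_left_diff_distrib)
        also have "\<dots> = (\<Sum>q\<in>Q x. (c u q - c u q0) *\<^sub>R grad (cell \<rho> q) x)" by (simp add: Qg[OF x])
        finally have "norm (grad (T u) x) \<le> (\<Sum>q\<in>Q x. norm ((c u q - c u q0) *\<^sub>R grad (cell \<rho> q) x))"
          by (simp only: norm_sum)
        also have "\<dots> \<le> (\<Sum>q\<in>Q x. (?A * (C\<^sub>0 * \<rho>)) * (Lc / \<rho>))"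
          unfolding norm_scaleR using osc q0 Lc \<rho> A C\<^sub>0
          by (intro sum_mono mult_mono) (auto intro!: mult_nonneg_nonneg)
        also have "\<dots> = real (card (Q x)) * (?A * C\<^sub>0 * Lc)" using \<rho> by simp
        also have "\<dots> \<le> 3 ^ CARD('n) * (?A * C\<^sub>0 * Lc)"
          using A C\<^sub>0 Lc by (intro mult_right_mono cardQ) auto
        also have "\<dots> = D * ?A" by (simp add: D_def)
        finally have "(norm (grad (T u) x))\<^sup>2 \<le> (D * ?A)\<^sup>2" by (intro power_mono) auto
        also have "\<dots> = D\<^sup>2 / \<kappa> * (J / \<rho> ^ CARD('n))" using J(1) \<kappa> \<rho> by (simp add: power_mult_distrib)
        finally show "ennreal ((norm (grad (T u) x))\<^sup>2) \<le> ennreal (C / \<rho> ^ CARD('n)) * local_energy \<Omega> g x (C * \<rho>)"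
          by (rule weaken[OF J(2,1) _ C(4)])
      next
        fix v :: "real^'n \<Rightarrow> real" and e x assume v: "v \<in> square_int N" and e: "e \<ge> 0" and x: "x \<in> \<Omega>"
          and close: "\<forall>y. dist x y \<le> C * \<rho> \<longrightarrow> \<bar>v y - v x\<bar> \<le> e"
        have cq: "\<bar>c v q - v x\<bar> \<le> e" if "q \<in> Q x" for q
          unfolding c_def
        proof (rule mollified_approx[OF v s _ _ e])
          have q: "q \<in> near_cells \<rho> x" using that Q by auto
          show "cball (anchor q) (?n * s) \<subseteq> \<Omega>" by (rule anchor_sub[OF x q])
          fix y assume "dist (anchor q) y \<le> ?n * s"
          then have "dist x y \<le> C\<^sub>1 * \<rho>"
            using dist_triangle[of x y "anchor q"] anchor(3)[OF x q] C1\<rho> C0\<rho> by (simp add: ns dist_commute)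
          also have "\<dots> \<le> C * \<rho>" using C(2) \<rho> by simp
          finally show "\<bar>v y - v x\<bar> \<le> e" using close by blast
        qed
        have "T v x - v x = (\<Sum>q\<in>Q x. (c v q - v x) * cell \<rho> q x)"
          using Q1[OF x] by (simp add: T_def restr left_diff_distrib sum_subtractf sum_distrib_left[symmetric])
        also have "\<bar>\<dots>\<bar> \<le> (\<Sum>q\<in>Q x. \<bar>(c v q - v x) * cell \<rho> q x\<bar>)" by (rule sum_abs)
        also have "\<dots> \<le> (\<Sum>q\<in>Q x. e * cell \<rho> q x)"
          using cq by (intro sum_mono) (simp add: abs_mult cell_nonneg mult_right_mono)
        also have "\<dots> = e" by (simp add: sum_distrib_left[symmetric] Q1[OF x])
        finally show "\<bar>T v x - v x\<bar> \<le> e" .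
      qed
    qed
  qed
qed

section \<open>From weak to strong approximation\<close>

context bounded_open
begin

lemma square_int_inner:
  fixes f g :: "real^'n \<Rightarrow> 'b::euclidean_space"
  assumes "f \<in> square_int N" "g \<in> square_int N" shows "integrable N (\<lambda>x. f x \<bullet> g x)"
proof -
  have [measurable]: "f \<in> borel_measurable N" "g \<in> borel_measurable N"
    using assms by (auto simp: square_int_def)
  have m: "(\<lambda>x. f x \<bullet> g x) \<in> borel_measurable N" by measurable
  have "integrable N (\<lambda>x. norm (f x) * norm (g x))"
    by (rule integrable_mult_square) (use assms in \<open>auto simp: square_int_def\<close>)
  then show ?thesis
    by (rule Bochner_Integration.integrable_bound[OF _ m]) (auto intro!: AE_I2 Cauchy_Schwarz_ineq2)
qed

lemma integral_norm_convex_combination: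
  fixes f g :: "real^'n \<Rightarrow> 'b::euclidean_space"
  assumes f: "f \<in> square_int N" and g: "g \<in> square_int N"
  shows "(\<integral>x. (norm ((1 - t) *\<^sub>R f x + t *\<^sub>R g x))\<^sup>2 \<partial>N)
    = (1 - t)\<^sup>2 * (\<integral>x. (norm (f x))\<^sup>2 \<partial>N) + 2 * t * (1 - t) * (\<integral>x. f x \<bullet> g x \<partial>N)
      + t\<^sup>2 * (\<integral>x. (norm (g x))\<^sup>2 \<partial>N)"
proof -
  have i: "integrable N (\<lambda>x. (norm (f x))\<^sup>2)" "integrable N (\<lambda>x. (norm (g x))\<^sup>2)"
    using f g by (auto simp: square_int_def)
  have "(norm ((1 - t) *\<^sub>R a + t *\<^sub>R b))\<^sup>2 = (1 - t)\<^sup>2 * (norm a)\<^sup>2 + 2 * t * (1 - t) * (a \<bullet> b) + t\<^sup>2 * (norm b)\<^sup>2"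
    for a b :: 'b
    unfolding power2_norm_eq_inner
    by (simp add: inner_add_left inner_add_right inner_commute[of b a] power2_eq_square algebra_simps)
  then show ?thesis
    using i square_int_inner[OF f g] by simp
qed

lemma L2_Cauchy_Schwarz:
  fixes f g :: "real^'n \<Rightarrow> real"
  assumes "f \<in> square_int N" "g \<in> square_int N"
  shows "\<bar>\<integral>x. f x * g x \<partial>N\<bar> \<le> sqrt (\<integral>x. (f x)\<^sup>2 \<partial>N) * sqrt (\<integral>x. (g x)\<^sup>2 \<partial>N)"
proof -
  have "(\<integral>x. f x * g x \<partial>N)\<^sup>2 \<le> (\<integral>x. (f x)\<^sup>2 \<partial>N) * (\<integral>x. (g x)\<^sup>2 \<partial>N)"
    using assms by (intro integral_Cauchy_Schwarz) (auto simp: square_int_def)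
  from real_sqrt_le_mono[OF this] show ?thesis by (simp add: real_sqrt_mult)
qed

lemma tendsto_inner_strong:
  fixes h :: "real^'n \<Rightarrow> real" and F :: "nat \<Rightarrow> real^'n \<Rightarrow> real"
  assumes h: "h \<in> square_int N" and F: "\<And>j. F j \<in> square_int N"
    and lim: "(\<lambda>j. \<integral>x. (F j x)\<^sup>2 \<partial>N) \<longlonglongrightarrow> 0"
  shows "(\<lambda>j. \<integral>x. h x * F j x \<partial>N) \<longlonglongrightarrow> 0"
proof (rule Lim_null_comparison)
  show "\<forall>\<^sub>F j in sequentially. norm (\<integral>x. h x * F j x \<partial>N)
      \<le> sqrt (\<integral>x. (h x)\<^sup>2 \<partial>N) * sqrt (\<integral>x. (F j x)\<^sup>2 \<partial>N)"
    using L2_Cauchy_Schwarz[OF h F] by simp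
  have "(\<lambda>j. sqrt (\<integral>x. (h x)\<^sup>2 \<partial>N) * sqrt (\<integral>x. (F j x)\<^sup>2 \<partial>N)) \<longlonglongrightarrow> sqrt (\<integral>x. (h x)\<^sup>2 \<partial>N) * sqrt 0"
    by (intro tendsto_intros lim)
  then show "(\<lambda>j. sqrt (\<integral>x. (h x)\<^sup>2 \<partial>N) * sqrt (\<integral>x. (F j x)\<^sup>2 \<partial>N)) \<longlonglongrightarrow> 0" by simp
qed

lemma grad_convex_combination:
  assumes "v \<in> smooth_gen" "w \<in> smooth_gen"
  shows "grad (\<lambda>x. (1 - t) * v x + t * w x) x = (1 - t) *\<^sub>R grad v x + t *\<^sub>R grad w x"
  by (rule grad_eqI)
    (use has_derivative_grad[OF smooth_gen_differentiable[OF assms(1)], of x]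
        has_derivative_grad[OF smooth_gen_differentiable[OF assms(2)], of x] in
      \<open>auto intro!: derivative_eq_intros simp: inner_add_right\<close>)

lemma smooth_test_square_int:
  assumes "v \<in> smooth_gen" shows "v \<in> square_int N" "grad v \<in> square_int N"
proof -
  have "C_k (Suc 0) v" by (rule smooth_gen_C_k[OF assms])
  then show "v \<in> square_int N" "grad v \<in> square_int N"
    using C1_continuous by (auto intro: square_int_continuous)
qed

lemma test_functions_convex:
  assumes v: "v \<in> smooth_gen \<inter> test_functions UNIV" and w: "w \<in> smooth_gen \<inter> test_functions UNIV"
  shows "(\<lambda>x. (1 - t) * v x + t * w x) \<in> smooth_gen \<inter> test_functions UNIV"
proof -
  have sm: "(\<lambda>x. (1 - t) * v x + t * w x) \<in> smooth_gen"
    using v w by (intro smooth_gen.add smooth_gen_cmult) auto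
  let ?K = "closure {x. v x \<noteq> 0} \<union> closure {x. w x \<noteq> 0}"
  have "(\<lambda>x. (1 - t) * v x + t * w x) \<in> test_functions UNIV"
  proof (rule smooth_gen_test_function[OF sm, of ?K])
    show "compact ?K" using v w by (auto simp: test_functions_def)
    show "{x. (1 - t) * v x + t * w x \<noteq> 0} \<subseteq> ?K"
    proof
      fix x assume "x \<in> {x. (1 - t) * v x + t * w x \<noteq> 0}"
      then have "x \<in> {x. v x \<noteq> 0} \<or> x \<in> {x. w x \<noteq> 0}" by auto
      then show "x \<in> ?K"
        using subsetD[OF closure_subset, of x "{x. v x \<noteq> 0}"] subsetD[OF closure_subset, of x "{x. w x \<noteq> 0}"] by blast
    qed
  qed simp
  with sm show ?thesis by simp
qed

text \<open>A bounded sequence converging weakly in \<open>W\<^sup>1\<^sup>,\<^sup>2\<close> suffices: if the smallest energy distance from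
  \<open>u\<close> to a test function were positive, moving a near-minimiser slightly towards a late member of
  the sequence would reduce it.\<close>

lemma strong_approximation_from_weak:
  assumes u: "u \<in> square_int N" and g: "g \<in> square_int N" "is_weak_grad \<Omega> u g"
    and v: "\<And>j. v j \<in> smooth_gen \<inter> test_functions UNIV"
    and lim: "(\<lambda>j. \<integral>x. (v j x - u x)\<^sup>2 \<partial>N) \<longlonglongrightarrow> 0"
    and bd: "\<And>j. (\<integral>x. (norm (grad (v j) x - g x))\<^sup>2 \<partial>N) \<le> B" and e: "e > 0"
  shows "\<exists>w \<in> smooth_gen \<inter> test_functions UNIV.
    (\<integral>x. (w x - u x)\<^sup>2 \<partial>N) + (\<integral>x. (norm (grad w x - g x))\<^sup>2 \<partial>N) < e"
proof (rule ccontr)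
  define E where "E w = (\<integral>x. (norm (w x - u x))\<^sup>2 \<partial>N) + (\<integral>x. (norm (grad w x - g x))\<^sup>2 \<partial>N)" for w
  let ?S = "smooth_gen \<inter> test_functions UNIV :: (real^'n \<Rightarrow> real) set"
  assume "\<not> (\<exists>w \<in> ?S. (\<integral>x. (w x - u x)\<^sup>2 \<partial>N) + (\<integral>x. (norm (grad w x - g x))\<^sup>2 \<partial>N) < e)"
  then have Ee: "E w \<ge> e" if "w \<in> ?S" for w using that by (force simp: E_def)
  \<comment> \<open>The infimum of the squared energy distance need not be attained; it is positive
    by the assumption made for contradiction, and a near-minimiser will do.\<close>
  define I where "I = Inf (E ` ?S)"
  have bb: "bdd_below (E ` ?S)" using Ee by (intro bdd_belowI2)
  have Ile: "I \<le> E w" if "w \<in> ?S" for w unfolding I_def using that bb by (intro cInf_lower) auto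
  have ne: "E ` ?S \<noteq> {}" using v by blast
  have "I \<ge> e" unfolding I_def using ne Ee by (intro cInf_greatest) auto
  with e have I: "I > 0" by simp
  have vs: "v j \<in> square_int N" "grad (v j) \<in> square_int N" for j
    using smooth_test_square_int[of "v j"] v by auto
  have vu: "(\<lambda>x. v j x - u x) \<in> square_int N" "(\<lambda>x. grad (v j) x - g x) \<in> square_int N" for j
    by (intro square_int_diff vs u g)+
  have lim': "(\<lambda>j. \<integral>x. (norm (v j x - u x))\<^sup>2 \<partial>N) \<longlonglongrightarrow> 0" using lim by simp
  obtain B' where B': "\<And>j. (\<integral>x. (norm (v j x - u x))\<^sup>2 \<partial>N) \<le> B'"
  proof -
    have "Bseq (\<lambda>j. \<integral>x. (norm (v j x - u x))\<^sup>2 \<partial>N)" using lim' by (rule convergent_imp_Bseq[OF convergentI])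
    then obtain K where K: "\<forall>j. norm (\<integral>x. (norm (v j x - u x))\<^sup>2 \<partial>N) \<le> K" by (rule BseqE)
    have "(\<integral>x. (norm (v j x - u x))\<^sup>2 \<partial>N) \<le> K" for j using K[rule_format, of j] by simp
    then show ?thesis by (rule that)
  qed
  define P where "P = B' + B"
  have EP: "E (v j) \<le> P" for j unfolding E_def P_def by (intro add_mono B' bd)
  have P0: "P \<ge> 0" using EP[of 0] Ile[OF v, of 0] I by linarith
  \<comment> \<open>This minimises (1 - t)^2 I + t^2 P, with value I - tI. The near-minimiser and
    the cross term each lose at most tI/4, so a gain of tI/2 is left.\<close>
  define t where "t = I / (I + P)"
  have t: "t > 0" "t \<le> 1" using I P0 by (auto simp: t_def)
  have tIP: "t * (I + P) = I" using I P0 by (simp add: t_def)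
  obtain w where w: "w \<in> ?S" "E w < I + t * I / 4"
  proof -
    have "Inf (E ` ?S) < I + t * I / 4" using I t by (simp add: I_def[symmetric])
    then show ?thesis using that cInf_lessD[OF ne] by blast
  qed
  have ws: "w \<in> square_int N" "grad w \<in> square_int N" using smooth_test_square_int[of w] w by auto
  have wu: "(\<lambda>x. w x - u x) \<in> square_int N" "(\<lambda>x. grad w x - g x) \<in> square_int N"
    by (intro square_int_diff ws u g)+
  define ip where "ip j = (\<integral>x. (w x - u x) \<bullet> (v j x - u x) \<partial>N) + (\<integral>x. (grad w x - g x) \<bullet> (grad (v j) x - g x) \<partial>N)" for j
  \<comment> \<open>Against a test function the derivative can be moved away from the difference,
    where convergence in L2 suffices; density of test functions and the uniform bound
    \<open>B\<close> extend this to every square integrable \<open>h\<close>.\<close>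
  have weak: "(\<lambda>j. \<integral>x. h x * (grad (v j) x - g x) $ i \<partial>N) \<longlonglongrightarrow> 0" if h: "h \<in> square_int N" for h i
  proof (rule LIMSEQ_I)
    fix \<eta> :: real assume \<eta>: "\<eta> > 0"
    have "0 \<le> (\<integral>x. (norm (grad (v 0) x - g x))\<^sup>2 \<partial>N)" by simp
    with bd[of 0] have B0: "B \<ge> 0" by linarith
    let ?Fj = "\<lambda>j x. (grad (v j) x - g x) $ i"
    have Fj: "?Fj j \<in> square_int N" for j by (intro square_int_nth vu)
    have FjB: "(\<integral>x. (?Fj j x)\<^sup>2 \<partial>N) \<le> B" for j
    proof -
      have "(\<integral>x. (?Fj j x)\<^sup>2 \<partial>N) \<le> (\<integral>x. (norm (grad (v j) x - g x))\<^sup>2 \<partial>N)"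
      proof (intro integral_mono)
        show "integrable N (\<lambda>x. (?Fj j x)\<^sup>2)" using Fj[of j] by (simp add: square_int_def)
        show "integrable N (\<lambda>x. (norm (grad (v j) x - g x))\<^sup>2)" using vu(2)[of j] by (simp add: square_int_def)
        show "(?Fj j x)\<^sup>2 \<le> (norm (grad (v j) x - g x))\<^sup>2" for x
          using power_mono[OF component_le_norm_cart[of "grad (v j) x - g x" i], of 2] by simp
      qed
      with bd[of j] show ?thesis by linarith
    qed
    \<comment> \<open>The accuracy is chosen so that, multiplied by the square root of
      \<open>B\<close>, it stays below \<eta> / 2; the added 1 avoids division by zero.\<close>
    have pos: "(\<eta> / (2 * (sqrt B + 1)))\<^sup>2 > 0" using \<eta> B0 by (simp add: add_nonneg_eq_0_iff)
    obtain \<phi> where \<phi>: "\<phi> \<in> smooth_gen" "\<phi> \<in> test_functions \<Omega>" "(\<integral>x. (h x - \<phi> x)\<^sup>2 \<partial>N) < (\<eta> / (2 * (sqrt B + 1)))\<^sup>2"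
      using test_functions_dense_L2[OF h pos] by blast
    note \<phi>s = test_function_square_int[OF \<phi>(2)]
    have "is_weak_grad \<Omega> (\<lambda>x. v j x - u x) (\<lambda>x. grad (v j) x - g x)" for j
      using v[of j] by (intro is_weak_grad_diff vs u g is_weak_grad_C1 smooth_gen_C_k) auto
    from is_weak_gradD[OF this \<phi>(2)]
    have by_parts: "(\<integral>x. \<phi> x * ?Fj j x \<partial>N) = - (\<integral>x. partial_deriv i \<phi> x * (v j x - u x) \<partial>N)" for j
      by (simp add: mult.commute)
    have "(\<lambda>j. - (\<integral>x. partial_deriv i \<phi> x * (v j x - u x) \<partial>N)) \<longlonglongrightarrow> - 0"
      by (intro tendsto_minus tendsto_inner_strong \<phi>s vu(1) lim)
    then have "(\<lambda>j. \<integral>x. \<phi> x * ?Fj j x \<partial>N) \<longlonglongrightarrow> 0"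
      unfolding by_parts by simp
    from LIMSEQ_D[OF this, of "\<eta> / 2"] \<eta> obtain j0 where j0: "\<And>j. j \<ge> j0 \<Longrightarrow> \<bar>\<integral>x. \<phi> x * ?Fj j x \<partial>N\<bar> < \<eta> / 2"
      by auto
    show "\<exists>j0. \<forall>j\<ge>j0. norm ((\<integral>x. h x * ?Fj j x \<partial>N) - 0) < \<eta>"
    proof (intro exI allI impI)
      fix j assume j: "j \<ge> j0"
      have hd: "(\<lambda>x. h x - \<phi> x) \<in> square_int N" by (intro square_int_diff h \<phi>s)
      have "(\<integral>x. h x * ?Fj j x \<partial>N) = (\<integral>x. (h x - \<phi> x) * ?Fj j x + \<phi> x * ?Fj j x \<partial>N)"
        by (simp add: left_diff_distrib)
      also have "\<dots> = (\<integral>x. (h x - \<phi> x) * ?Fj j x \<partial>N) + (\<integral>x. \<phi> x * ?Fj j x \<partial>N)"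
        by (intro Bochner_Integration.integral_add square_int_mult hd Fj \<phi>s)
      finally have eq: "(\<integral>x. h x * ?Fj j x \<partial>N) = (\<integral>x. (h x - \<phi> x) * ?Fj j x \<partial>N) + (\<integral>x. \<phi> x * ?Fj j x \<partial>N)" .
      have "\<bar>\<integral>x. (h x - \<phi> x) * ?Fj j x \<partial>N\<bar> \<le> sqrt (\<integral>x. (h x - \<phi> x)\<^sup>2 \<partial>N) * sqrt (\<integral>x. (?Fj j x)\<^sup>2 \<partial>N)"
        by (rule L2_Cauchy_Schwarz[OF hd Fj])
      also have "\<dots> \<le> (\<eta> / (2 * (sqrt B + 1))) * sqrt B"
      proof (intro mult_mono)
        show "sqrt (\<integral>x. (h x - \<phi> x)\<^sup>2 \<partial>N) \<le> \<eta> / (2 * (sqrt B + 1))"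
          using \<phi>(3) \<eta> B0 by (intro real_le_lsqrt) auto
        show "sqrt (\<integral>x. (?Fj j x)\<^sup>2 \<partial>N) \<le> sqrt B" using FjB by (rule real_sqrt_le_mono)
      qed (use \<eta> B0 in auto)
      also have "\<dots> \<le> \<eta> / 2"
      proof -
        have "\<eta> * sqrt B \<le> \<eta> / 2 * (2 * (sqrt B + 1))" using \<eta> by (simp add: distrib_left)
        moreover have "2 * (sqrt B + 1) > 0" using B0 by (simp add: add_nonneg_pos)
        ultimately have "\<eta> * sqrt B / (2 * (sqrt B + 1)) \<le> \<eta> / 2" by (simp only: pos_divide_le_eq)
        then show ?thesis by simp
      qed
      finally show "norm ((\<integral>x. h x * ?Fj j x \<partial>N) - 0) < \<eta>" using j0[OF j] eq by simp
    qed
  qed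
  have "ip \<longlonglongrightarrow> 0 + (\<Sum>i\<in>(UNIV :: 'n set). 0)"
    unfolding ip_def
  proof (intro tendsto_add)
    show "(\<lambda>j. \<integral>x. (w x - u x) \<bullet> (v j x - u x) \<partial>N) \<longlonglongrightarrow> 0"
      unfolding inner_real_def by (intro tendsto_inner_strong wu vu(1) lim)
    have "(\<integral>x. (grad w x - g x) \<bullet> (grad (v j) x - g x) \<partial>N)
        = (\<Sum>i\<in>UNIV. \<integral>x. (grad w x - g x) $ i * (grad (v j) x - g x) $ i \<partial>N)" for j
      unfolding inner_vec_def inner_real_def
      by (intro Bochner_Integration.integral_sum square_int_mult square_int_nth wu vu)
    moreover have "(\<lambda>j. \<Sum>i\<in>UNIV. \<integral>x. (grad w x - g x) $ i * (grad (v j) x - g x) $ i \<partial>N) \<longlonglongrightarrow> (\<Sum>i\<in>(UNIV :: 'n set). 0)"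
      by (intro tendsto_sum weak square_int_nth wu)
    ultimately show "(\<lambda>j. \<integral>x. (grad w x - g x) \<bullet> (grad (v j) x - g x) \<partial>N) \<longlonglongrightarrow> (\<Sum>i\<in>(UNIV :: 'n set). 0)" by simp
  qed
  then have "ip \<longlonglongrightarrow> 0" by simp
  from LIMSEQ_D[OF this, of "t * I / 8"] I t obtain j where j: "\<bar>ip j\<bar> < t * I / 8" by auto
  define y where "y x = (1 - t) * w x + t * v j x" for x
  have yS: "y \<in> ?S" unfolding y_def[abs_def] by (intro test_functions_convex w v)
  have gy: "grad y x - g x = (1 - t) *\<^sub>R (grad w x - g x) + t *\<^sub>R (grad (v j) x - g x)" for x
  proof -
    have "grad y x = (1 - t) *\<^sub>R grad w x + t *\<^sub>R grad (v j) x"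
      unfolding y_def[abs_def] using w v[of j] by (intro grad_convex_combination) auto
    then show ?thesis by (simp add: algebra_simps)
  qed
  have uy: "y x - u x = (1 - t) *\<^sub>R (w x - u x) + t *\<^sub>R (v j x - u x)" for x
    by (simp add: y_def algebra_simps)
  have "E y = (1 - t)\<^sup>2 * E w + 2 * t * (1 - t) * ip j + t\<^sup>2 * E (v j)"
    unfolding E_def ip_def gy uy
      integral_norm_convex_combination[OF wu(1) vu(1)] integral_norm_convex_combination[OF wu(2) vu(2)]
    by (simp add: algebra_simps)
  also have "(1 - t)\<^sup>2 * E w \<le> (1 - t)\<^sup>2 * I + t * I / 4"
  proof -
    have "(1 - t)\<^sup>2 * E w \<le> (1 - t)\<^sup>2 * (I + t * I / 4)" using w by (intro mult_left_mono) auto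
    moreover have "(1 - t)\<^sup>2 * (t * I / 4) \<le> 1 * (t * I / 4)"
      using t I by (intro mult_right_mono) (auto simp: power_le_one)
    ultimately show ?thesis by (simp add: distrib_left)
  qed
  also have "2 * t * (1 - t) * ip j \<le> t * I / 4"
  proof -
    have "t * (1 - t) \<le> 1 * 1" using t by (intro mult_mono) auto
    then have "t * (1 - t) * ip j \<le> 1 * \<bar>ip j\<bar>"
      using t by (intro order_trans[OF mult_left_mono[OF abs_ge_self] mult_right_mono]) auto
    then show ?thesis using j by linarith
  qed
  also have "t\<^sup>2 * E (v j) \<le> t\<^sup>2 * P" using EP by (intro mult_left_mono) auto
  also have "(1 - t)\<^sup>2 * I + t * I / 4 + t * I / 4 + t\<^sup>2 * P = I - 2 * (t * I) + t * (t * (I + P)) + t * I / 2"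
    by (simp add: power2_eq_square algebra_simps)
  also have "\<dots> = I - t * I / 2" by (simp add: tIP)
  also have "\<dots> < I" using t I by simp
  finally have "E y < I" by simp
  with Ile[OF yS] show False by simp
qed

section \<open>Bounds uniform in the scale and density\<close>

lemma nn_integral_local_energy_le:
  fixes f :: "real^'n \<Rightarrow> 'b::euclidean_space"
  assumes f: "f \<in> square_int N" and R: "R > 0"
  shows "(\<integral>\<^sup>+x. local_energy \<Omega> f x R \<partial>N)
    \<le> ennreal (unit_ball_volume TYPE('n) * R ^ CARD('n) * (\<integral>x. (norm (f x))\<^sup>2 \<partial>N))"
proof -
  have [measurable]: "f \<in> borel_measurable N" and i: "integrable N (\<lambda>x. (norm (f x))\<^sup>2)"
    using f by (auto simp: square_int_def)
  have sN: "sigma_finite_measure N" by unfold_locales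
  have "(\<integral>\<^sup>+x. local_energy \<Omega> f x R \<partial>N) = (\<integral>\<^sup>+x. local_energy \<Omega> f x R * indicator \<Omega> x \<partial>lborel)"
    by (rule nn_integral_lebesgue_on_open[OF op])
  also have "\<dots> \<le> (\<integral>\<^sup>+x. local_energy \<Omega> f x R \<partial>lborel)"
    by (intro nn_integral_mono) (auto simp: indicator_def)
  also have "\<dots> \<le> ennreal (unit_ball_volume TYPE('n) * R ^ CARD('n)) * (\<integral>\<^sup>+x. ennreal ((norm (f x))\<^sup>2) \<partial>N)"
    unfolding local_energy_def
    by (rule nn_integral_ball_le[OF _ _ sN sets_N])
      (simp_all add: emeasure_lborel_ball[OF R] lborel.sigma_finite_measure_axioms)
  also have "\<dots> = ennreal (unit_ball_volume TYPE('n) * R ^ CARD('n) * (\<integral>x. (norm (f x))\<^sup>2 \<partial>N))"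
    using i R less_imp_le[OF unit_ball_volume_pos[where 'n='n]]
    by (simp add: nn_integral_eq_integral ennreal_mult)
  finally show ?thesis .
qed

text \<open>Integrating local energies over balls of radius C\<rho> costs the volume of such a ball,
  which cancels the factor \<rho>^(-n). The resulting constant does not depend on \<rho>.\<close>

lemma integral_le_of_local_energy:
  fixes f :: "real^'n \<Rightarrow> 'b::euclidean_space" and F :: "real^'n \<Rightarrow> 'c::euclidean_space"
  assumes f: "f \<in> square_int N" and F: "F \<in> square_int N" and \<rho>: "\<rho> > 0" and C: "C > 0"
    and le: "\<And>x. x \<in> \<Omega> \<Longrightarrow> ennreal ((norm (F x))\<^sup>2) \<le> ennreal (C / \<rho> ^ CARD('n)) * local_energy \<Omega> f x (C * \<rho>)"
  shows "(\<integral>x. (norm (F x))\<^sup>2 \<partial>N) \<le> C * unit_ball_volume TYPE('n) * C ^ CARD('n) * (\<integral>x. (norm (f x))\<^sup>2 \<partial>N)"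
proof -
  let ?\<omega> = "unit_ball_volume TYPE('n)" and ?A = "\<integral>x. (norm (f x))\<^sup>2 \<partial>N"
  have \<omega>: "?\<omega> > 0" by (rule unit_ball_volume_pos)
  have [measurable]: "f \<in> borel_measurable N" using f by (auto simp: square_int_def)
  have sN: "sigma_finite_measure N" by unfold_locales
  have fm: "(\<lambda>y. ennreal ((norm (f y))\<^sup>2)) \<in> borel_measurable N" by measurable
  have "(\<lambda>x. local_energy \<Omega> f x (C * \<rho>)) \<in> borel_measurable (borel :: (real^'n) measure)"
    unfolding local_energy_def
    by (rule borel_measurable_nn_integral_ball[OF refl sN sets_N fm])
  then have m: "(\<lambda>x. local_energy \<Omega> f x (C * \<rho>)) \<in> borel_measurable N" by (rule borel_measurable_lebesgue_on)
  have i: "integrable N (\<lambda>x. (norm (F x))\<^sup>2)" using F by (auto simp: square_int_def)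
  have "ennreal (\<integral>x. (norm (F x))\<^sup>2 \<partial>N) = (\<integral>\<^sup>+x. ennreal ((norm (F x))\<^sup>2) \<partial>N)"
    using i by (simp add: nn_integral_eq_integral)
  also have "\<dots> \<le> (\<integral>\<^sup>+x. ennreal (C / \<rho> ^ CARD('n)) * local_energy \<Omega> f x (C * \<rho>) \<partial>N)"
    using le by (intro nn_integral_mono) simp
  also have "\<dots> = ennreal (C / \<rho> ^ CARD('n)) * (\<integral>\<^sup>+x. local_energy \<Omega> f x (C * \<rho>) \<partial>N)"
    by (rule nn_integral_cmult[OF m])
  also have "\<dots> \<le> ennreal (C / \<rho> ^ CARD('n)) * ennreal (?\<omega> * (C * \<rho>) ^ CARD('n) * ?A)"
    using C \<rho> by (intro mult_left_mono nn_integral_local_energy_le f) auto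
  also have "\<dots> = ennreal (C / \<rho> ^ CARD('n) * (?\<omega> * (C * \<rho>) ^ CARD('n) * ?A))"
    using C \<rho> by (simp add: ennreal_mult'[symmetric])
  also have "C / \<rho> ^ CARD('n) * (?\<omega> * (C * \<rho>) ^ CARD('n) * ?A) = C * ?\<omega> * C ^ CARD('n) * ?A"
    using \<rho> by (simp add: power_mult_distrib)
  finally show ?thesis
    using C \<omega> by (subst (asm) ennreal_le_iff) auto
qed

lemma integral_square_sum3_le:
  fixes a b c :: "real^'n \<Rightarrow> real"
  assumes "a \<in> square_int N" "b \<in> square_int N" "c \<in> square_int N"
  shows "(\<integral>x. (a x + b x + c x)\<^sup>2 \<partial>N) \<le> 3 * (\<integral>x. (a x)\<^sup>2 \<partial>N) + 3 * (\<integral>x. (b x)\<^sup>2 \<partial>N) + 3 * (\<integral>x. (c x)\<^sup>2 \<partial>N)"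
proof -
  have i: "integrable N (\<lambda>x. (a x)\<^sup>2)" "integrable N (\<lambda>x. (b x)\<^sup>2)" "integrable N (\<lambda>x. (c x)\<^sup>2)"
    using assms by (auto simp: square_int_def)
  have "(\<lambda>x. a x + b x + c x) \<in> square_int N" by (intro square_int_add assms)
  then have "integrable N (\<lambda>x. (a x + b x + c x)\<^sup>2)" by (simp add: square_int_def)
  moreover have "(a x + b x + c x)\<^sup>2 \<le> 3 * (a x)\<^sup>2 + 3 * (b x)\<^sup>2 + 3 * (c x)\<^sup>2" for x
    using zero_le_power2[of "a x - b x"] zero_le_power2[of "b x - c x"] zero_le_power2[of "a x - c x"]
    by (simp add: power2_eq_square algebra_simps)
  ultimately have "(\<integral>x. (a x + b x + c x)\<^sup>2 \<partial>N) \<le> (\<integral>x. 3 * (a x)\<^sup>2 + 3 * (b x)\<^sup>2 + 3 * (c x)\<^sup>2 \<partial>N)"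
    using i by (intro integral_mono) auto
  then show ?thesis using i by simp
qed

end

text \<open>The approximants at scales tending to 0 have bounded energy. Their convergence in L2 is
  checked on a test function first, where Lipschitz continuity makes the error of order \<rho>, and
  then transferred to \<open>u\<close> by the uniform L2 bound applied to the difference.\<close>

theorem test_functions_dense_W12:
  fixes \<Omega> :: "(real^'n) set" and M :: nat
  assumes NTA: "one_sided_NTA M \<Omega>" and bnd: "bounded \<Omega>" and diam: "diameter \<Omega> > 0"
    and u: "u \<in> W12 \<Omega>" and e: "e > 0"
  shows "\<exists>w \<in> smooth_gen \<inter> test_functions UNIV. (\<integral>x. (w x - u x)\<^sup>2 \<partial>lebesgue_on \<Omega>) +
    (\<integral>x. (norm (grad w x - weak_grad \<Omega> u x))\<^sup>2 \<partial>lebesgue_on \<Omega>) < e"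
proof -
  interpret bounded_open \<Omega>
    using NTA bnd by unfold_locales (auto simp: one_sided_NTA_def)
  have M: "M > 1" using NTA by (simp add: one_sided_NTA_def)
  let ?g = "weak_grad \<Omega> u" and ?\<omega> = "unit_ball_volume TYPE('n)"
  note u' = W12_weak_grad[OF u]
  obtain C where C: "C \<ge> 1" and approx:
    "\<And>\<rho>. 0 < \<rho> \<Longrightarrow> \<rho> \<le> diameter \<Omega> \<Longrightarrow> \<exists>T. lattice_approximant C \<Omega> \<rho> T"
    using lattice_approximation[OF M, where 'n='n] NTA bnd by blast
  define \<rho> where "\<rho> j = diameter \<Omega> / 2 ^ j" for j :: nat
  have \<rho>: "\<rho> j > 0" "\<rho> j \<le> diameter \<Omega>" for j
    using diam divide_left_mono[of 1 "2 ^ j" "diameter \<Omega>"] by (simp_all add: \<rho>_def)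
  have \<rho>0: "\<rho> \<longlonglongrightarrow> 0" unfolding \<rho>_def using LIMSEQ_divide_realpow_zero[of 2 "diameter \<Omega>"] by simp
  have "\<forall>j. \<exists>T. lattice_approximant C \<Omega> (\<rho> j) T" using approx \<rho> by blast
  from choice[OF this] obtain T where T: "\<And>j. lattice_approximant C \<Omega> (\<rho> j) (T j)" by blast
  note T' = T[unfolded lattice_approximant_def]
  have T1: "T j u \<in> smooth_gen \<inter> test_functions UNIV" for j u using T' by blast
  have T2: "T j (\<lambda>x. u x - v x) x = T j u x - T j v x"
    if "u \<in> square_int N" "v \<in> square_int N" for j u v x
    using T'[of j] that by blast
  have T3: "ennreal ((T j u x)\<^sup>2) \<le> ennreal (C / \<rho> j ^ CARD('n)) * local_energy \<Omega> u x (C * \<rho> j)"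
    if "u \<in> square_int N" "x \<in> \<Omega>" for j u x
    using T'[of j] that by blast
  have T4: "ennreal ((norm (grad (T j u) x))\<^sup>2) \<le> ennreal (C / \<rho> j ^ CARD('n)) * local_energy \<Omega> g x (C * \<rho> j)"
    if "u \<in> square_int N" "g \<in> square_int N" "is_weak_grad \<Omega> u g" "x \<in> \<Omega>" for j u g x
    using T'[of j] that by blast
  have T5: "\<bar>T j v x - v x\<bar> \<le> e"
    if "v \<in> square_int N" "e \<ge> 0" "x \<in> \<Omega>" "\<And>y. dist x y \<le> C * \<rho> j \<Longrightarrow> \<bar>v y - v x\<bar> \<le> e" for j v e x
    using T'[of j] that by blast
  have C0: "C > 0" using C by simp
  let ?K = "C * ?\<omega> * C ^ CARD('n)"
  have K: "?K > 0" using C0 unit_ball_volume_pos[where 'n='n] by simp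
  have Ts: "T j v \<in> square_int N" "grad (T j v) \<in> square_int N" for j v
    using smooth_test_square_int[of "T j v"] T1 by auto
  have TL2: "(\<integral>x. (T j v x)\<^sup>2 \<partial>N) \<le> ?K * (\<integral>x. (v x)\<^sup>2 \<partial>N)" if v: "v \<in> square_int N" for j v
    using integral_le_of_local_energy[OF v Ts(1)[of j v] \<rho>(1)[of j] C0] T3[OF v] by simp
  have Tg: "(\<integral>x. (norm (grad (T j u) x))\<^sup>2 \<partial>N) \<le> ?K * (\<integral>x. (norm (?g x))\<^sup>2 \<partial>N)" for j
    by (rule integral_le_of_local_energy[OF u'(2) Ts(2) \<rho>(1) C0 T4[OF u']])
  have lim: "(\<lambda>j. \<integral>x. (T j u x - u x)\<^sup>2 \<partial>N) \<longlonglongrightarrow> 0"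
  proof (rule LIMSEQ_I)
    fix \<eta> :: real assume \<eta>: "\<eta> > 0"
    \<comment> \<open>The error splits into three terms, each with a factor 3 from squaring the sum;
      only the first carries the operator bound.\<close>
    define \<eta>' where "\<eta>' = \<eta> / (9 * (?K + 1))"
    have \<eta>': "\<eta>' > 0" using \<eta> K by (simp add: \<eta>'_def)
    obtain \<phi> where \<phi>: "\<phi> \<in> smooth_gen" "\<phi> \<in> test_functions \<Omega>" "(\<integral>x. (u x - \<phi> x)\<^sup>2 \<partial>N) < \<eta>'"
      using test_functions_dense_L2[OF u'(1) \<eta>'] by blast
    note \<phi>s = test_function_square_int(1)[OF \<phi>(2)]
    obtain B where B: "B \<ge> 0" "\<And>x. norm (grad \<phi> x) \<le> B"
      using bounded_grad[OF test_function_C1[OF \<phi>(2)]] \<phi>(2) by (auto simp: test_functions_def)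
    have lip: "\<bar>\<phi> y - \<phi> x\<bar> \<le> B * dist x y" for x y
    proof -
      have "norm (\<phi> y - \<phi> x) \<le> B * norm (y - x)"
      proof (rule differentiable_bound[of UNIV])
        show "(\<phi> has_derivative (\<lambda>v. v \<bullet> grad \<phi> z)) (at z within UNIV)" for z
          by (intro has_derivative_grad smooth_gen_differentiable \<phi>)
        show "onorm (\<lambda>v. v \<bullet> grad \<phi> z) \<le> B" for z
        proof (rule onorm_le)
          fix v
          have "\<bar>v \<bullet> grad \<phi> z\<bar> \<le> norm v * norm (grad \<phi> z)" by (rule Cauchy_Schwarz_ineq2)
          also have "\<dots> \<le> norm v * B" by (intro mult_left_mono B) auto
          finally show "norm (v \<bullet> grad \<phi> z) \<le> B * norm v" by (simp add: mult.commute)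
        qed
      qed auto
      then show ?thesis by (simp add: dist_norm norm_minus_commute)
    qed
    have close: "\<bar>T j \<phi> x - \<phi> x\<bar> \<le> B * (C * \<rho> j)" if "x \<in> \<Omega>" for j x
    proof (rule T5[OF \<phi>s _ that])
      show "0 \<le> B * (C * \<rho> j)" using B C0 \<rho>(1)[of j] by simp
      show "\<bar>\<phi> y - \<phi> x\<bar> \<le> B * (C * \<rho> j)" if "dist x y \<le> C * \<rho> j" for y
        using lip[of y x] mult_left_mono[OF that B(1)] by linarith
    qed
    have mid: "(\<integral>x. (T j \<phi> x - \<phi> x)\<^sup>2 \<partial>N) \<le> (B * (C * \<rho> j))\<^sup>2 * measure N \<Omega>" for j
    proof -
      have "(\<lambda>x. T j \<phi> x - \<phi> x) \<in> square_int N" by (intro square_int_diff Ts \<phi>s)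
      then have i: "integrable N (\<lambda>x. (T j \<phi> x - \<phi> x)\<^sup>2)" by (simp add: square_int_def)
      have "(\<integral>x. (T j \<phi> x - \<phi> x)\<^sup>2 \<partial>N) \<le> (\<integral>x. (B * (C * \<rho> j))\<^sup>2 \<partial>N)"
      proof (intro integral_mono i)
        fix x assume "x \<in> space N"
        then have "\<bar>T j \<phi> x - \<phi> x\<bar> \<le> \<bar>B * (C * \<rho> j)\<bar>" using close[of x j] by auto
        then show "(T j \<phi> x - \<phi> x)\<^sup>2 \<le> (B * (C * \<rho> j))\<^sup>2" by (simp only: abs_le_square_iff)
      qed simp
      then show ?thesis by (simp add: mult.commute)
    qed
    have "(\<lambda>j. (B * (C * \<rho> j))\<^sup>2 * measure N \<Omega>) \<longlonglongrightarrow> (B * (C * 0))\<^sup>2 * measure N \<Omega>"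
      by (intro tendsto_intros \<rho>0)
    then have "(\<lambda>j. (B * (C * \<rho> j))\<^sup>2 * measure N \<Omega>) \<longlonglongrightarrow> 0" by simp
    from LIMSEQ_D[OF this \<eta>'] obtain j0 where j0: "\<And>j. j \<ge> j0 \<Longrightarrow> (B * (C * \<rho> j))\<^sup>2 * measure N \<Omega> < \<eta>'"
      by auto
    show "\<exists>j0. \<forall>j\<ge>j0. norm ((\<integral>x. (T j u x - u x)\<^sup>2 \<partial>N) - 0) < \<eta>"
    proof (intro exI allI impI)
      fix j assume j: "j \<ge> j0"
      have ud: "(\<lambda>x. u x - \<phi> x) \<in> square_int N" by (intro square_int_diff u' \<phi>s)
      have "(\<integral>x. (T j u x - u x)\<^sup>2 \<partial>N)
        = (\<integral>x. (T j (\<lambda>x. u x - \<phi> x) x + (T j \<phi> x - \<phi> x) + (-1) *\<^sub>R (u x - \<phi> x))\<^sup>2 \<partial>N)"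
        by (simp add: T2[OF u'(1) \<phi>s] algebra_simps)
      also have "\<dots> \<le> 3 * (\<integral>x. (T j (\<lambda>x. u x - \<phi> x) x)\<^sup>2 \<partial>N) + 3 * (\<integral>x. (T j \<phi> x - \<phi> x)\<^sup>2 \<partial>N)
          + 3 * (\<integral>x. ((-1) *\<^sub>R (u x - \<phi> x))\<^sup>2 \<partial>N)"
        by (intro integral_square_sum3_le Ts square_int_diff square_int_scaleR u' \<phi>s)
      also have "(\<integral>x. ((-1) *\<^sub>R (u x - \<phi> x))\<^sup>2 \<partial>N) = (\<integral>x. (u x - \<phi> x)\<^sup>2 \<partial>N)"
        by (simp add: power2_commute)
      also have "(\<integral>x. (T j (\<lambda>x. u x - \<phi> x) x)\<^sup>2 \<partial>N) \<le> ?K * (\<integral>x. (u x - \<phi> x)\<^sup>2 \<partial>N)"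
        by (rule TL2[OF ud])
      also have "?K * (\<integral>x. (u x - \<phi> x)\<^sup>2 \<partial>N) \<le> ?K * \<eta>'" using K \<phi>(3) by (intro mult_left_mono) auto
      finally have "(\<integral>x. (T j u x - u x)\<^sup>2 \<partial>N) < 3 * (?K * \<eta>') + 3 * \<eta>' + 3 * \<eta>'"
        using mid[of j] j0[OF j] \<phi>(3) by linarith
      also have "\<dots> \<le> 9 * (?K * \<eta>') + 9 * \<eta>'" using mult_pos_pos[OF K \<eta>'] \<eta>' by linarith
      also have "\<dots> = 9 * (?K + 1) * \<eta>'" by (simp add: algebra_simps)
      also have "\<dots> = \<eta>"
      proof -
        have "?K + 1 > 0" using K by linarith
        then have "9 * (?K + 1) > 0" by (rule mult_pos_pos[OF zero_less_numeral])
        then have ne: "9 * (?K + 1) \<noteq> 0" by (rule less_imp_neq[symmetric])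
        show ?thesis unfolding \<eta>'_def by (simp only: times_divide_eq_right nonzero_mult_div_cancel_left[OF ne])
      qed
      finally show "norm ((\<integral>x. (T j u x - u x)\<^sup>2 \<partial>N) - 0) < \<eta>" by simp
    qed
  qed
  let ?G = "\<integral>x. (norm (?g x))\<^sup>2 \<partial>N"
  have bd: "(\<integral>x. (norm (grad (T j u) x - ?g x))\<^sup>2 \<partial>N) \<le> 2 * (?K * ?G) + 2 * ?G" for j
  proof -
    have i: "integrable N (\<lambda>x. (norm (grad (T j u) x))\<^sup>2)" "integrable N (\<lambda>x. (norm (?g x))\<^sup>2)"
      using Ts(2)[of j u] u'(2) by (auto simp: square_int_def)
    have "(\<lambda>x. grad (T j u) x - ?g x) \<in> square_int N" by (intro square_int_diff Ts u')
    then have i': "integrable N (\<lambda>x. (norm (grad (T j u) x - ?g x))\<^sup>2)" by (simp add: square_int_def)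
    have "(norm (a - b))\<^sup>2 \<le> 2 * (norm a)\<^sup>2 + 2 * (norm b)\<^sup>2" for a b :: "real^'n"
      using power_mono[OF norm_triangle_ineq4[of a b], of 2] sum_squares_bound[of "norm a" "norm b"]
      by (simp add: power2_sum)
    then have "(\<integral>x. (norm (grad (T j u) x - ?g x))\<^sup>2 \<partial>N) \<le> (\<integral>x. 2 * (norm (grad (T j u) x))\<^sup>2 + 2 * (norm (?g x))\<^sup>2 \<partial>N)"
      using i i' by (intro integral_mono) auto
    also have "\<dots> = 2 * (\<integral>x. (norm (grad (T j u) x))\<^sup>2 \<partial>N) + 2 * ?G" using i by simp
    finally show ?thesis using Tg[of j] by linarith
  qed
  show ?thesis
    by (rule strong_approximation_from_weak[OF u' T1 lim bd e])
qed

section \<open>Passage to \<open>W\<^sup>1\<^sup>,\<^sup>2\<close>\<close>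

text \<open>Integrating \<open>f powr q \<le> t powr q * (1 + (f / t) powr p)\<close> replaces Jensen's inequality.\<close>

lemma power_mean_le:
  fixes f :: "'a \<Rightarrow> real"
  assumes D: "D \<in> sets M" "emeasure M D < \<infinity>" "measure M D > 0"
    and f: "f \<in> borel_measurable M" "\<And>x. f x \<ge> 0" and q: "0 < q" "q \<le> p" and A: "A \<ge> 0"
    and le: "(\<integral>\<^sup>+x. ennreal (f x powr p) * indicator D x \<partial>M) \<le> ennreal (A powr p * measure M D)"
  shows "set_integrable M D (\<lambda>x. f x powr q)"
    and "avg M D (\<lambda>x. f x powr q) powr (1 / q) \<le> 2 powr (1 / q) * A"
proof -
  let ?m = "measure M D"
  have pos: "p > 0" using q by simp
  have mp: "(\<lambda>x. indicator D x * f x powr p) \<in> borel_measurable M" using f(1) D(1) by measurable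
  have ip: "integrable M (\<lambda>x. indicator D x * f x powr p)"
  proof (rule integrableI_bounded[OF mp])
    have "(\<integral>\<^sup>+x. ennreal (norm (indicator D x * f x powr p)) \<partial>M) = (\<integral>\<^sup>+x. ennreal (f x powr p) * indicator D x \<partial>M)"
      by (intro nn_integral_cong) (auto simp: indicator_def)
    also have "\<dots> < \<infinity>" using le ennreal_less_top le_less_trans unfolding infinity_ennreal_def by blast
    finally show "(\<integral>\<^sup>+x. ennreal (norm (indicator D x * f x powr p)) \<partial>M) < \<infinity>" .
  qed
  have Ip: "(\<integral>x. indicator D x * f x powr p \<partial>M) \<le> A powr p * ?m"
  proof -
    have "ennreal (\<integral>x. indicator D x * f x powr p \<partial>M) = (\<integral>\<^sup>+x. ennreal (indicator D x * f x powr p) \<partial>M)"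
      using ip by (simp add: nn_integral_eq_integral)
    also have "\<dots> = (\<integral>\<^sup>+x. ennreal (f x powr p) * indicator D x \<partial>M)"
      by (intro nn_integral_cong) (auto simp: indicator_def)
    also have "\<dots> \<le> ennreal (A powr p * ?m)" by (rule le)
    finally show ?thesis by (subst (asm) ennreal_le_iff) auto
  qed
  have iD: "integrable M (indicator D :: 'a \<Rightarrow> real)" using D by (intro integrable_real_indicator) auto
  have pw: "f x powr q \<le> t powr q + t powr q * (f x powr p / t powr p)" if t: "t > 0" for t x
  proof (cases "f x \<le> t")
    case True
    then have "f x powr q \<le> t powr q" using f(2) q by (intro powr_mono2) auto
    moreover have "0 \<le> t powr q * (f x powr p / t powr p)" by simp
    ultimately show ?thesis by linarith
  next
    case False
    then have "f x powr q = t powr q * (f x / t) powr q" using t by (simp add: powr_divide)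
    also have "\<dots> \<le> t powr q * (f x / t) powr p"
      using False t q by (intro mult_left_mono powr_mono) auto
    also have "\<dots> = t powr q * (f x powr p / t powr p)" using f(2) t by (simp add: powr_divide)
    finally show ?thesis by (simp add: add_increasing)
  qed
  have mq: "(\<lambda>x. indicator D x * f x powr q) \<in> borel_measurable M" using f(1) D(1) by measurable
  have iq: "integrable M (\<lambda>x. indicator D x * f x powr q)"
  proof (rule Bochner_Integration.integrable_bound[OF _ mq])
    show "integrable M (\<lambda>x. indicator D x + indicator D x * f x powr p)" using iD ip by simp
    show "AE x in M. norm (indicator D x * f x powr q) \<le> norm (indicator D x + indicator D x * f x powr p)"
      using pw[of 1] by (intro AE_I2) (auto simp: indicator_def)
  qed
  then show "set_integrable M D (\<lambda>x. f x powr q)" by (simp add: set_integrable_def)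
  define Q where "Q = avg M D (\<lambda>x. f x powr q)"
  have Qeq: "Q = (\<integral>x. indicator D x * f x powr q \<partial>M) / ?m"
    by (simp add: Q_def avg_def set_lebesgue_integral_def)
  have Q0: "Q \<ge> 0" unfolding Qeq by (intro divide_nonneg_nonneg integral_nonneg_AE) auto
  have Qt: "Q \<le> 2 * t powr q" if t: "t > 0" "A \<le> t" for t
  proof -
    have "(\<integral>x. indicator D x * f x powr q \<partial>M)
        \<le> (\<integral>x. t powr q * indicator D x + t powr q / t powr p * (indicator D x * f x powr p) \<partial>M)"
    proof (rule integral_mono[OF iq])
      show "integrable M (\<lambda>x. t powr q * indicator D x + t powr q / t powr p * (indicator D x * f x powr p))"
        by (intro Bochner_Integration.integrable_add integrable_mult_right iD ip)
      show "indicator D x * f x powr q \<le> t powr q * indicator D x + t powr q / t powr p * (indicator D x * f x powr p)" for x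
        using pw[OF t(1), of x] by (simp add: indicator_def)
    qed
    also have "\<dots> = t powr q * ?m + t powr q / t powr p * (\<integral>x. indicator D x * f x powr p \<partial>M)"
      using iD ip D(1) sets.sets_into_space[OF D(1)] by (simp add: Int_absorb1)
    also have "\<dots> \<le> t powr q * ?m + t powr q / t powr p * (t powr p * ?m)"
    proof -
      have "A powr p \<le> t powr p" using t A pos by (intro powr_mono2) auto
      then have "A powr p * ?m \<le> t powr p * ?m" by (intro mult_right_mono) auto
      then show ?thesis using Ip by (intro add_left_mono mult_left_mono) auto
    qed
    also have "\<dots> = 2 * t powr q * ?m" using t by simp
    finally show ?thesis using D(3) by (simp add: Qeq field_simps)
  qed
  have "Q powr (1 / q) \<le> 2 powr (1 / q) * t" if t: "t > 0" "A \<le> t" for t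
  proof -
    have "Q powr (1 / q) \<le> (2 * t powr q) powr (1 / q)" using Qt[OF t] Q0 q by (intro powr_mono2) auto
    also have "\<dots> = 2 powr (1 / q) * t" using t q by (simp add: powr_mult powr_powr)
    finally show ?thesis .
  qed
  then have lim: "Q powr (1 / q) \<le> 2 powr (1 / q) * (A + \<eta>)" if "\<eta> > 0" for \<eta>
    using that A by simp
  show "avg M D (\<lambda>x. f x powr q) powr (1 / q) \<le> 2 powr (1 / q) * A"
    unfolding Q_def[symmetric]
  proof (rule field_le_epsilon)
    fix \<eta> :: real assume "\<eta> > 0"
    then show "Q powr (1 / q) \<le> 2 powr (1 / q) * A + \<eta>"
      using lim[of "\<eta> / 2 powr (1 / q)"] by (simp add: distrib_left)
  qed
qed

text \<open>Boundedness of the trace turns approximation in the Sobolev norm into convergence in L2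
  of \<sigma>, and a subsequence converges almost everywhere. Since the trace of a test function is
  that function, the limit of its plain values is the trace of \<open>u\<close>.\<close>

lemma trace_approximation:
  fixes \<Omega> :: "(real^'n) set"
  assumes NTA: "one_sided_NTA M \<Omega>" and bnd: "bounded \<Omega>" and diam: "diameter \<Omega> > 0"
    and \<sigma>: "sets \<sigma> = sets borel" and Tr: "is_trace_operator \<Omega> \<sigma> Tr" and u: "u \<in> W12 \<Omega>"
  obtains w where "\<And>j::nat. w j \<in> smooth_gen \<inter> test_functions UNIV"
    "(\<lambda>j. \<integral>x. (w j x - u x)\<^sup>2 \<partial>lebesgue_on \<Omega>) \<longlonglongrightarrow> 0"
    "(\<lambda>j. \<integral>x. (norm (grad (w j) x - weak_grad \<Omega> u x))\<^sup>2 \<partial>lebesgue_on \<Omega>) \<longlonglongrightarrow> 0"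
    "AE z in \<sigma>. (\<lambda>j. w j z) \<longlonglongrightarrow> Tr u z"
proof -
  interpret bounded_open \<Omega>
    using NTA bnd by unfold_locales (auto simp: one_sided_NTA_def)
  let ?g = "weak_grad \<Omega> u"
  note u' = W12_weak_grad[OF u]
  have "\<forall>j::nat. \<exists>w. w \<in> smooth_gen \<inter> test_functions UNIV \<and>
    (\<integral>x. (w x - u x)\<^sup>2 \<partial>N) + (\<integral>x. (norm (grad w x - ?g x))\<^sup>2 \<partial>N) < 1 / real (Suc j)"
  proof
    fix j :: nat
    have "1 / real (Suc j) > 0" by simp
    from test_functions_dense_W12[OF NTA bnd diam u this]
    show "\<exists>w. w \<in> smooth_gen \<inter> test_functions UNIV \<and>
      (\<integral>x. (w x - u x)\<^sup>2 \<partial>N) + (\<integral>x. (norm (grad w x - ?g x))\<^sup>2 \<partial>N) < 1 / real (Suc j)" by (simp only: Bex_def)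
  qed
  from choice[OF this] obtain w where w: "\<And>j. w j \<in> smooth_gen \<inter> test_functions UNIV"
    "\<And>j. (\<integral>x. (w j x - u x)\<^sup>2 \<partial>N) + (\<integral>x. (norm (grad (w j) x - ?g x))\<^sup>2 \<partial>N) < 1 / real (Suc j)" by blast
  have inv0: "(\<lambda>j. 1 / real (Suc j)) \<longlonglongrightarrow> 0" using LIMSEQ_inverse_real_of_nat by (simp add: inverse_eq_divide)
  have ws: "w j \<in> square_int N" "grad (w j) \<in> square_int N" for j
    using smooth_test_square_int[of "w j"] w(1)[of j] by auto
  have lim1: "(\<lambda>j. \<integral>x. (w j x - u x)\<^sup>2 \<partial>N) \<longlonglongrightarrow> 0"
  proof (rule tendsto_sandwich[OF _ _ tendsto_const inv0])
    show "\<forall>\<^sub>F j in sequentially. 0 \<le> (\<integral>x. (w j x - u x)\<^sup>2 \<partial>N)" by simp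
    have "(\<integral>x. (w j x - u x)\<^sup>2 \<partial>N) \<le> 1 / real (Suc j)" for j
    proof -
      have "0 \<le> (\<integral>x. (norm (grad (w j) x - ?g x))\<^sup>2 \<partial>N)" by simp
      with w(2)[of j] show ?thesis by linarith
    qed
    then show "\<forall>\<^sub>F j in sequentially. (\<integral>x. (w j x - u x)\<^sup>2 \<partial>N) \<le> 1 / real (Suc j)"
      by (intro always_eventually allI)
  qed
  have lim2: "(\<lambda>j. \<integral>x. (norm (grad (w j) x - ?g x))\<^sup>2 \<partial>N) \<longlonglongrightarrow> 0"
  proof (rule tendsto_sandwich[OF _ _ tendsto_const inv0])
    show "\<forall>\<^sub>F j in sequentially. 0 \<le> (\<integral>x. (norm (grad (w j) x - ?g x))\<^sup>2 \<partial>N)" by simp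
    have "(\<integral>x. (norm (grad (w j) x - ?g x))\<^sup>2 \<partial>N) \<le> 1 / real (Suc j)" for j
    proof -
      have "0 \<le> (\<integral>x. (w j x - u x)\<^sup>2 \<partial>N)" by simp
      with w(2)[of j] show ?thesis by linarith
    qed
    then show "\<forall>\<^sub>F j in sequentially. (\<integral>x. (norm (grad (w j) x - ?g x))\<^sup>2 \<partial>N) \<le> 1 / real (Suc j)"
      by (intro always_eventually allI)
  qed
  have wgrad: "is_weak_grad \<Omega> (w j) (grad (w j))" for j
    using w(1)[of j] by (intro is_weak_grad_C1 smooth_gen_C_k) auto
  have wW: "w j \<in> W12 \<Omega>" for j by (rule W12I[OF ws wgrad])
  have nW: "(\<lambda>x. - 1 * w j x) \<in> W12 \<Omega>" for j
  proof -
    have z: "(\<lambda>x. 0) \<in> square_int N" "(\<lambda>x. 0 :: real^'n) \<in> square_int N" "is_weak_grad \<Omega> (\<lambda>x. 0) (\<lambda>x. 0)"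
      by (auto simp: square_int_def is_weak_grad_def)
    have "(\<lambda>x. 0 - w j x) \<in> W12 \<Omega>"
      by (rule W12I[OF square_int_diff[OF z(1) ws(1)] square_int_diff[OF z(2) ws(2)] is_weak_grad_diff[OF z ws wgrad]])
    then show ?thesis by simp
  qed
  \<comment> \<open>Written as a sum with a multiple by -1 because the trace operator is known to
    respect sums and scalar multiples, only up to null sets.\<close>
  define d where "d j x = u x + - 1 * w j x" for j x
  have d_eq: "d j = (\<lambda>x. u x - w j x)" for j by (simp add: d_def fun_eq_iff)
  have ds: "d j \<in> square_int N" for j unfolding d_eq by (intro square_int_diff u' ws)
  have dgs: "(\<lambda>x. ?g x - grad (w j) x) \<in> square_int N" for j by (intro square_int_diff u' ws)
  have dg: "is_weak_grad \<Omega> (d j) (\<lambda>x. ?g x - grad (w j) x)" for j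
    unfolding d_eq by (rule is_weak_grad_diff[OF u' ws wgrad])
  have dW: "d j \<in> W12 \<Omega>" for j by (rule W12I[OF ds dgs dg])
  have norm_d: "(norm_W12 \<Omega> (d j))\<^sup>2 \<le> 1 / real (Suc j)" for j
  proof -
    have "(\<integral>x. (norm (weak_grad \<Omega> (d j) x))\<^sup>2 \<partial>N) = (\<integral>x. (norm (?g x - grad (w j) x))\<^sup>2 \<partial>N)"
    proof (rule integral_cong_AE)
      show "AE x in N. (norm (weak_grad \<Omega> (d j) x))\<^sup>2 = (norm (?g x - grad (w j) x))\<^sup>2"
        using weak_grad_AE[OF ds dgs dg, of j] by eventually_elim simp
    qed (use W12_weak_grad(2)[OF dW, of j] dgs[of j] in \<open>auto simp: square_int_def\<close>)
    then have "(norm_W12 \<Omega> (d j))\<^sup>2 = (\<integral>x. (w j x - u x)\<^sup>2 \<partial>N) + (\<integral>x. (norm (grad (w j) x - ?g x))\<^sup>2 \<partial>N)"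
      by (simp add: norm_W12_def norm_L2_def d_eq power2_commute[of "u _" "w j _"] norm_minus_commute[of "?g _"])
    with w(2)[of j] show ?thesis by linarith
  qed
  from Tr have Tr1: "\<And>u. u \<in> W12 \<Omega> \<Longrightarrow> Tr u \<in> square_int \<sigma>"
    and Tr2: "\<And>u v. u \<in> W12 \<Omega> \<Longrightarrow> v \<in> W12 \<Omega> \<Longrightarrow> AE z in \<sigma>. Tr (\<lambda>x. u x + v x) z = Tr u z + Tr v z"
    and Tr3: "\<And>u a. u \<in> W12 \<Omega> \<Longrightarrow> AE z in \<sigma>. Tr (\<lambda>x. a * u x) z = a * Tr u z"
    and Tr5: "\<And>\<phi>. \<phi> \<in> test_functions UNIV \<Longrightarrow> AE z in \<sigma>. Tr \<phi> z = \<phi> z"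
    unfolding is_trace_operator_def by blast+
  from Tr obtain B where B: "\<And>u. u \<in> W12 \<Omega> \<Longrightarrow> norm_L2 \<sigma> (Tr u) \<le> B * norm_W12 \<Omega> u"
    unfolding is_trace_operator_def by blast
  have Td: "AE z in \<sigma>. Tr (d j) z = Tr u z - w j z" for j
  proof -
    have "AE z in \<sigma>. Tr (d j) z = Tr u z + Tr (\<lambda>x. - 1 * w j x) z"
      unfolding d_def[abs_def] by (rule Tr2[OF u nW])
    moreover have "AE z in \<sigma>. Tr (\<lambda>x. - 1 * w j x) z = - 1 * Tr (w j) z" by (rule Tr3[OF wW])
    moreover have "AE z in \<sigma>. Tr (w j) z = w j z" using w(1)[of j] by (intro Tr5) auto
    ultimately show ?thesis by eventually_elim simp
  qed
  have Trd: "(\<integral>z. (Tr (d j) z)\<^sup>2 \<partial>\<sigma>) \<le> B\<^sup>2 * (1 / real (Suc j))" for j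
  proof -
    have "norm_L2 \<sigma> (Tr (d j)) \<ge> 0" by (simp add: norm_L2_def)
    then have "(norm_L2 \<sigma> (Tr (d j)))\<^sup>2 \<le> (B * norm_W12 \<Omega> (d j))\<^sup>2"
      using B[OF dW] by (intro power_mono)
    also have "\<dots> \<le> B\<^sup>2 * (1 / real (Suc j))"
      unfolding power_mult_distrib using norm_d by (intro mult_left_mono) auto
    finally show ?thesis by (simp add: norm_L2_def)
  qed
  have iTd: "integrable \<sigma> (\<lambda>z. (Tr (d j) z)\<^sup>2)" for j using Tr1[OF dW[of j]] by (simp add: square_int_def)
  have limTd: "(\<lambda>j. \<integral>z. norm ((Tr (d j) z)\<^sup>2) \<partial>\<sigma>) \<longlonglongrightarrow> 0"
  proof (rule tendsto_sandwich[OF _ _ tendsto_const])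
    show "(\<lambda>j. B\<^sup>2 * (1 / real (Suc j))) \<longlonglongrightarrow> 0" using tendsto_mult[OF tendsto_const inv0, of "B\<^sup>2"] by simp
    show "\<forall>\<^sub>F j in sequentially. 0 \<le> (\<integral>z. norm ((Tr (d j) z)\<^sup>2) \<partial>\<sigma>)" by simp
    show "\<forall>\<^sub>F j in sequentially. (\<integral>z. norm ((Tr (d j) z)\<^sup>2) \<partial>\<sigma>) \<le> B\<^sup>2 * (1 / real (Suc j))"
      using Trd by simp
  qed
  obtain r where r: "strict_mono r" "AE z in \<sigma>. (\<lambda>j. (Tr (d (r j)) z)\<^sup>2) \<longlonglongrightarrow> 0"
    using tendsto_L1_AE_subseq[OF iTd limTd] by blast
  have "AE z in \<sigma>. \<forall>j. Tr (d j) z = Tr u z - w j z" using Td by (simp add: AE_all_countable)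
  with r(2) have AE: "AE z in \<sigma>. (\<lambda>j. w (r j) z) \<longlonglongrightarrow> Tr u z"
  proof eventually_elim
    case (elim z)
    then have "(\<lambda>j. sqrt ((Tr u z - w (r j) z)\<^sup>2)) \<longlonglongrightarrow> sqrt 0" by (intro tendsto_real_sqrt) simp
    then have "(\<lambda>j. Tr u z - w (r j) z) \<longlonglongrightarrow> 0" by (simp add: tendsto_rabs_zero_iff)
    from tendsto_diff[OF tendsto_const this, of "Tr u z"] show ?case by simp
  qed
  show thesis
  proof (rule that[of "\<lambda>j. w (r j)"])
    show "w (r j) \<in> smooth_gen \<inter> test_functions UNIV" for j by (rule w)
    show "(\<lambda>j. \<integral>x. (w (r j) x - u x)\<^sup>2 \<partial>N) \<longlonglongrightarrow> 0"
      using LIMSEQ_subseq_LIMSEQ[OF lim1 r(1)] by (simp add: o_def)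
    show "(\<lambda>j. \<integral>x. (norm (grad (w (r j)) x - ?g x))\<^sup>2 \<partial>N) \<longlonglongrightarrow> 0"
      using LIMSEQ_subseq_LIMSEQ[OF lim2 r(1)] by (simp add: o_def)
  qed (rule AE)
qed

section \<open>Means and local energies under strong convergence\<close>

context bounded_open
begin

lemma set_integral_eq_N:
  fixes f :: "real^'n \<Rightarrow> real"
  assumes "A \<subseteq> \<Omega>"
  shows "(LINT x:A|lebesgue. f x) = (\<integral>x. indicator A x * f x \<partial>N)"
proof -
  have "(\<integral>x. indicator A x * f x \<partial>N) = (\<integral>x. indicator \<Omega> x *\<^sub>R (indicator A x * f x) \<partial>lebesgue)"
    using op by (intro integral_restrict_space) simp
  also have "(\<lambda>x. indicator \<Omega> x *\<^sub>R (indicator A x * f x)) = (\<lambda>x. indicator A x *\<^sub>R f x)"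
    using assms by (auto simp: fun_eq_iff indicator_def)
  finally show ?thesis by (simp add: set_lebesgue_integral_def)
qed

lemma square_int_indicator:
  assumes "A \<in> sets lebesgue" "A \<subseteq> \<Omega>" shows "(indicator A :: real^'n \<Rightarrow> real) \<in> square_int N"
proof -
  have [measurable]: "A \<in> sets N" using assms op by (auto simp: sets_restrict_space image_iff)
  have m: "(indicator A :: real^'n \<Rightarrow> real) \<in> borel_measurable N" by measurable
  have m2: "(\<lambda>x. (norm (indicator A x :: real))\<^sup>2) \<in> borel_measurable N" by measurable
  have "integrable N (\<lambda>x. (norm (indicator A x :: real))\<^sup>2)"
    by (rule integrable_const_bound[of _ 1, OF _ m2]) (auto simp: indicator_def)
  with m show ?thesis by (simp add: square_int_def)
qed

lemma tendsto_avg: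
  assumes E: "E \<in> sets lebesgue" "E \<subseteq> \<Omega>" and w: "\<And>j. w j \<in> square_int N" and u: "u \<in> square_int N"
    and lim: "(\<lambda>j. \<integral>x. (w j x - u x)\<^sup>2 \<partial>N) \<longlonglongrightarrow> 0"
  shows "(\<lambda>j. avg lebesgue E (w j)) \<longlonglongrightarrow> avg lebesgue E u"
proof -
  note ind = square_int_indicator[OF E]
  have "(\<lambda>j. \<integral>x. indicator E x * (w j x - u x) \<partial>N) \<longlonglongrightarrow> 0"
    by (intro tendsto_inner_strong ind square_int_diff w u lim)
  moreover have "(\<integral>x. indicator E x * (w j x - u x) \<partial>N)
      = (\<integral>x. indicator E x * w j x \<partial>N) - (\<integral>x. indicator E x * u x \<partial>N)" for j
    unfolding right_diff_distrib by (intro Bochner_Integration.integral_diff square_int_mult ind w u)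
  ultimately have "(\<lambda>j. (\<integral>x. indicator E x * w j x \<partial>N) - (\<integral>x. indicator E x * u x \<partial>N)) \<longlonglongrightarrow> 0" by simp
  from tendsto_add[OF this tendsto_const[of "\<integral>x. indicator E x * u x \<partial>N"]]
  have "(\<lambda>j. \<integral>x. indicator E x * w j x \<partial>N) \<longlonglongrightarrow> (\<integral>x. indicator E x * u x \<partial>N)" by simp
  then show ?thesis unfolding avg_def set_integral_eq_N[OF E(2)] divide_inverse by (rule tendsto_mult_right)
qed

text \<open>The crude factor 2 from squaring the triangle inequality is harmless, as it only
  enlarges the constant; in return the error is the global squared L2 distance of the
  gradients.\<close>

lemma local_energy_perturb:
  fixes f g :: "real^'n \<Rightarrow> real^'n"
  assumes f: "f \<in> square_int N" and g: "g \<in> square_int N"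
  shows "local_energy \<Omega> f x R \<le> ennreal (2 * (\<integral>y. indicator (ball x R \<inter> \<Omega>) y * (norm (g y))\<^sup>2 \<partial>N)
    + 2 * (\<integral>y. (norm (f y - g y))\<^sup>2 \<partial>N))"
proof -
  have [measurable]: "f \<in> borel_measurable N" "g \<in> borel_measurable N"
    using f g by (auto simp: square_int_def)
  have [measurable]: "(\<lambda>y. indicator (ball x R \<inter> \<Omega>) y :: real) \<in> borel_measurable N"
    using op by (intro borel_measurable_lebesgue_on borel_measurable_indicator) simp
  have ig: "integrable N (\<lambda>y. (norm (g y))\<^sup>2)" using g by (simp add: square_int_def)
  have m: "(\<lambda>y. indicator (ball x R \<inter> \<Omega>) y * (norm (g y))\<^sup>2) \<in> borel_measurable N" by measurable
  have i1: "integrable N (\<lambda>y. indicator (ball x R \<inter> \<Omega>) y * (norm (g y))\<^sup>2)"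
    by (rule Bochner_Integration.integrable_bound[OF ig m]) (auto simp: indicator_def)
  have i2: "integrable N (\<lambda>y. (norm (f y - g y))\<^sup>2)"
    using square_int_diff[OF f g] by (simp add: square_int_def)
  have tri: "(norm a)\<^sup>2 \<le> 2 * (norm b)\<^sup>2 + 2 * (norm (a - b))\<^sup>2" for a b :: "real^'n"
    using power_mono[OF norm_triangle_ineq[of b "a - b"], of 2] sum_squares_bound[of "norm b" "norm (a - b)"]
    by (simp add: power2_sum)
  have "local_energy \<Omega> f x R \<le> (\<integral>\<^sup>+y. ennreal (2 * (indicator (ball x R \<inter> \<Omega>) y * (norm (g y))\<^sup>2) + 2 * (norm (f y - g y))\<^sup>2) \<partial>N)"
    unfolding local_energy_def
  proof (intro nn_integral_mono)
    fix y assume "y \<in> space N"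
    then have y: "y \<in> \<Omega>" by simp
    have "(norm (f y))\<^sup>2 * indicator (ball x R) y
        \<le> 2 * (indicator (ball x R \<inter> \<Omega>) y * (norm (g y))\<^sup>2) + 2 * (norm (f y - g y))\<^sup>2"
      using tri[of "f y" "g y"] y by (auto simp: indicator_def)
    from ennreal_leI[OF this]
    show "ennreal ((norm (f y))\<^sup>2) * indicator (ball x R) y
        \<le> ennreal (2 * (indicator (ball x R \<inter> \<Omega>) y * (norm (g y))\<^sup>2) + 2 * (norm (f y - g y))\<^sup>2)"
      using y by (cases "y \<in> ball x R") (simp_all add: indicator_def del: ennreal_plus)
  qed
  also have "\<dots> = ennreal (\<integral>y. 2 * (indicator (ball x R \<inter> \<Omega>) y * (norm (g y))\<^sup>2) + 2 * (norm (f y - g y))\<^sup>2 \<partial>N)"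
    using i1 i2 by (intro nn_integral_eq_integral) auto
  finally show ?thesis using i1 i2 by simp
qed

end

lemma powr_one_minus_half:
  assumes "r > (0::real)" shows "r powr (1 - real n / 2) = r / sqrt (r ^ n)"
proof -
  have "sqrt (r ^ n) = r powr (real n / 2)"
    using assms by (simp add: powr_half_sqrt[symmetric] powr_realpow[symmetric] powr_powr)
  then show ?thesis using assms by (simp add: powr_diff)
qed

text \<open>The order of quantifiers encodes what the constants depend on: \<open>K\<close> precedes
  \<open>k\<close> and \<open>c\<close>, and \<open>C\<close> precedes the domain, the measure,
  \<open>E\<close> and \<open>u\<close>. Integrability is part of the conclusion because a
  non-integrable function has integral 0 by convention, so the inequality alone would say nothing
  about it.\<close>

theorem lemma2p29:
  fixes M :: nat and M' d :: real
  assumes "CARD('n::finite) \<ge> 3"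
    and "M > 1" and "M' \<ge> 1"
    and "real CARD('n) - 2 < d" and "d < real CARD('n)"
  shows "\<exists>K > 1. \<forall>k c :: real. 0 < k \<and> k < d / (real CARD('n) - 2) \<and> c > 0 \<longrightarrow>
    (\<exists>C > 0. \<forall>(\<Omega> :: (real^'n) set) \<sigma> Tr z\<^sub>0 r E.
       bounded \<Omega> \<and> one_sided_NTA M \<Omega> \<and> ahlfors_regular M' d \<Omega> \<sigma> \<and>
       is_trace_operator \<Omega> \<sigma> Tr \<and>
       z\<^sub>0 \<in> frontier \<Omega> \<and> 0 < r \<and> r \<le> diameter \<Omega> \<and>
       E \<in> sets lebesgue \<and> E \<subseteq> ball z\<^sub>0 r \<inter> \<Omega> \<and> measure lebesgue E \<ge> c * r ^ CARD('n) \<longrightarrow>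
       (\<forall>u \<in> W12 \<Omega>.
          set_integrable \<sigma> (surface_ball \<Omega> z\<^sub>0 r)
            (\<lambda>z. \<bar>Tr u z - avg lebesgue E u\<bar> powr (2 * k)) \<and>
          (avg \<sigma> (surface_ball \<Omega> z\<^sub>0 r) (\<lambda>z. \<bar>Tr u z - avg lebesgue E u\<bar> powr (2 * k)))
            powr (1 / (2 * k))
          \<le> C * r * (avg lebesgue (ball z\<^sub>0 (K * r) \<inter> \<Omega>) (\<lambda>x. (norm (weak_grad \<Omega> u x))\<^sup>2))
            powr (1 / 2)))"
proof -
  let ?n = "real CARD('n)" and ?\<omega> = "unit_ball_volume TYPE('n)"
  have n: "?n \<ge> 3" using assms(1) by simp
  have d0: "d > 0" using n assms(4) by linarith
  have \<omega>: "?\<omega> > 0" by (rule unit_ball_volume_pos)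
  show ?thesis
  proof (rule trace_inequality_C1[OF assms(2-4) d0])
  fix K :: real
  assume K: "K > 1" and ineq: "\<And>p c. p \<ge> 2 \<Longrightarrow> p * (?n - 2) / 2 < d \<Longrightarrow> c > 0 \<Longrightarrow>
      \<exists>C > 0. \<forall>(\<Omega> :: (real^'n) set) \<sigma> z\<^sub>0 r E u Bd G.
        bounded \<Omega> \<and> one_sided_NTA M \<Omega> \<and> ahlfors_regular M' d \<Omega> \<sigma> \<and> z\<^sub>0 \<in> frontier \<Omega> \<and>
        0 < r \<and> r \<le> diameter \<Omega> \<and> E \<in> sets lebesgue \<and> E \<subseteq> ball z\<^sub>0 r \<inter> \<Omega> \<and>
        c * r ^ CARD('n) \<le> measure lebesgue E \<and> C_k (Suc 0) u \<and> (\<forall>x. norm (grad u x) \<le> Bd) \<and>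
        G \<ge> 0 \<and> local_energy \<Omega> (grad u) z\<^sub>0 (K * r) \<le> ennreal (G\<^sup>2) \<longrightarrow>
        (\<integral>\<^sup>+x. ennreal (\<bar>u x - avg lebesgue E u\<bar> powr p) * indicator (surface_ball \<Omega> z\<^sub>0 r) x \<partial>\<sigma>)
          \<le> ennreal (C * (G * r powr (1 - ?n / 2)) powr p * r powr d)"
  show ?thesis
  proof (rule exI[of _ K], intro conjI allI impI K, elim conjE)
  fix k c :: real
  assume k: "0 < k" "k < d / (?n - 2)" and c: "c > 0"
  \<comment> \<open>The integrated bound needs p \<ge> 2. For p = 2 the subcritical condition is
    exactly n - 2 < d, for p = 2k it is the assumption on \<open>k\<close>; smaller exponents follow
    from p = 2 by comparison of means.\<close>
  define p where "p = max (2 * k) 2"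
  have p: "p \<ge> 2" "p > 0" "2 * k \<le> p" by (auto simp: p_def)
  have "k * (?n - 2) < d" using k(2) n by (simp add: pos_less_divide_eq)
  then have crit: "p * (?n - 2) / 2 < d" using assms(4) by (auto simp: p_def max_def)
  obtain C\<^sub>1 where C\<^sub>1: "C\<^sub>1 > 0" and smooth_ineq:
    "\<forall>(\<Omega> :: (real^'n) set) \<sigma> z\<^sub>0 r E u Bd G.
        bounded \<Omega> \<and> one_sided_NTA M \<Omega> \<and> ahlfors_regular M' d \<Omega> \<sigma> \<and> z\<^sub>0 \<in> frontier \<Omega> \<and>
        0 < r \<and> r \<le> diameter \<Omega> \<and> E \<in> sets lebesgue \<and> E \<subseteq> ball z\<^sub>0 r \<inter> \<Omega> \<and>
        c * r ^ CARD('n) \<le> measure lebesgue E \<and> C_k (Suc 0) u \<and> (\<forall>x. norm (grad u x) \<le> Bd) \<and>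
        G \<ge> 0 \<and> local_energy \<Omega> (grad u) z\<^sub>0 (K * r) \<le> ennreal (G\<^sup>2) \<longrightarrow>
        (\<integral>\<^sup>+x. ennreal (\<bar>u x - avg lebesgue E u\<bar> powr p) * indicator (surface_ball \<Omega> z\<^sub>0 r) x \<partial>\<sigma>)
          \<le> ennreal (C\<^sub>1 * (G * r powr (1 - ?n / 2)) powr p * r powr d)"
  proof -
    from ineq[OF p(1) crit c] show ?thesis by (elim exE conjE) (rule that)
  qed
  \<comment> \<open>The factors come, in order, from the comparison of means, from the smooth
    inequality together with the lower bound for the surface measure, from the perturbed energy, and
    from the volume of the dilated ball.\<close>
  define C where "C = 2 powr (1 / (2 * k)) * (C\<^sub>1 * M') powr (1 / p) * sqrt 2 * sqrt (?\<omega> * K ^ CARD('n))"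
  have M': "M' > 0" using assms(3) by simp
  have C: "C > 0" using C\<^sub>1 M' \<omega> K by (simp add: C_def)
  show "\<exists>C > 0. \<forall>(\<Omega> :: (real^'n) set) \<sigma> Tr z\<^sub>0 r E.
       bounded \<Omega> \<and> one_sided_NTA M \<Omega> \<and> ahlfors_regular M' d \<Omega> \<sigma> \<and>
       is_trace_operator \<Omega> \<sigma> Tr \<and>
       z\<^sub>0 \<in> frontier \<Omega> \<and> 0 < r \<and> r \<le> diameter \<Omega> \<and>
       E \<in> sets lebesgue \<and> E \<subseteq> ball z\<^sub>0 r \<inter> \<Omega> \<and> measure lebesgue E \<ge> c * r ^ CARD('n) \<longrightarrow>
       (\<forall>u \<in> W12 \<Omega>.
          set_integrable \<sigma> (surface_ball \<Omega> z\<^sub>0 r)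
            (\<lambda>z. \<bar>Tr u z - avg lebesgue E u\<bar> powr (2 * k)) \<and>
          (avg \<sigma> (surface_ball \<Omega> z\<^sub>0 r) (\<lambda>z. \<bar>Tr u z - avg lebesgue E u\<bar> powr (2 * k)))
            powr (1 / (2 * k))
          \<le> C * r * (avg lebesgue (ball z\<^sub>0 (K * r) \<inter> \<Omega>) (\<lambda>x. (norm (weak_grad \<Omega> u x))\<^sup>2))
            powr (1 / 2))"
  proof (intro exI[of _ C] conjI[OF C] allI impI ballI, elim conjE)
  fix \<Omega> :: "(real^'n) set" and \<sigma> Tr z\<^sub>0 r E u
  assume bnd: "bounded \<Omega>" and NTA: "one_sided_NTA M \<Omega>" and \<sigma>: "ahlfors_regular M' d \<Omega> \<sigma>"
    and Tr: "is_trace_operator \<Omega> \<sigma> Tr" and z0: "z\<^sub>0 \<in> frontier \<Omega>" and r: "0 < r" "r \<le> diameter \<Omega>"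
    and E: "E \<in> sets lebesgue" "E \<subseteq> ball z\<^sub>0 r \<inter> \<Omega>" "c * r ^ CARD('n) \<le> measure lebesgue E"
    and u: "u \<in> W12 \<Omega>"
  interpret bounded_open \<Omega>
    using NTA bnd by unfold_locales (auto simp: one_sided_NTA_def)
  have diam: "diameter \<Omega> > 0" using r by linarith
  have sets\<sigma>: "sets \<sigma> = sets borel" using \<sigma> by (simp add: ahlfors_regular_def)
  note u' = W12_weak_grad[OF u]
  let ?g = "weak_grad \<Omega> u" and ?\<Delta> = "surface_ball \<Omega> z\<^sub>0 r" and ?U = "ball z\<^sub>0 (K * r) \<inter> \<Omega>"
  let ?a = "avg lebesgue E u" and ?\<gamma> = "r powr (1 - ?n / 2)"
  obtain w where w: "\<And>j::nat. w j \<in> smooth_gen \<inter> test_functions UNIV"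
    and w1: "(\<lambda>j. \<integral>x. (w j x - u x)\<^sup>2 \<partial>N) \<longlonglongrightarrow> 0"
    and w2: "(\<lambda>j. \<integral>x. (norm (grad (w j) x - ?g x))\<^sup>2 \<partial>N) \<longlonglongrightarrow> 0"
    and w3: "AE z in \<sigma>. (\<lambda>j. w j z) \<longlonglongrightarrow> Tr u z"
    using trace_approximation[OF NTA bnd diam sets\<sigma> Tr u] by blast
  have ws: "w j \<in> square_int N" "grad (w j) \<in> square_int N" for j
    using smooth_test_square_int[of "w j"] w[of j] by auto
  have avg_lim: "(\<lambda>j. avg lebesgue E (w j)) \<longlonglongrightarrow> ?a"
    using E(2) by (intro tendsto_avg E ws u' w1) auto
  define G2 where "G2 = (\<integral>x. indicator ?U x * (norm (?g x))\<^sup>2 \<partial>N)"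
  have G2: "G2 \<ge> 0" unfolding G2_def by (intro integral_nonneg_AE) auto
  define e where "e j = (\<integral>x. (norm (grad (w j) x - ?g x))\<^sup>2 \<partial>N)" for j
  have e: "e j \<ge> 0" for j by (simp add: e_def)
  \<comment> \<open>Each approximant gets its own energy bound; the error \<open>e j\<close>
    disappears in the limit, while the factor 2 remains and goes into the constant.\<close>
  define G where "G j = sqrt (2 * G2 + 2 * e j)" for j
  have smooth: "(\<integral>\<^sup>+x. ennreal (\<bar>w j x - avg lebesgue E (w j)\<bar> powr p) * indicator ?\<Delta> x \<partial>\<sigma>)
      \<le> ennreal (C\<^sub>1 * (G j * ?\<gamma>) powr p * r powr d)" for j
  proof -
    have C1: "C_k (Suc 0) (w j)" using w[of j] by (intro smooth_gen_C_k) auto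
    obtain Bd where Bd: "\<And>x. norm (grad (w j) x) \<le> Bd"
    proof -
      have "compact (closure {x. w j x \<noteq> 0})" using w[of j] unfolding test_functions_def by blast
      from bounded_grad[OF C1 this] show ?thesis using that by blast
    qed
    show ?thesis
    proof (rule smooth_ineq[rule_format, of \<Omega> \<sigma> z\<^sub>0 r E "w j" Bd "G j"],
        intro conjI allI bnd NTA \<sigma> z0 r E C1 Bd)
      show "0 \<le> G j" using G2 e[of j] by (simp add: G_def)
      have "(G j)\<^sup>2 = 2 * G2 + 2 * e j" using G2 e[of j] by (simp add: G_def)
      then show "local_energy \<Omega> (grad (w j)) z\<^sub>0 (K * r) \<le> ennreal ((G j)\<^sup>2)"
        using local_energy_perturb[OF ws(2) u'(2), of j z\<^sub>0 "K * r"] by (simp add: G2_def e_def)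
    qed
  qed
  have Trm[measurable]: "Tr u \<in> borel_measurable \<sigma>"
    using Tr u unfolding is_trace_operator_def square_int_def by blast
  have wm[measurable]: "w j \<in> borel_measurable \<sigma>" for j
  proof -
    have "continuous_on UNIV (w j)" using w[of j] smooth_gen_C_k[of "w j" 0] by simp
    then show ?thesis using sets\<sigma> borel_measurable_continuous_onI by (simp cong: measurable_cong_sets)
  qed
  have \<Delta>[measurable]: "?\<Delta> \<in> sets \<sigma>" by (rule ahlfors_regular_surface_ball(3)[OF \<sigma> bnd z0 r])
  define Q where "Q = C\<^sub>1 * (sqrt (2 * G2) * ?\<gamma>) powr p * r powr d"
  have fatou: "(\<integral>\<^sup>+z. ennreal (\<bar>Tr u z - ?a\<bar> powr p) * indicator ?\<Delta> z \<partial>\<sigma>) \<le> ennreal Q"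
  proof -
    let ?f = "\<lambda>j z. ennreal (\<bar>w j z - avg lebesgue E (w j)\<bar> powr p) * indicator ?\<Delta> z"
    have "(\<integral>\<^sup>+z. ennreal (\<bar>Tr u z - ?a\<bar> powr p) * indicator ?\<Delta> z \<partial>\<sigma>) = (\<integral>\<^sup>+z. liminf (\<lambda>j. ?f j z) \<partial>\<sigma>)"
    proof (rule nn_integral_cong_AE)
      show "AE z in \<sigma>. ennreal (\<bar>Tr u z - ?a\<bar> powr p) * indicator ?\<Delta> z = liminf (\<lambda>j. ?f j z)"
        using w3
      proof eventually_elim
        case (elim z)
        have "(\<lambda>j. \<bar>w j z - avg lebesgue E (w j)\<bar> powr p) \<longlonglongrightarrow> \<bar>Tr u z - ?a\<bar> powr p"
          using p by (intro tendsto_powr' tendsto_rabs tendsto_diff elim avg_lim tendsto_const) auto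
        then have "(\<lambda>j. ?f j z) \<longlonglongrightarrow> ennreal (\<bar>Tr u z - ?a\<bar> powr p) * indicator ?\<Delta> z"
          by (cases "z \<in> ?\<Delta>") (auto intro: tendsto_ennrealI)
        then show ?case by (intro lim_imp_Liminf[symmetric]) auto
      qed
    qed
    also have "\<dots> \<le> liminf (\<lambda>j. \<integral>\<^sup>+z. ?f j z \<partial>\<sigma>)"
      by (rule nn_integral_liminf) measurable
    also have "\<dots> \<le> liminf (\<lambda>j. ennreal (C\<^sub>1 * (G j * ?\<gamma>) powr p * r powr d))"
      by (intro Liminf_mono always_eventually allI smooth)
    also have "\<dots> = ennreal Q"
    proof (rule lim_imp_Liminf)
      have "e \<longlonglongrightarrow> 0" unfolding e_def by (rule w2)
      then have "G \<longlonglongrightarrow> sqrt (2 * G2 + 2 * 0)" unfolding G_def by (intro tendsto_intros)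
      then have "(\<lambda>j. C\<^sub>1 * (G j * ?\<gamma>) powr p * r powr d) \<longlonglongrightarrow> C\<^sub>1 * (sqrt (2 * G2 + 2 * 0) * ?\<gamma>) powr p * r powr d"
      proof (intro tendsto_mult tendsto_const tendsto_powr')
        have "G j \<ge> 0" for j using G2 e[of j] by (simp add: G_def)
        then show "sqrt (2 * G2 + 2 * 0) * ?\<gamma> \<noteq> 0 \<or> 0 < p \<and> (\<forall>\<^sub>F j in sequentially. 0 \<le> G j * ?\<gamma>)"
          using p by (auto intro!: always_eventually)
      qed
      then show "(\<lambda>j. ennreal (C\<^sub>1 * (G j * ?\<gamma>) powr p * r powr d)) \<longlonglongrightarrow> ennreal Q"
        unfolding Q_def by (intro tendsto_ennrealI) simp
    qed simp
    finally show ?thesis .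
  qed
  let ?m = "measure \<sigma> ?\<Delta>"
  have fin: "emeasure \<sigma> ?\<Delta> < \<infinity>"
    using ahlfors_regular_surface_ball(1)[OF \<sigma> bnd z0 r] ennreal_less_top le_less_trans
    unfolding infinity_ennreal_def by blast
  have m_ge: "r powr d / M' \<le> ?m"
  proof -
    have "ennreal (r powr d / M') \<le> ennreal ?m"
      using ahlfors_regular_surface_ball(2)[OF \<sigma> bnd z0 r] fin
      by (simp add: emeasure_eq_ennreal_measure less_top)
    then show ?thesis by simp
  qed
  have "r powr d / M' > 0" using r M' by simp
  with m_ge have m0: "?m > 0" by linarith
  \<comment> \<open>Chosen so that the limit bound \<open>Q\<close> is at most the p-th power of
    \<open>A\<close> times the surface measure: the lower regularity bound absorbs the factor
    \<open>r powr d\<close>.\<close>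
  define A where "A = (C\<^sub>1 * M') powr (1 / p) * (sqrt (2 * G2) * ?\<gamma>)"
  have A0: "A \<ge> 0" using G2 by (simp add: A_def)
  have QA: "Q \<le> A powr p * ?m"
  proof -
    have "A powr p = ((C\<^sub>1 * M') powr (1 / p)) powr p * (sqrt (2 * G2) * ?\<gamma>) powr p"
      unfolding A_def by (rule powr_mult)
    also have "((C\<^sub>1 * M') powr (1 / p)) powr p = C\<^sub>1 * M'"
      using p C\<^sub>1 M' by (simp add: powr_powr)
    finally have Ap: "A powr p = C\<^sub>1 * M' * (sqrt (2 * G2) * ?\<gamma>) powr p" .
    have "Q = C\<^sub>1 * M' * (sqrt (2 * G2) * ?\<gamma>) powr p * (r powr d / M')"
      using M' by (simp add: Q_def)
    also have "\<dots> \<le> C\<^sub>1 * M' * (sqrt (2 * G2) * ?\<gamma>) powr p * ?m"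
      using C\<^sub>1 M' by (intro mult_left_mono m_ge) auto
    finally show ?thesis by (simp only: Ap)
  qed
  have bound: "(\<integral>\<^sup>+z. ennreal (\<bar>Tr u z - ?a\<bar> powr p) * indicator ?\<Delta> z \<partial>\<sigma>) \<le> ennreal (A powr p * ?m)"
    using fatou ennreal_leI[OF QA] by (rule order_trans)
  have fm: "(\<lambda>z. \<bar>Tr u z - ?a\<bar>) \<in> borel_measurable \<sigma>" by measurable
  have k2: "0 < 2 * k" using k by simp
  note pm = power_mean_le[OF \<Delta> fin m0 fm abs_ge_zero k2 p(3) A0 bound]
  have final: "2 powr (1 / (2 * k)) * A \<le> C * r * (avg lebesgue ?U (\<lambda>x. (norm (?g x))\<^sup>2)) powr (1 / 2)"
  proof -
    let ?V = "measure lebesgue ?U"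
    have Ul: "?U \<in> lmeasurable" using op by (intro bounded_set_imp_lmeasurable bounded_Int) auto
    have Kr: "K * r > 0" using K r by simp
    \<comment> \<open>The centre lies in the closure of \<Omega>, so the intersection is a nonempty
      open set; its volume can then be divided by to form the mean on the right.\<close>
    have V0: "?V > 0"
    proof -
      have "z\<^sub>0 \<in> closure \<Omega>" using z0 by (simp add: frontier_def)
      then obtain y where y: "y \<in> \<Omega>" "dist y z\<^sub>0 < K * r" using Kr unfolding closure_approachable by blast
      then have "y \<in> ?U" by (simp add: dist_commute)
      moreover have "open ?U" by (intro open_Int open_ball op)
      ultimately obtain s where s: "s > 0" "ball y s \<subseteq> ?U" by (meson openE)
      have "0 < measure lebesgue (ball y s)" using content_ball_pos[OF s(1), of y] by simp
      also have "\<dots> \<le> ?V" using s Ul by (intro measure_mono_fmeasurable) auto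
      finally show ?thesis .
    qed
    have V: "?V \<le> ?\<omega> * K ^ CARD('n) * r ^ CARD('n)"
    proof -
      have "?V \<le> measure lebesgue (ball z\<^sub>0 (K * r))"
        using Ul by (intro measure_mono_fmeasurable) (auto simp: lmeasurable_ball)
      also have "\<dots> = ?\<omega> * (K * r) ^ CARD('n)"
        using emeasure_lborel_ball[OF Kr, of z\<^sub>0] \<omega> Kr by (simp add: measure_def)
      finally show ?thesis by (simp add: power_mult_distrib mult.assoc)
    qed
    have avg_eq: "avg lebesgue ?U (\<lambda>x. (norm (?g x))\<^sup>2) = G2 / ?V"
      unfolding avg_def G2_def by (subst set_integral_eq_N) auto
    have "sqrt (2 * G2) * ?\<gamma> = sqrt 2 * r * sqrt (G2 / r ^ CARD('n))"
      using r by (simp add: powr_one_minus_half real_sqrt_mult real_sqrt_divide)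
    also have "\<dots> \<le> sqrt 2 * r * sqrt (?\<omega> * K ^ CARD('n) * (G2 / ?V))"
    proof (intro mult_left_mono real_sqrt_le_mono)
      have "G2 * ?V \<le> G2 * (?\<omega> * K ^ CARD('n) * r ^ CARD('n))" using V G2 by (intro mult_left_mono)
      then show "G2 / r ^ CARD('n) \<le> ?\<omega> * K ^ CARD('n) * (G2 / ?V)"
        using V0 r by (simp add: field_simps)
    qed (use r in auto)
    also have "\<dots> = sqrt 2 * sqrt (?\<omega> * K ^ CARD('n)) * r * sqrt (G2 / ?V)"
      unfolding real_sqrt_mult[of "?\<omega> * K ^ CARD('n)" "G2 / ?V"] by (simp only: ac_simps)
    finally have "2 powr (1 / (2 * k)) * A \<le> 2 powr (1 / (2 * k)) * ((C\<^sub>1 * M') powr (1 / p) *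
        (sqrt 2 * sqrt (?\<omega> * K ^ CARD('n)) * r * sqrt (G2 / ?V)))"
      unfolding A_def by (intro mult_left_mono) auto
    also have "\<dots> = C * r * sqrt (G2 / ?V)" by (simp add: C_def)
    finally show ?thesis using G2 V0 by (simp add: avg_eq powr_half_sqrt)
  qed
  show "set_integrable \<sigma> ?\<Delta> (\<lambda>z. \<bar>Tr u z - ?a\<bar> powr (2 * k)) \<and>
      (avg \<sigma> ?\<Delta> (\<lambda>z. \<bar>Tr u z - ?a\<bar> powr (2 * k))) powr (1 / (2 * k))
      \<le> C * r * (avg lebesgue ?U (\<lambda>x. (norm (?g x))\<^sup>2)) powr (1 / 2)"
    using pm final by linarith
  qed
  qed
  qed
qed

end
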